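(* Let $n\ge 2$ be an integer, let $1\le p,q<\infty$, and let $p',q'\in(1,\infty]$ be the conjugate exponents of $p,q$. There exists a constant $C_n>0$, independent of $F$, such that $$\|(F\,d\sigma_n)^{\vee}\|_{L^{p'}(\mathbb{R}^{2n})}=\left\|\int_{\mathbb{T}^n}e^{2\pi i x\cdot\xi}F(\xi)\,d\sigma_n(\xi)\right\|_{L^{p'}(\mathbb{R}^{2n})}\le C_n\,\|F\|_{L^{q'}(\mathbb{T}^n,d\sigma_n)}$$ for all $F\in L^{q'}(\mathbb{T}^n,d\sigma_n)$ if and only if $p'>4$ and $q'\ge (p'/3)'$.
   Context: The $n$-torus is the subset $\mathbb{T}^n=\{(x_{1,1},x_{1,2},\dots,x_{n,1},x_{n,2})\in\mathbb{R}^{2n}: x_{\ell,1}^2+x_{\ell,2}^2=1,\ 1\le\ell\le n\}=(\mathbb{S}^1)^n$ of $\mathbb{R}^{2n}$. It carries the product surface measure $d\sigma_n=\bigotimes_{j=1}^n d\sigma(\xi_{j,1},\xi_{j,2})$, where on $\mathbb{S}^1$ the measure $d\sigma$ is arc length normalized to total mass 1, i.e. $d\sigma(\xi_1,\xi_2)=d\varkappa$ for $(\xi_1,\xi_2)=(\cos 2\pi\varkappa,\sin 2\pi\varkappa)$, $0\le\varkappa<1$. For $F\in L^{q'}(\mathbb{T}^n,d\sigma_n)\subset L^1(\mathbb{T}^n,d\sigma_n)$, $(F\,d\sigma_n)^{\vee}(x)=\int_{\mathbb{T}^n}e^{2\pi i x\cdot\xi}F(\xi)\,d\sigma_n(\xi)$,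 $x\in\mathbb{R}^{2n}$, is the inverse Fourier transform of the measure $F\,d\sigma_n$. The conjugate exponent of $r$ is $r'=r/(r-1)$, with $1'=\infty$ and $\infty'=1$; in particular $(p'/3)'=1$ when $p'=\infty$. The constant $C_n$ may depend on $n,p,q$. The condition $q'\ge(p'/3)'$ is only considered together with $p'>4$, so that $p'/3>1$. *)

theory Defs
  imports "HOL-Probability.Probability"
begin

section \<open>Conjugate exponents and Lebesgue norms\<close>

text \<open>The two endpoint cases are spelled out because \<open>ereal\<close> division gives \<open>\<infinity> / \<infinity> = 0\<close>.\<close>

definition conj_exp :: "ereal \<Rightarrow> ereal" where
  "conj_exp r = (if r = 1 then \<infinity> else if r = \<infinity> then 1 else r / (r - 1))"

text \<open>Norms take values in \<open>[0, \<infinity>]\<close>, so that a function outside \<open>L\<^sup>r\<close> has norm \<open>\<infinity>\<close>.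
  The real-valued \<open>powr\<close> is applied only to finite integrals. Exponents are meant to
  satisfy \<open>1 \<le> r \<le> \<infinity>\<close>.\<close>

definition Lp_norm :: "ereal \<Rightarrow> 'a measure \<Rightarrow> ('a \<Rightarrow> 'b::real_normed_vector) \<Rightarrow> ennreal" where
  "Lp_norm r M f =
    (if r = \<infinity> then esssup M (\<lambda>x. ennreal (norm (f x)))
     else let I = \<integral>\<^sup>+x. ennreal (norm (f x) powr real_of_ereal r) \<partial>M
          in if I = \<infinity> then \<infinity> else ennreal (enn2real I powr (1 / real_of_ereal r)))"

definition Lp_space :: "ereal \<Rightarrow> 'a measure \<Rightarrow> ('a \<Rightarrow> 'b::real_normed_vector) set" where
  "Lp_space r M = {f \<in> borel_measurable M. Lp_norm r M f < \<infinity>}"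

lemma conj_exp_1 [simp]: "conj_exp 1 = \<infinity>"
  by (simp add: conj_exp_def)

lemma conj_exp_PInf [simp]: "conj_exp \<infinity> = 1"
  by (simp add: conj_exp_def)

lemma conj_exp_ereal: "r \<noteq> 1 \<Longrightarrow> conj_exp (ereal r) = ereal (r / (r - 1))"
  by (simp add: conj_exp_def one_ereal_def)

section \<open>The torus and its surface measure\<close>

text \<open>\<open>\<real>\<^sup>2\<^sup>n\<close> is the Euclidean space \<open>(real \<times> real)^'n\<close> with \<open>n = CARD('n)\<close>:
  the components of \<open>x $ l\<close> are \<open>x\<^sub>l\<^sub>,\<^sub>1\<close> and \<open>x\<^sub>l\<^sub>,\<^sub>2\<close>.\<close>

definition circle :: "(real \<times> real) set" where
  "circle = {(a, b). a\<^sup>2 + b\<^sup>2 = 1}"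

definition torus :: "((real \<times> real) ^ 'n::finite) set" where
  "torus = {x. \<forall>l. (fst (x $ l))\<^sup>2 + (snd (x $ l))\<^sup>2 = 1}"

definition circle_measure :: "(real \<times> real) measure" where
  "circle_measure =
    distr (restrict_space lborel {0..<1}) (restrict_space borel circle)
      (\<lambda>t. (cos (2 * pi * t), sin (2 * pi * t)))"

text \<open>The library's product measure lives on functions \<open>'n \<Rightarrow> real \<times> real\<close>; \<open>vec_lambda\<close>
  transports it to vectors. The underlying space of the result is the torus itself, so the
  values of a function outside the torus play no role.\<close>

definition torus_measure :: "((real \<times> real) ^ 'n::finite) measure" where
  "torus_measure = distr (Pi\<^sub>M UNIV (\<lambda>_. circle_measure)) (restrict_space borel torus) vec_lambda"

lemma space_circle_measure [simp]: "space circle_measure = circle"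
  by (simp add: circle_measure_def space_restrict_space)

lemma sets_circle_measure [simp, measurable_cong]:
  "sets circle_measure = sets (restrict_space borel circle)"
  by (simp add: circle_measure_def)

lemma space_torus_measure [simp]: "space torus_measure = torus"
  by (simp add: torus_measure_def space_restrict_space)

lemma sets_torus_measure [simp, measurable_cong]:
  "sets torus_measure = sets (restrict_space borel torus)"
  by (simp add: torus_measure_def)

lemma measurable_circle_param [measurable]:
  "(\<lambda>t. (cos (2 * pi * t), sin (2 * pi * t)))
     \<in> restrict_space lborel {0..<1} \<rightarrow>\<^sub>M restrict_space borel circle"
proof (rule measurable_restrict_space2)
  have "(\<lambda>t::real. (cos (2 * pi * t), sin (2 * pi * t))) \<in> borel_measurable borel"
    by (intro borel_measurable_continuous_onI continuous_intros)
  then show "(\<lambda>t. (cos (2 * pi * t), sin (2 * pi * t)))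
      \<in> borel_measurable (restrict_space lborel {0..<1})"
    by (intro measurable_restrict_space1) simp
qed (auto simp: circle_def)

lemma prob_space_circle_measure: "prob_space circle_measure"
  unfolding circle_measure_def
  by (rule prob_space.prob_space_distr[OF _ measurable_circle_param], rule prob_spaceI)
     (simp add: space_restrict_space emeasure_restrict_space)

lemma measurable_vec_lambda_circle [measurable]:
  "vec_lambda \<in> Pi\<^sub>M (UNIV :: 'n::finite set) (\<lambda>_. circle_measure)
     \<rightarrow>\<^sub>M restrict_space borel (torus :: ((real \<times> real) ^ 'n) set)"
proof (rule measurable_restrict_space2)
  have comp: "(\<lambda>f. f l) \<in> borel_measurable (Pi\<^sub>M (UNIV :: 'n set) (\<lambda>_. circle_measure))" for l
  proof -
    have "(\<lambda>x. x) \<in> borel_measurable circle_measure"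
      by (subst measurable_cong_sets[OF sets_circle_measure refl])
         (simp add: measurable_restrict_space1)
    moreover have "(\<lambda>f. f l) \<in> Pi\<^sub>M (UNIV :: 'n set) (\<lambda>_. circle_measure) \<rightarrow>\<^sub>M circle_measure"
      by (rule measurable_component_singleton) simp
    ultimately show ?thesis
      by (rule measurable_compose[rotated])
  qed
  show "vec_lambda \<in> borel_measurable (Pi\<^sub>M (UNIV :: 'n set) (\<lambda>_. circle_measure))"
  proof (subst borel_measurable_euclidean_space, rule ballI)
    fix b :: "(real \<times> real) ^ 'n"
    have "(\<lambda>f. vec_lambda f \<bullet> b) = (\<lambda>f. \<Sum>l\<in>UNIV. f l \<bullet> (b $ l))"
      by (simp add: inner_vec_def)
    then show "(\<lambda>f. vec_lambda f \<bullet> b) \<in> borel_measurable (Pi\<^sub>M UNIV (\<lambda>_. circle_measure))"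
      using comp by simp
  qed
  show "vec_lambda \<in> space (Pi\<^sub>M (UNIV :: 'n set) (\<lambda>_. circle_measure)) \<rightarrow> torus"
    by (force simp: space_PiM PiE_iff torus_def circle_def split: prod.splits)
qed

lemma prob_space_torus_measure: "prob_space torus_measure"
  unfolding torus_measure_def
  by (rule prob_space.prob_space_distr[OF prob_space_PiM measurable_vec_lambda_circle])
     (rule prob_space_circle_measure)

section \<open>Inverse Fourier transform of the measure \<open>F d\<mu>\<close>\<close>

definition inv_fourier ::
  "'a::euclidean_space measure \<Rightarrow> ('a \<Rightarrow> complex) \<Rightarrow> 'a \<Rightarrow> complex" where
  "inv_fourier \<mu> F x =
    (LINT \<xi>|\<mu>. exp (2 * complex_of_real pi * \<i> * complex_of_real (x \<bullet> \<xi>)) * F \<xi>)"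

end

theory Submission
  imports Defs
begin

text \<open>
  Write \<open>r = p'\<close>, let \<open>\<sigma>\<close> be the surface measure and \<open>E F\<close> the inverse Fourier transform of \<open>F d\<sigma>\<close>. Then
  \<open>(E F)\<^sup>2\<close> is the transform of the image of \<open>(F d\<sigma>) \<otimes> (F d\<sigma>)\<close> under \<open>(\<xi>, \<eta>) \<mapsto> \<xi> + \<eta>\<close>, a map whose Jacobian is, up to a constant,
  \<open>J(\<xi>, \<eta>) = \<Prod>\<^sub>l \<bar>det (\<xi>\<^sub>l, \<eta>\<^sub>l)\<bar>\<close>. The Hausdorff--Young inequality with exponent \<open>r / 2 > 2\<close> bounds the norm of
  \<open>(E F)\<^sup>2\<close> by \<open>\<integral>\<integral> \<bar>F(\<xi>)\<bar>\<^sup>1\<^sup>+\<^sup>c \<bar>F(\<eta>)\<bar>\<^sup>1\<^sup>+\<^sup>c J\<^sup>-\<^sup>c d\<sigma> d\<sigma>\<close>, \<open>c = 2 / (r - 2)\<close>, to which the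
  Hardy--Littlewood--Sobolev inequality applies one coordinate at a time; since \<open>c < 1\<close> exactly when \<open>r > 4\<close>, this
  gives the endpoint \<open>q' = (r / 3)'\<close>, and larger \<open>q'\<close> follow because \<open>\<sigma>\<close> has mass 1. Conversely, \<open>F = 1\<close>
  rules out \<open>r \<le> 4\<close>, and indicators of small caps rule out \<open>q' < (r / 3)'\<close>.\<close>

section \<open>Gaussians\<close>

text \<open>Addition of two torus points is never inverted. The Hausdorff--Young step asks only that
  the image of J d\<sigma> d\<sigma> under addition, averaged against a Gaussian, be bounded
  uniformly in centre and width. Gaussian, weight and \<sigma> all factor over the coordinates, so
  this is one estimate on pairs of points of the circle.

  Writing F(\<xi>) F(\<eta>) = G J makes the integral of |G|^(1+c) against J d\<sigma> d\<sigma>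
  produce exactly the kernel J^(-c), with 1 + c = (r/2)'. The Hardy--Littlewood--Sobolev exponent
  for this kernel is a = 2 / (2 - c), and (1 + c) a = r / (r - 3) = (r/3)', which is how the second
  condition arises.

  The exponent 4 is delicate: the transform of arc length in the plane decays like |x|^(-1/2), so
  its fourth power diverges only logarithmically. Instead of Bessel asymptotics, the treatment of F
  = 1 compares a damped L^2 norm with a hypothetical L^4 norm. Both thresholds are independent of n
  because every gain and loss occurs at the same rate in each coordinate.\<close>

lemma gaussian_fourier_real:
  fixes e y :: real
  assumes e: "e > 0"
  shows "integrable lborel (\<lambda>x. complex_of_real (exp (- (pi * e\<^sup>2 * x\<^sup>2))) * cis (2 * pi * (x * y)))" (is ?int)
    and "(LINT x|lborel. complex_of_real (exp (- (pi * e\<^sup>2 * x\<^sup>2))) * cis (2 * pi * (x * y))) =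
           complex_of_real (exp (- (pi * y\<^sup>2 / e\<^sup>2)) / e)" (is ?eq)
proof -
  \<comment> \<open>Substituting c x turns the weight into exp (- u^2 / 2), so that the integral
    becomes the characteristic function of the standard normal distribution at t.\<close>
  define c where "c = sqrt (2 * pi) * e"
  have c: "c > 0" "c\<^sup>2 = 2 * pi * e\<^sup>2"
    using e by (auto simp: c_def power_mult_distrib)
  define t where "t = 2 * pi * y / c"
  define g where "g = (\<lambda>x. std_normal_density x *\<^sub>R iexp (t * x))"
  have eq: "g (0 + c * x) = (1 / sqrt (2 * pi)) *\<^sub>R
      (complex_of_real (exp (- (pi * e\<^sup>2 * x\<^sup>2))) * cis (2 * pi * (x * y)))" for x
  proof -
    have q: "- (c * x)\<^sup>2 / 2 = - (pi * e\<^sup>2 * x\<^sup>2)"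
      using c(2) by (simp add: power_mult_distrib)
    have ph: "t * (c * x) = 2 * pi * (x * y)"
      using c(1) by (simp add: t_def)
    show ?thesis
      unfolding g_def cis_conv_exp[symmetric] add_0 ph std_normal_density_def q scaleR_conv_of_real
      by simp
  qed
  have "integrable lborel std_normal_density"
    using integrable_std_normal_moment[of 0] by simp
  then have gi: "integrable lborel g"
    unfolding g_def
    by (rule Bochner_Integration.integrable_bound) (auto simp: g_def)
  have gv: "(LINT x|lborel. g x) = exp (- (t\<^sup>2 / 2))"
  proof -
    have "(LINT x|lborel. g x) = char std_normal_distribution t"
      unfolding char_def g_def by (subst integral_density) auto
    then show ?thesis by (simp add: char_std_normal_distribution exp_of_real)
  qed
  from gi c have "integrable lborel (\<lambda>x. g (0 + c * x))"
    by (subst lborel_integrable_real_affine_iff) auto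
  then have "integrable lborel (\<lambda>x. sqrt (2 * pi) *\<^sub>R g (0 + c * x))"
    by simp
  then show ?int unfolding eq by simp
  have "t\<^sup>2 / 2 = pi * y\<^sup>2 / e\<^sup>2"
    using e c(1) unfolding t_def by (simp add: power_divide c(2) power_mult_distrib) (simp add: power2_eq_square)
  then have "exp (- (pi * y\<^sup>2 / e\<^sup>2)) = (LINT x|lborel. g x)"
    using gv by (simp add: exp_of_real)
  also have "\<dots> = c *\<^sub>R (LINT x|lborel. g (0 + c * x))"
    using c by (subst lborel_integral_real_affine[of c _ 0]) auto
  also have "\<dots> = e *\<^sub>R (LINT x|lborel. complex_of_real (exp (- (pi * e\<^sup>2 * x\<^sup>2))) * cis (2 * pi * (x * y)))"
    unfolding eq by (simp add: c_def scaleR_conv_of_real)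
  finally show ?eq using e by (simp add: scaleR_conv_of_real field_simps)
qed

text \<open>The Fourier transform of exp (- \<pi> e^2 |x|^2): a density of total mass 1 that
  concentrates at 0 as e tends to 0. A small e thus means weak damping in x and sharp localisation
  in y.\<close>

definition gauss :: "real \<Rightarrow> 'a::euclidean_space \<Rightarrow> real" where
  "gauss e y = exp (- (pi * (norm y)\<^sup>2 / e\<^sup>2)) / e ^ DIM('a)"

lemma gauss_nonneg [simp]: "e > 0 \<Longrightarrow> 0 \<le> gauss e y"
  by (simp add: gauss_def)

lemma gauss_minus: "gauss e (x - y) = gauss e (y - x)"
  by (simp add: gauss_def norm_minus_commute)

lemma borel_measurable_gauss [measurable]: "gauss e \<in> borel_measurable borel"
  unfolding gauss_def by measurable

lemma gauss_le: "e > 0 \<Longrightarrow> gauss e (y::'a::euclidean_space) \<le> 1 / e ^ DIM('a)"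
  unfolding gauss_def by (intro divide_right_mono) auto

text \<open>Weight and character are both products over an orthonormal basis, and
  \<open>lborel\<close> is the image of a product of measures on the line, so the real case
  multiplies up.\<close>

lemma gaussian_fourier:
  fixes y :: "'a::euclidean_space"
  assumes e: "e > 0"
  shows "integrable lborel (\<lambda>x::'a. complex_of_real (exp (- (pi * e\<^sup>2 * (norm x)\<^sup>2))) * cis (2 * pi * (x \<bullet> y)))" (is ?int)
    and "(LINT x|lborel. complex_of_real (exp (- (pi * e\<^sup>2 * (norm x)\<^sup>2))) * cis (2 * pi * (x \<bullet> y))) =
           complex_of_real (gauss e y)" (is ?eq)
proof -
  interpret product_sigma_finite "\<lambda>_::'a. lborel :: real measure" ..
  define G where "G = (\<lambda>x::'a. complex_of_real (exp (- (pi * e\<^sup>2 * (norm x)\<^sup>2))) * cis (2 * pi * (x \<bullet> y)))"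
  define h where "h = (\<lambda>(b::'a) x. complex_of_real (exp (- (pi * e\<^sup>2 * x\<^sup>2))) * cis (2 * pi * (x * (y \<bullet> b))))"
  have cis_sum: "cis (sum a A) = (\<Prod>i\<in>A. cis (a i))" if "finite A" for a and A :: "'a set"
    using that by (induction A) (auto simp flip: cis_mult)
  have comp: "(\<Sum>c\<in>Basis. f c *\<^sub>R c) \<bullet> b = f b" if "b \<in> Basis" for f :: "'a \<Rightarrow> real" and b
    using that by simp
  have Gh: "G (\<Sum>b\<in>Basis. f b *\<^sub>R b) = (\<Prod>b\<in>Basis. h b (f b))" for f
  proof -
    let ?x = "\<Sum>b\<in>Basis. f b *\<^sub>R b"
    have "(norm ?x)\<^sup>2 = (\<Sum>b\<in>Basis. (f b)\<^sup>2)"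
      by (simp add: norm_eq_sqrt_inner euclidean_inner[of ?x ?x] power2_eq_square sum_nonneg)
    moreover have "?x \<bullet> y = (\<Sum>b\<in>Basis. f b * (y \<bullet> b))"
      by (simp add: euclidean_inner[of ?x y])
    ultimately show ?thesis
      unfolding G_def h_def
      by (simp add: prod.distrib sum_distrib_left cis_sum flip: sum_negf exp_sum of_real_prod) 
  qed
  have meas: "G \<in> borel_measurable borel"
    unfolding G_def cis_conv_exp by measurable
  have hi: "integrable lborel (h b)" and hv: "(LINT x|lborel. h b x) = complex_of_real (exp (- (pi * (y \<bullet> b)\<^sup>2 / e\<^sup>2)) / e)" for b
    using gaussian_fourier_real[OF e] by (auto simp: h_def)
  have [measurable]: "(\<lambda>f. \<Sum>b\<in>Basis. f b *\<^sub>R b) \<in> (\<Pi>\<^sub>M b\<in>(Basis::'a set). (lborel::real measure)) \<rightarrow>\<^sub>M borel"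
    by measurable
  show ?int
    unfolding G_def[symmetric]
    by (subst lborel_eq, subst integrable_distr_eq[OF _ meas])
       (use product_integrable_prod[OF finite_Basis hi] in \<open>simp_all add: Gh\<close>)
  have "(LINT x|lborel. G x) = (\<Prod>b\<in>Basis. LINT x|lborel. h b x)"
    by (subst lborel_eq, subst integral_distr[OF _ meas])
       (use product_integral_prod[OF finite_Basis hi] in \<open>simp_all add: Gh\<close>)
  also have "\<dots> = complex_of_real (\<Prod>b\<in>Basis. exp (- (pi * (y \<bullet> b)\<^sup>2 / e\<^sup>2)) / e)"
    by (simp add: hv)
  also have "(\<Prod>b\<in>Basis. exp (- (pi * (y \<bullet> b)\<^sup>2 / e\<^sup>2)) / e) = gauss e y"
  proof -
    have "(norm y)\<^sup>2 = (\<Sum>b\<in>Basis. (y \<bullet> b)\<^sup>2)"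
      by (simp add: norm_eq_sqrt_inner euclidean_inner[of y y] power2_eq_square sum_nonneg)
    then show ?thesis
      by (simp add: gauss_def prod_dividef sum_distrib_left sum_divide_distrib flip: exp_sum sum_negf)
  qed
  finally show ?eq by (simp add: G_def)
qed

lemma gaussian_integral:
  fixes e :: real
  assumes "e > 0"
  shows "integrable lborel (\<lambda>x::'a::euclidean_space. exp (- (pi * e\<^sup>2 * (norm x)\<^sup>2)))"
    and "(LINT x|lborel. exp (- (pi * e\<^sup>2 * (norm (x::'a))\<^sup>2))) = 1 / e ^ DIM('a)"
proof -
  have i: "integrable lborel (\<lambda>x::'a. complex_of_real (exp (- (pi * e\<^sup>2 * (norm x)\<^sup>2))))"
    using gaussian_fourier(1)[OF assms, of "0::'a"] by simp
  show i': "integrable lborel (\<lambda>x::'a. exp (- (pi * e\<^sup>2 * (norm x)\<^sup>2)))"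
    using integrable_Re[OF i] by simp
  have "complex_of_real (LINT x|lborel. exp (- (pi * e\<^sup>2 * (norm (x::'a))\<^sup>2))) = complex_of_real (1 / e ^ DIM('a))"
    using gaussian_fourier(2)[OF assms, of "0::'a"] by (simp add: gauss_def del: of_real_exp flip: integral_complex_of_real)
  then show "(LINT x|lborel. exp (- (pi * e\<^sup>2 * (norm (x::'a))\<^sup>2))) = 1 / e ^ DIM('a)"
    by (simp only: of_real_eq_iff)
qed

section \<open>Oscillatory integrals against a finite measure\<close>

lemma (in pair_sigma_finite) integral_product_mult:
  fixes f :: "'a \<Rightarrow> complex" and g :: "'b \<Rightarrow> complex"
  assumes f: "integrable M1 f" and g: "integrable M2 g"
  shows "integrable (M1 \<Otimes>\<^sub>M M2) (\<lambda>(x, y). f x * g y)"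
    and "(LINT (x, y)|(M1 \<Otimes>\<^sub>M M2). f x * g y) = (LINT x|M1. f x) * (LINT y|M2. g y)"
proof -
  note [measurable] = borel_measurable_integrable[OF f] borel_measurable_integrable[OF g]
  show i: "integrable (M1 \<Otimes>\<^sub>M M2) (\<lambda>(x, y). f x * g y)"
    by (rule Fubini_integrable) (use f g in \<open>auto simp: norm_mult integrable_mult_right integrable_mult_left\<close>)
  show "(LINT (x, y)|(M1 \<Otimes>\<^sub>M M2). f x * g y) = (LINT x|M1. f x) * (LINT y|M2. g y)"
    using integral_fst[of "\<lambda>x y. f x * g y"] i by simp
qed

text \<open>The inverse Fourier transform of the image under \<Phi> of the complex measure G d\<nu>.
  Keeping \<Phi> separate lets the same results serve a single torus point (\<Phi> =
  \<open>vec_lambda\<close>) and the sum of two points under a weighted \<nu>, without forming the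
  image measure.\<close>

definition osc :: "'w measure \<Rightarrow> ('w \<Rightarrow> 'a::euclidean_space) \<Rightarrow> ('w \<Rightarrow> complex) \<Rightarrow> 'a \<Rightarrow> complex" where
  "osc \<nu> \<Phi> G x = (LINT w|\<nu>. cis (2 * pi * (x \<bullet> \<Phi> w)) * G w)"

lemma cis_measurable [measurable]: "cis \<in> borel_measurable borel"
  by (intro borel_measurable_continuous_onI continuous_intros)

lemma integrable_osc:
  fixes \<Phi> :: "'w \<Rightarrow> 'a::euclidean_space" and G :: "'w \<Rightarrow> complex"
  assumes [measurable]: "\<Phi> \<in> borel_measurable \<nu>" and G: "integrable \<nu> G"
  shows "integrable \<nu> (\<lambda>w. cis (2 * pi * (x \<bullet> \<Phi> w)) * G w)"
proof -
  note [measurable] = borel_measurable_integrable[OF G]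
  have "(\<lambda>w. cis (2 * pi * (x \<bullet> \<Phi> w)) * G w) \<in> borel_measurable \<nu>"
    by measurable
  then show ?thesis
    by (rule Bochner_Integration.integrable_bound[OF G]) (auto simp: norm_mult)
qed

lemma norm_osc_le:
  assumes "\<Phi> \<in> borel_measurable \<nu>" "integrable \<nu> G"
  shows "norm (osc \<nu> \<Phi> G x) \<le> (LINT w|\<nu>. norm (G w))"
proof -
  have "norm (osc \<nu> \<Phi> G x) \<le> (LINT w|\<nu>. norm (cis (2 * pi * (x \<bullet> \<Phi> w)) * G w))"
    unfolding osc_def by (rule integral_norm_bound)
  then show ?thesis by (simp add: norm_mult)
qed

lemma borel_measurable_osc:
  assumes [measurable]: "\<Phi> \<in> borel_measurable \<nu>" "G \<in> borel_measurable \<nu>" and "sigma_finite_measure \<nu>"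
  shows "osc \<nu> \<Phi> G \<in> borel_measurable borel"
proof -
  interpret sigma_finite_measure \<nu> by fact
  show ?thesis
    unfolding osc_def by measurable
qed

lemma osc_add:
  assumes "\<Phi> \<in> borel_measurable \<nu>" "integrable \<nu> F" "integrable \<nu> G"
  shows "osc \<nu> \<Phi> (\<lambda>w. F w + G w) x = osc \<nu> \<Phi> F x + osc \<nu> \<Phi> G x"
  unfolding osc_def distrib_left
  by (intro Bochner_Integration.integral_add integrable_osc assms)

text \<open>The Gaussian weight makes Fubini applicable.\<close>

lemma damped_plancherel:
  fixes \<Phi> :: "'w \<Rightarrow> 'a::euclidean_space"
  assumes "finite_measure \<nu>" and \<Phi>[measurable]: "\<Phi> \<in> borel_measurable \<nu>" and G: "integrable \<nu> G" and e: "e > 0"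
  shows "integrable lborel (\<lambda>x. (norm (osc \<nu> \<Phi> G x))\<^sup>2 * exp (- (pi * e\<^sup>2 * (norm x)\<^sup>2)))"
    and "integrable (\<nu> \<Otimes>\<^sub>M \<nu>) (\<lambda>(u, v). G u * cnj (G v) * gauss e (\<Phi> u - \<Phi> v))"
    and "complex_of_real (LINT x|lborel. (norm (osc \<nu> \<Phi> G x))\<^sup>2 * exp (- (pi * e\<^sup>2 * (norm x)\<^sup>2))) =
      (LINT (u, v)|(\<nu> \<Otimes>\<^sub>M \<nu>). G u * cnj (G v) * gauss e (\<Phi> u - \<Phi> v))"
proof -
  interpret finite_measure \<nu> by fact
  interpret P: pair_sigma_finite \<nu> \<nu> ..
  interpret Q: pair_sigma_finite "lborel :: 'a measure" "\<nu> \<Otimes>\<^sub>M \<nu>"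
    by (intro pair_sigma_finite.intro P.sigma_finite_measure_axioms sigma_finite_lborel)
  define w where "w = (\<lambda>x::'a. exp (- (pi * e\<^sup>2 * (norm x)\<^sup>2)))"
  have w: "integrable lborel w" "\<And>x. w x \<ge> 0"
    using gaussian_integral(1)[OF e, where 'a='a] by (auto simp: w_def)
  note [measurable] = borel_measurable_integrable[OF G] borel_measurable_integrable[OF w(1)]
  define K where "K = (\<lambda>(u, v). G u * cnj (G v))"
  have K: "integrable (\<nu> \<Otimes>\<^sub>M \<nu>) K"
    unfolding K_def using G by (intro P.integral_product_mult) auto
  note [measurable] = borel_measurable_integrable[OF K]
  \<comment> \<open>The integrand after the square is expanded as a double integral. Integrating
    over p first gives the damped square (\<open>sq\<close>), over x first the kernel
    \<open>gauss\<close> (\<open>inn\<close>).\<close>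
  define R where "R = (\<lambda>x p. complex_of_real (w x) * cis (2 * pi * (x \<bullet> (\<Phi> (fst p) - \<Phi> (snd p)))) * K p)"
  have R: "integrable (lborel \<Otimes>\<^sub>M (\<nu> \<Otimes>\<^sub>M \<nu>)) (\<lambda>(x, p). R x p)"
  proof (rule Q.Fubini_integrable)
    show "(\<lambda>(x, p). R x p) \<in> borel_measurable (lborel \<Otimes>\<^sub>M (\<nu> \<Otimes>\<^sub>M \<nu>))"
      unfolding R_def by measurable
    have n: "norm (R x p) = w x * norm (K p)" for x p
      by (simp add: R_def norm_mult w(2))
    show "integrable lborel (\<lambda>x. LINT p|(\<nu> \<Otimes>\<^sub>M \<nu>). norm (case (x, p) of (x, p) \<Rightarrow> R x p))"
      using w(1) by (simp add: n)
    show "AE x in lborel. integrable (\<nu> \<Otimes>\<^sub>M \<nu>) (\<lambda>p. case (x, p) of (x, p) \<Rightarrow> R x p)"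
    proof (intro AE_I2)
      fix x
      have "(\<lambda>p. R x p) \<in> borel_measurable (\<nu> \<Otimes>\<^sub>M \<nu>)"
        unfolding R_def by measurable
      then show "integrable (\<nu> \<Otimes>\<^sub>M \<nu>) (\<lambda>p. case (x, p) of (x, p) \<Rightarrow> R x p)"
        by (intro Bochner_Integration.integrable_bound[OF integrable_mult_right[OF integrable_norm[OF K], of "w x"]])
          (auto simp: n w(2))
    qed
  qed
  have sq: "complex_of_real ((norm (osc \<nu> \<Phi> G x))\<^sup>2 * w x) = (LINT p|(\<nu> \<Otimes>\<^sub>M \<nu>). R x p)" for x
  proof -
    let ?f = "\<lambda>u. cis (2 * pi * (x \<bullet> \<Phi> u)) * G u"
    have f: "integrable \<nu> ?f" by (intro integrable_osc \<Phi> G)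
    have "complex_of_real ((norm (osc \<nu> \<Phi> G x))\<^sup>2) = (LINT u|\<nu>. ?f u) * (LINT v|\<nu>. cnj (?f v))"
      unfolding complex_norm_square osc_def by (simp only: Bochner_Integration.integral_cnj)
    also have "\<dots> = (LINT (u, v)|(\<nu> \<Otimes>\<^sub>M \<nu>). ?f u * cnj (?f v))"
      using f by (intro P.integral_product_mult(2)[symmetric]) (simp_all only: integrable_cnj)
    finally have "complex_of_real ((norm (osc \<nu> \<Phi> G x))\<^sup>2 * w x) =
        complex_of_real (w x) * (LINT (u, v)|(\<nu> \<Otimes>\<^sub>M \<nu>). ?f u * cnj (?f v))"
      by simp
    also have "\<dots> = (LINT (u, v)|(\<nu> \<Otimes>\<^sub>M \<nu>). complex_of_real (w x) * (?f u * cnj (?f v)))"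
      unfolding case_prod_unfold by (rule integral_mult_right_zero[symmetric])
    also have "\<dots> = (LINT p|(\<nu> \<Otimes>\<^sub>M \<nu>). R x p)"
    proof (rule Bochner_Integration.integral_cong[OF refl], clarify)
      fix u v
      have "cis (2 * pi * (x \<bullet> \<Phi> u)) * cnj (cis (2 * pi * (x \<bullet> \<Phi> v))) = cis (2 * pi * (x \<bullet> (\<Phi> u - \<Phi> v)))"
        by (simp add: cis_cnj cis_mult inner_diff_right algebra_simps)
      then show "complex_of_real (w x) * (?f u * cnj (?f v)) = R x (u, v)"
        by (simp add: R_def K_def)
    qed
    finally show ?thesis .
  qed
  have inn: "(LINT x|lborel. R x p) = K p * complex_of_real (gauss e (\<Phi> (fst p) - \<Phi> (snd p)))" for p
    unfolding R_def w_def by (simp add: gaussian_fourier(2)[OF e] del: of_real_exp)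
  have "integrable lborel (\<lambda>x. complex_of_real ((norm (osc \<nu> \<Phi> G x))\<^sup>2 * w x))"
    unfolding sq using Q.integrable_fst'[OF R] by simp
  from integrable_Re[OF this]
  show "integrable lborel (\<lambda>x. (norm (osc \<nu> \<Phi> G x))\<^sup>2 * exp (- (pi * e\<^sup>2 * (norm x)\<^sup>2)))"
    by (simp add: w_def)
  have "integrable (\<nu> \<Otimes>\<^sub>M \<nu>) (\<lambda>p. K p * complex_of_real (gauss e (\<Phi> (fst p) - \<Phi> (snd p))))"
    using Q.integrable_snd[OF R] by (simp add: inn)
  then show "integrable (\<nu> \<Otimes>\<^sub>M \<nu>) (\<lambda>(u, v). G u * cnj (G v) * gauss e (\<Phi> u - \<Phi> v))"
    by (simp add: K_def case_prod_unfold)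
  have "complex_of_real (LINT x|lborel. (norm (osc \<nu> \<Phi> G x))\<^sup>2 * w x) = (LINT x|lborel. LINT p|(\<nu> \<Otimes>\<^sub>M \<nu>). R x p)"
    by (subst integral_complex_of_real[symmetric]) (simp only: sq)
  also have "\<dots> = (LINT p|(\<nu> \<Otimes>\<^sub>M \<nu>). LINT x|lborel. R x p)"
    by (rule Q.Fubini_integral[symmetric, OF R])
  finally show "complex_of_real (LINT x|lborel. (norm (osc \<nu> \<Phi> G x))\<^sup>2 * exp (- (pi * e\<^sup>2 * (norm x)\<^sup>2))) =
      (LINT (u, v)|(\<nu> \<Otimes>\<^sub>M \<nu>). G u * cnj (G v) * gauss e (\<Phi> u - \<Phi> v))"
    by (simp add: inn w_def K_def case_prod_unfold)
qed

text \<open>The last hypothesis says that the image of \<nu> under \<Phi> has density at most C,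
  phrased through Gaussian averages at all scales. The damped Plancherel identity turns the left
  side into a quadratic form with kernel \<open>gauss e (\<Phi> u - \<Phi> v)\<close>; the
  arithmetic-geometric mean inequality bounds it as in Schur's test, uniformly in e, and Fatou's
  lemma removes the damping.\<close>

lemma osc_L2_bound:
  fixes \<Phi> :: "'w \<Rightarrow> 'a::euclidean_space"
  assumes "finite_measure \<nu>" and \<Phi>[measurable]: "\<Phi> \<in> borel_measurable \<nu>" and G: "integrable \<nu> G"
    and C: "\<And>e y. e > 0 \<Longrightarrow> (\<integral>\<^sup>+v. ennreal (gauss e (y - \<Phi> v)) \<partial>\<nu>) \<le> C"
  shows "(\<integral>\<^sup>+x. ennreal ((norm (osc \<nu> \<Phi> G x))\<^sup>2) \<partial>lborel) \<le> C * (\<integral>\<^sup>+w. ennreal ((norm (G w))\<^sup>2) \<partial>\<nu>)"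
proof -
  interpret finite_measure \<nu> by fact
  interpret P: pair_sigma_finite \<nu> \<nu> ..
  note [measurable] = borel_measurable_integrable[OF G]
  have [measurable]: "osc \<nu> \<Phi> G \<in> borel_measurable borel"
    by (intro borel_measurable_osc sigma_finite_measure_axioms) auto
  define I where "I = (\<integral>\<^sup>+w. ennreal ((norm (G w))\<^sup>2) \<partial>\<nu>)"
  define w where "w = (\<lambda>e x::'a. exp (- (pi * e\<^sup>2 * (norm x)\<^sup>2)))"
  have *: "(\<integral>\<^sup>+x. ennreal ((norm (osc \<nu> \<Phi> G x))\<^sup>2 * w e x) \<partial>lborel) \<le> C * I" if e: "e > 0" for e
  proof -
    note dp = damped_plancherel[OF assms(1) \<Phi> G e]
    let ?K = "\<lambda>u v. norm (G u) * norm (G v) * gauss e (\<Phi> u - \<Phi> v)"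
    have "(\<integral>\<^sup>+x. ennreal ((norm (osc \<nu> \<Phi> G x))\<^sup>2 * w e x) \<partial>lborel) =
        ennreal (LINT x|lborel. (norm (osc \<nu> \<Phi> G x))\<^sup>2 * w e x)"
      using dp(1) by (intro nn_integral_eq_integral) (auto simp: w_def)
    also have "\<dots> \<le> ennreal (LINT p|(\<nu> \<Otimes>\<^sub>M \<nu>). ?K (fst p) (snd p))"
    proof (rule ennreal_leI)
      have "(LINT x|lborel. (norm (osc \<nu> \<Phi> G x))\<^sup>2 * w e x) =
          norm (LINT (u, v)|(\<nu> \<Otimes>\<^sub>M \<nu>). G u * cnj (G v) * gauss e (\<Phi> u - \<Phi> v))"
        unfolding dp(3)[symmetric] norm_of_real by (simp add: w_def)
      also have "\<dots> \<le> (LINT p|(\<nu> \<Otimes>\<^sub>M \<nu>). norm (case p of (u, v) \<Rightarrow> G u * cnj (G v) * gauss e (\<Phi> u - \<Phi> v)))"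
        by (rule integral_norm_bound)
      also have "\<dots> = (LINT p|(\<nu> \<Otimes>\<^sub>M \<nu>). ?K (fst p) (snd p))"
        using e by (simp add: case_prod_unfold norm_mult)
      finally show "(LINT x|lborel. (norm (osc \<nu> \<Phi> G x))\<^sup>2 * w e x) \<le> (LINT p|(\<nu> \<Otimes>\<^sub>M \<nu>). ?K (fst p) (snd p))" .
    qed
    also have "\<dots> = (\<integral>\<^sup>+p. ennreal (?K (fst p) (snd p)) \<partial>(\<nu> \<Otimes>\<^sub>M \<nu>))"
      using integrable_norm[OF dp(2)] e
      by (intro nn_integral_eq_integral[symmetric]) (auto simp: case_prod_unfold norm_mult)
    also have "\<dots> \<le> (\<integral>\<^sup>+p. ennreal ((norm (G (fst p)))\<^sup>2 / 2) * ennreal (gauss e (\<Phi> (fst p) - \<Phi> (snd p)))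
        + ennreal ((norm (G (snd p)))\<^sup>2 / 2) * ennreal (gauss e (\<Phi> (snd p) - \<Phi> (fst p))) \<partial>(\<nu> \<Otimes>\<^sub>M \<nu>))"
    proof (rule nn_integral_mono, clarify)
      fix u v
      have "norm (G u) * norm (G v) \<le> (norm (G u))\<^sup>2 / 2 + (norm (G v))\<^sup>2 / 2"
        using sum_squares_bound[of "norm (G u)" "norm (G v)"] by simp
      from mult_right_mono[OF this, of "gauss e (\<Phi> u - \<Phi> v)"] e
      have "?K u v \<le> (norm (G u))\<^sup>2 / 2 * gauss e (\<Phi> u - \<Phi> v) + (norm (G v))\<^sup>2 / 2 * gauss e (\<Phi> v - \<Phi> u)"
        by (simp add: gauss_minus[of e "\<Phi> v"] distrib_right)
      then show "ennreal (?K (fst (u, v)) (snd (u, v))) \<le>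
          ennreal ((norm (G (fst (u, v))))\<^sup>2 / 2) * ennreal (gauss e (\<Phi> (fst (u, v)) - \<Phi> (snd (u, v))))
        + ennreal ((norm (G (snd (u, v))))\<^sup>2 / 2) * ennreal (gauss e (\<Phi> (snd (u, v)) - \<Phi> (fst (u, v))))"
        using e by (simp flip: ennreal_mult ennreal_plus)
    qed
    also have "\<dots> = (\<integral>\<^sup>+u. ennreal ((norm (G u))\<^sup>2 / 2) * (\<integral>\<^sup>+v. ennreal (gauss e (\<Phi> u - \<Phi> v)) \<partial>\<nu>) \<partial>\<nu>) +
        (\<integral>\<^sup>+v. ennreal ((norm (G v))\<^sup>2 / 2) * (\<integral>\<^sup>+u. ennreal (gauss e (\<Phi> v - \<Phi> u)) \<partial>\<nu>) \<partial>\<nu>)"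
    proof (subst nn_integral_add)
      have "(\<integral>\<^sup>+p. ennreal ((norm (G (fst p)))\<^sup>2 / 2) * ennreal (gauss e (\<Phi> (fst p) - \<Phi> (snd p))) \<partial>(\<nu> \<Otimes>\<^sub>M \<nu>)) =
          (\<integral>\<^sup>+u. \<integral>\<^sup>+v. ennreal ((norm (G u))\<^sup>2 / 2) * ennreal (gauss e (\<Phi> u - \<Phi> v)) \<partial>\<nu> \<partial>\<nu>)"
        by (subst nn_integral_fst[symmetric]) auto
      moreover have "(\<integral>\<^sup>+p. ennreal ((norm (G (snd p)))\<^sup>2 / 2) * ennreal (gauss e (\<Phi> (snd p) - \<Phi> (fst p))) \<partial>(\<nu> \<Otimes>\<^sub>M \<nu>)) =
          (\<integral>\<^sup>+v. \<integral>\<^sup>+u. ennreal ((norm (G v))\<^sup>2 / 2) * ennreal (gauss e (\<Phi> v - \<Phi> u)) \<partial>\<nu> \<partial>\<nu>)"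
        by (subst P.nn_integral_snd[symmetric]) auto
      ultimately show "(\<integral>\<^sup>+p. ennreal ((norm (G (fst p)))\<^sup>2 / 2) * ennreal (gauss e (\<Phi> (fst p) - \<Phi> (snd p))) \<partial>(\<nu> \<Otimes>\<^sub>M \<nu>)) +
          (\<integral>\<^sup>+p. ennreal ((norm (G (snd p)))\<^sup>2 / 2) * ennreal (gauss e (\<Phi> (snd p) - \<Phi> (fst p))) \<partial>(\<nu> \<Otimes>\<^sub>M \<nu>)) =
        (\<integral>\<^sup>+u. ennreal ((norm (G u))\<^sup>2 / 2) * (\<integral>\<^sup>+v. ennreal (gauss e (\<Phi> u - \<Phi> v)) \<partial>\<nu>) \<partial>\<nu>) +
        (\<integral>\<^sup>+v. ennreal ((norm (G v))\<^sup>2 / 2) * (\<integral>\<^sup>+u. ennreal (gauss e (\<Phi> v - \<Phi> u)) \<partial>\<nu>) \<partial>\<nu>)"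
        by (simp add: nn_integral_cmult)
    qed measurable
    also have "\<dots> \<le> (\<integral>\<^sup>+u. ennreal ((norm (G u))\<^sup>2 / 2) * C \<partial>\<nu>) + (\<integral>\<^sup>+v. ennreal ((norm (G v))\<^sup>2 / 2) * C \<partial>\<nu>)"
      by (intro add_mono nn_integral_mono mult_left_mono C e) auto
    also have "\<dots> = C * ((\<integral>\<^sup>+u. ennreal ((norm (G u))\<^sup>2 / 2) \<partial>\<nu>) + (\<integral>\<^sup>+u. ennreal ((norm (G u))\<^sup>2 / 2) \<partial>\<nu>))"
      by (subst (1 2) nn_integral_multc) (auto simp: distrib_left mult.commute)
    also have "\<dots> = C * I"
      unfolding I_def by (subst nn_integral_add[symmetric]) (auto simp flip: ennreal_plus)
    finally show ?thesis .
  qed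
  define u where "u = (\<lambda>k::nat. inverse (real (Suc k)))"
  have lim: "(\<lambda>k. ennreal ((norm (osc \<nu> \<Phi> G x))\<^sup>2 * w (u k) x)) \<longlonglongrightarrow> ennreal ((norm (osc \<nu> \<Phi> G x))\<^sup>2)" for x
  proof -
    have "u \<longlonglongrightarrow> 0" unfolding u_def by (rule LIMSEQ_inverse_real_of_nat)
    then have "(\<lambda>k. (norm (osc \<nu> \<Phi> G x))\<^sup>2 * w (u k) x) \<longlonglongrightarrow> (norm (osc \<nu> \<Phi> G x))\<^sup>2 * exp (- (pi * 0\<^sup>2 * (norm x)\<^sup>2))"
      unfolding w_def by (intro tendsto_intros)
    then show ?thesis by (intro tendsto_ennrealI) simp
  qed
  have "(\<integral>\<^sup>+x. ennreal ((norm (osc \<nu> \<Phi> G x))\<^sup>2) \<partial>lborel) =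
      (\<integral>\<^sup>+x. liminf (\<lambda>k. ennreal ((norm (osc \<nu> \<Phi> G x))\<^sup>2 * w (u k) x)) \<partial>lborel)"
    by (intro nn_integral_cong lim_imp_Liminf[symmetric] lim) simp
  also have "\<dots> \<le> liminf (\<lambda>k. \<integral>\<^sup>+x. ennreal ((norm (osc \<nu> \<Phi> G x))\<^sup>2 * w (u k) x) \<partial>lborel)"
    unfolding w_def by (rule nn_integral_liminf) measurable
  also have "\<dots> \<le> liminf (\<lambda>k. C * I)"
    by (intro Liminf_mono always_eventually allI *) (simp add: u_def)
  finally show ?thesis by (simp add: I_def Liminf_const)
qed

section \<open>Real interpolation from L^2 to higher exponents\<close>

lemma nn_integral_powr_Icc:
  fixes s c :: real
  assumes "s > -1" "c \<ge> 0"
  shows "(\<integral>\<^sup>+x. ennreal (x powr s) * indicator {0..c} x \<partial>lborel) = ennreal (c powr (s + 1) / (s + 1))"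
proof -
  have "(\<integral>\<^sup>+x. ennreal (indicator {0..c} x * x powr s) \<partial>lborel) = ennreal (c powr (s + 1) / (s + 1))"
    using assms by (intro nn_integral_has_integral_lebesgue has_integral_powr_from_0) auto
  moreover have "ennreal (indicator {0..c} x * x powr s) = ennreal (x powr s) * indicator {0..c} x" for x
    by (simp add: indicator_def)
  ultimately show ?thesis by simp
qed

lemma borel_measurable_indicator_Icc [measurable]:
  fixes f g :: "'a \<Rightarrow> real"
  assumes [measurable]: "f \<in> borel_measurable M" "g \<in> borel_measurable M"
  shows "(\<lambda>x. indicator {0..f x} (g x) :: ennreal) \<in> borel_measurable M"
proof -
  have "(\<lambda>x. indicator {0..f x} (g x) :: ennreal) = (\<lambda>x. if 0 \<le> g x \<and> g x \<le> f x then 1 else 0)"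
    by (auto simp: indicator_def)
  then show ?thesis by simp
qed

lemma powr_layer_cake:
  fixes h t :: real
  assumes "h \<ge> 0" "t > 0"
  shows "ennreal (h powr t) = (\<integral>\<^sup>+l. ennreal (t * l powr (t - 1)) * indicator {0..h} l \<partial>lborel)"
proof -
  have "(\<integral>\<^sup>+l. ennreal (t * l powr (t - 1)) * indicator {0..h} l \<partial>lborel) =
      (\<integral>\<^sup>+l. ennreal t * (ennreal (l powr (t - 1)) * indicator {0..h} l) \<partial>lborel)"
    using assms by (simp add: ennreal_mult mult.assoc)
  also have "\<dots> = ennreal t * ennreal (h powr t / t)"
    using nn_integral_powr_Icc[of "t - 1" h] assms by (simp add: nn_integral_cmult)
  finally show ?thesis using assms by (simp flip: ennreal_mult)
qed

text \<open>A Hausdorff--Young inequality by real interpolation between the trivial \<open>L\<^sup>1\<close> bound and the \<open>L\<^sup>2\<close> bound: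
  at level \<open>l\<close> the function is split so that its large part contributes at most \<open>l / 2\<close> pointwise.\<close>

lemma osc_Hausdorff_Young:
  fixes \<Phi> :: "'w \<Rightarrow> 'a::euclidean_space" and t N :: real
  assumes "finite_measure \<nu>" and \<Phi>[measurable]: "\<Phi> \<in> borel_measurable \<nu>" and G: "integrable \<nu> G"
    and C: "\<And>e y. e > 0 \<Longrightarrow> (\<integral>\<^sup>+v. ennreal (gauss e (y - \<Phi> v)) \<partial>\<nu>) \<le> C"
    and t: "t > 2" and N: "N > 0" "(\<integral>\<^sup>+w. ennreal (norm (G w) powr (t / (t - 1))) \<partial>\<nu>) \<le> ennreal N"
  shows "(\<integral>\<^sup>+x. ennreal (norm (osc \<nu> \<Phi> G x) powr t) \<partial>lborel) \<le>
    C * ennreal (4 * t / (t - 2) * (2 * N) powr (t - 2) * N)"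
proof -
  interpret finite_measure \<nu> by fact
  interpret P: pair_sigma_finite \<nu> "lborel :: real measure" ..
  note [measurable] = borel_measurable_integrable[OF G]
  have H[measurable]: "osc \<nu> \<Phi> G \<in> borel_measurable borel"
    by (intro borel_measurable_osc sigma_finite_measure_axioms) auto
  define k where "k = 1 / (t - 1)"
  have k: "t / (t - 1) = 1 + k" "k > 0"
    using t by (auto simp: k_def field_simps)
  \<comment> \<open>The large values are those with |G|^k > 2 N / l, that is l > L w. There |G|
    \<le> l / (2 N) |G|^(1+k), which integrates to at most l / 2. Since the cut depends on N, the
    final bound N^(t-1) comes out with the right homogeneity, 1 + k being conjugate to t.\<close>
  define L where "L = (\<lambda>w. 2 * N * norm (G w) powr (- k))"
  have [measurable]: "L \<in> borel_measurable \<nu>" unfolding L_def by measurable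
  have L0: "L w \<ge> 0" for w using N by (simp add: L_def)
  have level: "(\<integral>\<^sup>+x. indicator {0..norm (osc \<nu> \<Phi> G x)} l \<partial>lborel) \<le>
      ennreal (4 / l\<^sup>2) * (C * (\<integral>\<^sup>+w. ennreal ((norm (G w))\<^sup>2) * indicator {0..L w} l \<partial>\<nu>))" if l: "l > 0" for l
  proof -
    define G1 where "G1 = (\<lambda>w. if l \<le> L w then G w else 0)"
    define G2 where "G2 = (\<lambda>w. if l \<le> L w then 0 else G w)"
    have G1: "integrable \<nu> G1"
      by (rule Bochner_Integration.integrable_bound[OF G]) (auto simp: G1_def)
    have G2: "integrable \<nu> G2"
      by (rule Bochner_Integration.integrable_bound[OF G]) (auto simp: G2_def)
    note [measurable] = borel_measurable_integrable[OF G1]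
    have [measurable]: "osc \<nu> \<Phi> G1 \<in> borel_measurable borel"
      by (intro borel_measurable_osc sigma_finite_measure_axioms) auto
    have split: "osc \<nu> \<Phi> G x = osc \<nu> \<Phi> G1 x + osc \<nu> \<Phi> G2 x" for x
      by (subst osc_add[OF \<Phi> G1 G2, symmetric]) (auto simp: G1_def G2_def if_distrib cong: if_cong)
    have "ennreal (LINT w|\<nu>. norm (G2 w)) = (\<integral>\<^sup>+w. ennreal (norm (G2 w)) \<partial>\<nu>)"
      using G2 by (intro nn_integral_eq_integral[symmetric]) auto
    also have "\<dots> \<le> (\<integral>\<^sup>+w. ennreal (l / (2 * N)) * ennreal (norm (G w) powr (1 + k)) \<partial>\<nu>)"
    proof (rule nn_integral_mono)
      fix w
      have "norm (G2 w) \<le> l / (2 * N) * norm (G w) powr (1 + k)"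
      proof (cases "l \<le> L w \<or> G w = 0")
        case False
        then have "norm (G w) powr (- k) \<le> l / (2 * N)"
          using N by (simp add: L_def field_simps)
        then have "norm (G w) powr (- k) * norm (G w) powr (1 + k) \<le> l / (2 * N) * norm (G w) powr (1 + k)"
          by (rule mult_right_mono) simp
        then show ?thesis using False by (simp add: G2_def flip: powr_add)
      qed (use l N in \<open>auto simp: G2_def\<close>)
      then show "ennreal (norm (G2 w)) \<le> ennreal (l / (2 * N)) * ennreal (norm (G w) powr (1 + k))"
        using l N by (simp flip: ennreal_mult)
    qed
    also have "\<dots> \<le> ennreal (l / (2 * N)) * ennreal N"
      using N(2) k by (simp add: nn_integral_cmult mult_left_mono)
    also have "\<dots> = ennreal (l / 2)"
      using N l by (simp flip: ennreal_mult)
    finally have "(LINT w|\<nu>. norm (G2 w)) \<le> l / 2"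
      using l by simp
    then have small: "norm (osc \<nu> \<Phi> G2 x) \<le> l / 2" for x
      using norm_osc_le[OF \<Phi> G2, of x] by linarith
    \<comment> \<open>Chebyshev's inequality: where the whole transform is at least l, the part
      coming from \<open>G1\<close> is at least l / 2, because the other part never exceeds l /
      2.\<close>
    have "(\<integral>\<^sup>+x. indicator {0..norm (osc \<nu> \<Phi> G x)} l \<partial>lborel) \<le>
        (\<integral>\<^sup>+x. ennreal (4 / l\<^sup>2) * ennreal ((norm (osc \<nu> \<Phi> G1 x))\<^sup>2) \<partial>lborel)"
    proof (rule nn_integral_mono)
      fix x
      show "indicator {0..norm (osc \<nu> \<Phi> G x)} l \<le> ennreal (4 / l\<^sup>2) * ennreal ((norm (osc \<nu> \<Phi> G1 x))\<^sup>2)"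
      proof (cases "l \<le> norm (osc \<nu> \<Phi> G x)")
        case True
        then have "l / 2 \<le> norm (osc \<nu> \<Phi> G1 x)"
          using small[of x] norm_triangle_ineq[of "osc \<nu> \<Phi> G1 x" "osc \<nu> \<Phi> G2 x"] unfolding split by linarith
        then have "(l / 2)\<^sup>2 \<le> (norm (osc \<nu> \<Phi> G1 x))\<^sup>2"
          using l by (intro power_mono) auto
        then have "1 \<le> 4 / l\<^sup>2 * (norm (osc \<nu> \<Phi> G1 x))\<^sup>2"
          using l by (simp add: field_simps)
        then have "ennreal 1 \<le> ennreal (4 / l\<^sup>2 * (norm (osc \<nu> \<Phi> G1 x))\<^sup>2)"
          by (rule ennreal_leI)
        then have "1 \<le> ennreal (4 / l\<^sup>2) * ennreal ((norm (osc \<nu> \<Phi> G1 x))\<^sup>2)"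
          by (subst ennreal_mult[symmetric]) auto
        then show ?thesis by (simp add: indicator_def)
      qed auto
    qed
    also have "\<dots> = ennreal (4 / l\<^sup>2) * (\<integral>\<^sup>+x. ennreal ((norm (osc \<nu> \<Phi> G1 x))\<^sup>2) \<partial>lborel)"
      by (simp add: nn_integral_cmult)
    also have "\<dots> \<le> ennreal (4 / l\<^sup>2) * (C * (\<integral>\<^sup>+w. ennreal ((norm (G1 w))\<^sup>2) \<partial>\<nu>))"
      by (intro mult_left_mono osc_L2_bound[OF assms(1) \<Phi> G1 C]) auto
    also have "(\<integral>\<^sup>+w. ennreal ((norm (G1 w))\<^sup>2) \<partial>\<nu>) = (\<integral>\<^sup>+w. ennreal ((norm (G w))\<^sup>2) * indicator {0..L w} l \<partial>\<nu>)"
      using l by (intro nn_integral_cong) (auto simp: G1_def indicator_def)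
    finally show ?thesis .
  qed
  have "(\<integral>\<^sup>+x. ennreal (norm (osc \<nu> \<Phi> G x) powr t) \<partial>lborel) =
      (\<integral>\<^sup>+x. (\<integral>\<^sup>+l. ennreal (t * l powr (t - 1)) * indicator {0..norm (osc \<nu> \<Phi> G x)} l \<partial>lborel) \<partial>lborel)"
    using t by (intro nn_integral_cong powr_layer_cake) auto
  also have "\<dots> = (\<integral>\<^sup>+l. (\<integral>\<^sup>+x. ennreal (t * l powr (t - 1)) * indicator {0..norm (osc \<nu> \<Phi> G x)} l \<partial>lborel) \<partial>lborel)"
    by (rule lborel_pair.Fubini') measurable
  \<comment> \<open>The level bound costs a factor l^(-2) and leaves l^(t-3), which is integrable at
    0 exactly because t > 2.\<close>
  also have "\<dots> \<le> (\<integral>\<^sup>+l. (\<integral>\<^sup>+w. ennreal (4 * t) * C * ennreal ((norm (G w))\<^sup>2) * (ennreal (l powr (t - 3)) * indicator {0..L w} l) \<partial>\<nu>) \<partial>lborel)"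
  proof (rule nn_integral_mono)
    fix l :: real
    show "(\<integral>\<^sup>+x. ennreal (t * l powr (t - 1)) * indicator {0..norm (osc \<nu> \<Phi> G x)} l \<partial>lborel) \<le>
      (\<integral>\<^sup>+w. ennreal (4 * t) * C * ennreal ((norm (G w))\<^sup>2) * (ennreal (l powr (t - 3)) * indicator {0..L w} l) \<partial>\<nu>)"
    proof (cases "l > 0")
      case False
      then have z: "ennreal (t * l powr (t - 1)) * indicator {0..norm (osc \<nu> \<Phi> G x)} l = 0" for x
        by (auto simp: indicator_def)
      show ?thesis unfolding z by simp
    next
      case True
      have e: "t * l powr (t - 1) * (4 / l\<^sup>2) = 4 * t * l powr (t - 3)"
        using True by (simp add: powr_diff powr_numeral powr_realpow field_simps power2_eq_square power3_eq_cube)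
      have "(\<integral>\<^sup>+x. ennreal (t * l powr (t - 1)) * indicator {0..norm (osc \<nu> \<Phi> G x)} l \<partial>lborel) =
          ennreal (t * l powr (t - 1)) * (\<integral>\<^sup>+x. indicator {0..norm (osc \<nu> \<Phi> G x)} l \<partial>lborel)"
        by (rule nn_integral_cmult) measurable
      also have "\<dots> \<le> ennreal (t * l powr (t - 1)) * (ennreal (4 / l\<^sup>2) *
          (C * (\<integral>\<^sup>+w. ennreal ((norm (G w))\<^sup>2) * indicator {0..L w} l \<partial>\<nu>)))"
        by (intro mult_left_mono level True) auto
      also have "\<dots> = ennreal (4 * t * l powr (t - 3)) * C * (\<integral>\<^sup>+w. ennreal ((norm (G w))\<^sup>2) * indicator {0..L w} l \<partial>\<nu>)"
        unfolding e[symmetric] using t by (subst ennreal_mult) (auto simp: mult_ac)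
      also have "\<dots> = (\<integral>\<^sup>+w. ennreal (4 * t * l powr (t - 3)) * C * (ennreal ((norm (G w))\<^sup>2) * indicator {0..L w} l) \<partial>\<nu>)"
        by (rule nn_integral_cmult[symmetric]) measurable
      also have "\<dots> = (\<integral>\<^sup>+w. ennreal (4 * t) * C * ennreal ((norm (G w))\<^sup>2) * (ennreal (l powr (t - 3)) * indicator {0..L w} l) \<partial>\<nu>)"
        using t by (intro nn_integral_cong) (simp add: ennreal_mult mult_ac)
      finally show ?thesis .
    qed
  qed
  also have "\<dots> = (\<integral>\<^sup>+w. (\<integral>\<^sup>+l. ennreal (4 * t) * C * ennreal ((norm (G w))\<^sup>2) * (ennreal (l powr (t - 3)) * indicator {0..L w} l) \<partial>lborel) \<partial>\<nu>)"
    by (rule P.Fubini') measurable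
  also have "\<dots> = (\<integral>\<^sup>+w. ennreal (4 * t) * C * ennreal ((norm (G w))\<^sup>2) * ennreal (L w powr (t - 2) / (t - 2)) \<partial>\<nu>)"
    using nn_integral_powr_Icc[of "t - 3" "L _"] t L0 by (simp add: nn_integral_cmult)
  also have "\<dots> = (\<integral>\<^sup>+w. C * ennreal (4 * t / (t - 2) * (2 * N) powr (t - 2)) * ennreal (norm (G w) powr (1 + k)) \<partial>\<nu>)"
  proof (rule nn_integral_cong)
    fix w
    have "(norm (G w))\<^sup>2 * (L w powr (t - 2)) = (2 * N) powr (t - 2) * norm (G w) powr (1 + k)"
    proof (cases "G w = 0")
      case False
      have e: "2 - k * (t - 2) = 1 + k" using t by (simp add: k_def field_simps)
      then show ?thesis
        using False N by (simp add: L_def powr_mult powr_powr e mult_ac flip: powr_numeral powr_add)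
    qed simp
    then have "4 * t * ((norm (G w))\<^sup>2 * (L w powr (t - 2) / (t - 2))) =
        4 * t / (t - 2) * (2 * N) powr (t - 2) * norm (G w) powr (1 + k)"
      by (simp add: field_simps)
    then show "ennreal (4 * t) * C * ennreal ((norm (G w))\<^sup>2) * ennreal (L w powr (t - 2) / (t - 2)) =
      C * ennreal (4 * t / (t - 2) * (2 * N) powr (t - 2)) * ennreal (norm (G w) powr (1 + k))"
      using t by (simp add: ac_simps flip: ennreal_mult)
  qed
  also have "\<dots> \<le> C * ennreal (4 * t / (t - 2) * (2 * N) powr (t - 2)) * ennreal N"
    using N(2) by (simp add: nn_integral_cmult k(1) mult_left_mono)
  also have "\<dots> = C * ennreal (4 * t / (t - 2) * (2 * N) powr (t - 2) * N)"
    using t N by (simp add: mult.assoc flip: ennreal_mult)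
  finally show ?thesis .
qed

section \<open>The Hardy--Littlewood--Sobolev inequality on products\<close>

text \<open>A power on [0, \<infinity>] that fixes \<infinity> for every exponent and sends 0 to 0.
  Norms of slices in the product argument may be infinite, so powers have to compose and multiply
  without finiteness conditions.\<close>

definition epow :: "ennreal \<Rightarrow> real \<Rightarrow> ennreal" where
  "epow x p = (if x = \<infinity> then \<infinity> else ennreal (enn2real x powr p))"

lemma epow_ennreal: "a \<ge> 0 \<Longrightarrow> epow (ennreal a) p = ennreal (a powr p)"
  by (simp add: epow_def)

lemma epow_top [simp]: "epow \<infinity> p = \<infinity>" "epow top p = \<infinity>"
  by (simp_all add: epow_def)

lemma epow_0 [simp]: "epow 0 p = 0"
  by (simp add: epow_def)

lemma epow_1 [simp]: "epow x 1 = x"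
  by (cases x) (simp_all add: epow_ennreal)

lemma epow_one [simp]: "epow 1 p = 1"
  using epow_ennreal[of 1] by simp

lemma borel_measurable_epow [measurable]:
  assumes [measurable]: "f \<in> borel_measurable M"
  shows "(\<lambda>x. epow (f x) p) \<in> borel_measurable M"
  unfolding epow_def by measurable

lemma epow_mono: "x \<le> y \<Longrightarrow> p \<ge> 0 \<Longrightarrow> epow x p \<le> epow y p"
  by (cases x; cases y) (auto simp: epow_ennreal top_unique intro!: ennreal_leI powr_mono2)

lemma epow_epow: "epow (epow x p) q = epow x (p * q)"
  by (cases x) (simp_all add: epow_ennreal powr_powr)

lemma epow_mult: "epow (x * y) p = epow x p * epow y p"
  by (cases x; cases y)
     (auto simp: epow_ennreal powr_mult ennreal_mult_top ennreal_top_mult ennreal_top_eq_mult_iff simp flip: ennreal_mult split: if_splits)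

lemma epow_eq_0_iff [simp]: "epow x p = 0 \<longleftrightarrow> x = 0"
  by (cases x) (simp_all add: epow_ennreal)

lemma epow_eq_top_iff [simp]: "epow x p = \<infinity> \<longleftrightarrow> x = \<infinity>" "epow x p = top \<longleftrightarrow> x = top"
  by (auto simp: epow_def)

text \<open>Fix x and put r = (f x)^(-a). On d \<le> r, the bound g y \<le> f x and
  \<open>near\<close> give A (f x)^2 r^(1-c) = A (f x)^a. On d > r there are two cases: if d^(-c)
  \<le> (f x g y)^(a-1), the integrand is at most (f x g y)^a, which the norm of g controls;
  otherwise f x g y \<le> d^(c-2), so the integrand is at most d^(-2), and \<open>far\<close> gives
  A / r = A (f x)^a. The choice a = 2 / (2 - c) makes all powers of f x agree.\<close>

lemma hls_half:
  fixes S :: "'b measure" and d :: "'b \<Rightarrow> 'b \<Rightarrow> real" and f g :: "'b \<Rightarrow> real"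
  assumes S: "sigma_finite_measure S"
    and [measurable]: "case_prod d \<in> borel_measurable (S \<Otimes>\<^sub>M S)" and d0: "\<And>x y. d x y \<ge> 0"
    and c: "0 < c" "c < 1" and A: "A \<ge> 0"
    and near: "\<And>x r. x \<in> space S \<Longrightarrow> r > 0 \<Longrightarrow>
      (\<integral>\<^sup>+y. ennreal (d x y powr (- c)) * indicator {..r} (d x y) \<partial>S) \<le> ennreal (A * r powr (1 - c))"
    and far: "\<And>x r. x \<in> space S \<Longrightarrow> r > 0 \<Longrightarrow>
      (\<integral>\<^sup>+y. ennreal (d x y powr (- 2)) * indicator {r<..} (d x y) \<partial>S) \<le> ennreal (A / r)"
    and [measurable]: "f \<in> borel_measurable S" "g \<in> borel_measurable S"
    and f0: "\<And>x. f x \<ge> 0" and g0: "\<And>x. g x \<ge> 0"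
    and a: "a = 2 / (2 - c)" and g1: "(\<integral>\<^sup>+x. ennreal (g x powr a) \<partial>S) \<le> 1"
  shows "(\<integral>\<^sup>+x. (\<integral>\<^sup>+y. ennreal (f x) * ennreal (g y) * ennreal (d x y powr (- c)) * indicator {..f x} (g y) \<partial>S) \<partial>S)
    \<le> ennreal (2 * A + 1) * (\<integral>\<^sup>+x. ennreal (f x powr a) \<partial>S)"
proof -
  interpret sigma_finite_measure S by fact
  have a1: "a > 1" "c / (a - 1) = 2 - c" "a * (1 - c) = 2 - a"
    using c by (auto simp: a field_simps)
  have "(\<integral>\<^sup>+y. ennreal (f x) * ennreal (g y) * ennreal (d x y powr (- c)) * indicator {..f x} (g y) \<partial>S) \<le>
      ennreal (2 * A + 1) * ennreal (f x powr a)" if x: "x \<in> space S" for x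
  proof (cases "f x = 0")
    case False
    then have fx: "f x > 0" using f0[of x] by simp
    define r where "r = f x powr (- a)"
    have r: "r > 0" using fx by (simp add: r_def)
    have [measurable]: "(\<lambda>y. d x y) \<in> borel_measurable S"
      using x by simp
    have "(\<integral>\<^sup>+y. ennreal (f x) * ennreal (g y) * ennreal (d x y powr (- c)) * indicator {..f x} (g y) \<partial>S) \<le>
      (\<integral>\<^sup>+y. ennreal ((f x)\<^sup>2) * (ennreal (d x y powr (- c)) * indicator {..r} (d x y))
        + (ennreal (f x powr a) * ennreal (g y powr a) + ennreal (d x y powr (- 2)) * indicator {r<..} (d x y)) \<partial>S)"
    proof (rule nn_integral_mono)
      fix y
      let ?D = "d x y"
      consider "g y > f x" | "g y \<le> f x" "?D \<le> r" | "g y \<le> f x" "?D > r" by linarith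
      then show "ennreal (f x) * ennreal (g y) * ennreal (?D powr (- c)) * indicator {..f x} (g y) \<le>
        ennreal ((f x)\<^sup>2) * (ennreal (?D powr (- c)) * indicator {..r} ?D)
        + (ennreal (f x powr a) * ennreal (g y powr a) + ennreal (?D powr (- 2)) * indicator {r<..} ?D)"
      proof cases
        case 2
        have "f x * g y * ?D powr (- c) \<le> (f x)\<^sup>2 * ?D powr (- c)"
          using 2 fx by (intro mult_right_mono) (auto simp: power2_eq_square)
        then show ?thesis
          using 2 fx g0[of y] by (simp flip: ennreal_mult add: add_increasing2 ennreal_leI)
      next
        case 3
        then have D: "?D > 0" using r by simp
        have "f x * g y * ?D powr (- c) \<le> f x powr a * g y powr a + ?D powr (- 2)"
        proof (cases "?D powr (- c) \<le> f x powr (a - 1) * g y powr (a - 1)")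
          case True
          then have "f x * g y * ?D powr (- c) \<le> f x * g y * (f x powr (a - 1) * g y powr (a - 1))"
            using fx g0[of y] by (intro mult_left_mono) auto
          also have "\<dots> = f x powr a * g y powr a"
          proof -
            have z: "z * z powr (a - 1) = z powr a" if "z \<ge> 0" for z :: real
              using that a1(1) by (cases "z = 0") (auto simp: powr_diff)
            have "f x * g y * (f x powr (a - 1) * g y powr (a - 1)) = (f x * f x powr (a - 1)) * (g y * g y powr (a - 1))"
              by (simp only: mult_ac)
            then show ?thesis using f0 g0 by (simp only: z)
          qed
          finally show ?thesis by (simp add: add_increasing2)
        next
          case False
          have "f x * g y = ((f x * g y) powr (a - 1)) powr (1 / (a - 1))"
            using a1(1) fx g0[of y] by (simp add: powr_powr)
          also have "\<dots> \<le> (?D powr (- c)) powr (1 / (a - 1))"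
            using False a1(1) fx g0[of y] by (intro powr_mono2) (auto simp: powr_mult)
          also have "\<dots> = ?D powr (c - 2)"
            using a1(2) by (simp add: powr_powr)
          finally have "f x * g y * ?D powr (- c) \<le> ?D powr (c - 2) * ?D powr (- c)"
            by (rule mult_right_mono) simp
          also have "\<dots> = ?D powr (- 2)"
            using D by (simp flip: powr_add)
          finally show ?thesis by (simp add: add_increasing)
        qed
        then show ?thesis
          using 3 fx g0[of y] by (simp add: ennreal_leI flip: ennreal_mult ennreal_plus)
      qed auto
    qed
    also have "\<dots> = ennreal ((f x)\<^sup>2) * (\<integral>\<^sup>+y. ennreal (d x y powr (- c)) * indicator {..r} (d x y) \<partial>S)
        + (ennreal (f x powr a) * (\<integral>\<^sup>+y. ennreal (g y powr a) \<partial>S) + (\<integral>\<^sup>+y. ennreal (d x y powr (- 2)) * indicator {r<..} (d x y) \<partial>S))"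
      by (simp add: nn_integral_add nn_integral_cmult)
    also have "\<dots> \<le> ennreal ((f x)\<^sup>2) * ennreal (A * r powr (1 - c)) + (ennreal (f x powr a) * 1 + ennreal (A / r))"
      by (intro add_mono mult_left_mono near far g1 x r) auto
    also have "\<dots> = ennreal ((f x)\<^sup>2 * (A * r powr (1 - c)) + (f x powr a + A / r))"
      using A r by (simp flip: ennreal_mult ennreal_plus)
    also have "(f x)\<^sup>2 * (A * r powr (1 - c)) + (f x powr a + A / r) = (2 * A + 1) * f x powr a"
    proof -
      have "r powr (1 - c) = f x powr (a - 2)"
      proof -
        have "- a * (1 - c) = a - 2" using a1(3) by linarith
        then show ?thesis by (simp only: r_def powr_powr)
      qed
      then have "(f x)\<^sup>2 * r powr (1 - c) = f x powr a"
        using fx by (simp add: powr_diff powr_numeral)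
      moreover have "1 / r = f x powr a"
        using fx by (simp add: r_def powr_minus field_simps)
      ultimately show ?thesis by (simp add: algebra_simps divide_inverse)
    qed
    finally show ?thesis using A by (simp add: ennreal_mult)
  qed simp
  then have "(\<integral>\<^sup>+x. (\<integral>\<^sup>+y. ennreal (f x) * ennreal (g y) * ennreal (d x y powr (- c)) * indicator {..f x} (g y) \<partial>S) \<partial>S)
    \<le> (\<integral>\<^sup>+x. ennreal (2 * A + 1) * ennreal (f x powr a) \<partial>S)"
    by (rule nn_integral_mono)
  then show ?thesis by (simp add: nn_integral_cmult)
qed

text \<open>For \<open>f\<close> of norm 1 the diagonal Hardy--Littlewood--Sobolev inequality needs no maximal function:
  by symmetry one may integrate over \<open>g y \<le> f x\<close> only, and there the kernel is cut at distance \<open>(f x)\<^sup>-\<^sup>a\<close>.\<close>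

lemma hls_normalised:
  fixes S :: "'b measure" and d :: "'b \<Rightarrow> 'b \<Rightarrow> real" and f g :: "'b \<Rightarrow> ennreal"
  assumes S: "sigma_finite_measure S"
    and dm[measurable]: "case_prod d \<in> borel_measurable (S \<Otimes>\<^sub>M S)" and d0: "\<And>x y. d x y \<ge> 0" and sym: "\<And>x y. d x y = d y x"
    and c: "0 < c" "c < 1" and A: "A \<ge> 0"
    and near: "\<And>x r. x \<in> space S \<Longrightarrow> r > 0 \<Longrightarrow>
      (\<integral>\<^sup>+y. ennreal (d x y powr (- c)) * indicator {..r} (d x y) \<partial>S) \<le> ennreal (A * r powr (1 - c))"
    and far: "\<And>x r. x \<in> space S \<Longrightarrow> r > 0 \<Longrightarrow>
      (\<integral>\<^sup>+y. ennreal (d x y powr (- 2)) * indicator {r<..} (d x y) \<partial>S) \<le> ennreal (A / r)"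
    and fm[measurable]: "f \<in> borel_measurable S" "g \<in> borel_measurable S"
    and a: "a = 2 / (2 - c)"
    and f1: "(\<integral>\<^sup>+x. epow (f x) a \<partial>S) \<le> 1" and g1: "(\<integral>\<^sup>+x. epow (g x) a \<partial>S) \<le> 1"
  shows "(\<integral>\<^sup>+x. (\<integral>\<^sup>+y. f x * g y * ennreal (d x y powr (- c)) \<partial>S) \<partial>S) \<le> ennreal (2 * (2 * A + 1))"
proof -
  interpret sigma_finite_measure S by fact
  interpret P: pair_sigma_finite S S ..
  have fin: "AE x in S. h x \<noteq> \<infinity>" if [measurable]: "h \<in> borel_measurable S" and "(\<integral>\<^sup>+x. epow (h x) a \<partial>S) \<le> 1" for h :: "'b \<Rightarrow> ennreal"
  proof -
    have "AE x in S. epow (h x) a \<noteq> \<infinity>"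
      using that(2) by (intro nn_integral_PInf_AE) (auto simp: top_unique)
    then show ?thesis by simp
  qed
  \<comment> \<open>Functions of finite norm are finite almost everywhere, so real-valued
    representatives replace them.\<close>
  define f' where "f' = (\<lambda>x. enn2real (f x))"
  define g' where "g' = (\<lambda>x. enn2real (g x))"
  have [measurable]: "f' \<in> borel_measurable S" "g' \<in> borel_measurable S"
    unfolding f'_def g'_def by auto
  have ff: "AE x in S. f x = ennreal (f' x)" and gg: "AE x in S. g x = ennreal (g' x)"
    using fin[OF fm(1) f1] fin[OF fm(2) g1] by (auto simp: f'_def g'_def less_top)
  have f0: "f' x \<ge> 0" and g0: "g' x \<ge> 0" for x by (auto simp: f'_def g'_def)
  have f1': "(\<integral>\<^sup>+x. ennreal (f' x powr a) \<partial>S) \<le> 1"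
  proof -
    have "AE x in S. epow (f x) a = ennreal (f' x powr a)"
      using ff by eventually_elim (simp add: epow_ennreal f0)
    from nn_integral_cong_AE[OF this] f1 show ?thesis by simp
  qed
  have g1': "(\<integral>\<^sup>+x. ennreal (g' x powr a) \<partial>S) \<le> 1"
  proof -
    have "AE x in S. epow (g x) a = ennreal (g' x powr a)"
      using gg by eventually_elim (simp add: epow_ennreal g0)
    from nn_integral_cong_AE[OF this] g1 show ?thesis by simp
  qed
  let ?B = "\<lambda>f g. (\<integral>\<^sup>+x. (\<integral>\<^sup>+y. ennreal (f x) * ennreal (g y) * ennreal (d x y powr (- c)) * indicator {..f x} (g y) \<partial>S) \<partial>S)"
  have half: "?B f g \<le> ennreal (2 * A + 1)"
    if "f \<in> borel_measurable S" "g \<in> borel_measurable S" "\<And>x. f x \<ge> 0" "\<And>x. g x \<ge> 0"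
      "(\<integral>\<^sup>+x. ennreal (f x powr a) \<partial>S) \<le> 1" "(\<integral>\<^sup>+x. ennreal (g x powr a) \<partial>S) \<le> 1" for f g :: "'b \<Rightarrow> real"
  proof -
    have "?B f g \<le> ennreal (2 * A + 1) * (\<integral>\<^sup>+x. ennreal (f x powr a) \<partial>S)"
      by (rule hls_half[OF S dm d0 c A near far that(1-4) a that(6)])
    also have "\<dots> \<le> ennreal (2 * A + 1) * 1"
      by (intro mult_left_mono that) auto
    finally show ?thesis by simp
  qed
  have "(\<integral>\<^sup>+x. (\<integral>\<^sup>+y. f x * g y * ennreal (d x y powr (- c)) \<partial>S) \<partial>S) =
      (\<integral>\<^sup>+x. (\<integral>\<^sup>+y. ennreal (f' x) * ennreal (g' y) * ennreal (d x y powr (- c)) \<partial>S) \<partial>S)"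
    using ff
  proof (intro nn_integral_cong_AE, eventually_elim)
    case (elim x)
    show ?case using gg by (intro nn_integral_cong_AE, eventually_elim) (simp add: elim)
  qed
  also have "\<dots> \<le> (\<integral>\<^sup>+x. (\<integral>\<^sup>+y. ennreal (f' x) * ennreal (g' y) * ennreal (d x y powr (- c)) * indicator {..f' x} (g' y) +
      ennreal (g' y) * ennreal (f' x) * ennreal (d y x powr (- c)) * indicator {..g' y} (f' x) \<partial>S) \<partial>S)"
    by (intro nn_integral_mono) (auto simp: indicator_def sym mult_ac)
  also have "\<dots> = ?B f' g' + (\<integral>\<^sup>+x. (\<integral>\<^sup>+y. ennreal (g' y) * ennreal (f' x) * ennreal (d y x powr (- c)) * indicator {..g' y} (f' x) \<partial>S) \<partial>S)"
  proof -
    have [measurable]: "(\<lambda>x. indicator {..p x} (q x) :: ennreal) \<in> borel_measurable M"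
      if [measurable]: "p \<in> borel_measurable M" "q \<in> borel_measurable M" for p q :: "'c \<Rightarrow> real" and M
    proof -
      have "(\<lambda>x. indicator {..p x} (q x) :: ennreal) = (\<lambda>x. if q x \<le> p x then 1 else 0)"
        by (auto simp: indicator_def)
      then show ?thesis by simp
    qed
    show ?thesis
      by (subst nn_integral_add[symmetric]) (auto intro!: nn_integral_cong nn_integral_add)
  qed
  also have "(\<integral>\<^sup>+x. (\<integral>\<^sup>+y. ennreal (g' y) * ennreal (f' x) * ennreal (d y x powr (- c)) * indicator {..g' y} (f' x) \<partial>S) \<partial>S) = ?B g' f'"
    by (rule P.Fubini') (simp add: indicator_def)
  also have "?B f' g' + ?B g' f' \<le> ennreal (2 * A + 1) + ennreal (2 * A + 1)"
    by (intro add_mono half f0 g0 f1' g1') auto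
  also have "\<dots> = ennreal (2 * (2 * A + 1))"
    using A by (simp flip: ennreal_plus)
  finally show ?thesis .
qed

text \<open>Both sides are homogeneous of degree one in f and in g, so only the norms 0 and
  \<infinity> need care. Norm 0 makes the integrand vanish almost everywhere; it is treated before
  norm \<infinity> because zero times \<infinity> is 0 in \<open>ennreal\<close>.\<close>

lemma bilinear_homogenise:
  fixes S :: "'b measure" and k :: "'b \<Rightarrow> 'b \<Rightarrow> ennreal" and f g :: "'b \<Rightarrow> ennreal"
  assumes S: "sigma_finite_measure S" and [measurable]: "case_prod k \<in> borel_measurable (S \<Otimes>\<^sub>M S)"
    and a: "a > 0" and C: "C > 0"
    and le: "\<And>f g. f \<in> borel_measurable S \<Longrightarrow> g \<in> borel_measurable S \<Longrightarrow> (\<integral>\<^sup>+x. epow (f x) a \<partial>S) \<le> 1 \<Longrightarrow> (\<integral>\<^sup>+x. epow (g x) a \<partial>S) \<le> 1 \<Longrightarrow>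
      (\<integral>\<^sup>+x. (\<integral>\<^sup>+y. f x * g y * k x y \<partial>S) \<partial>S) \<le> C"
    and [measurable]: "f \<in> borel_measurable S" "g \<in> borel_measurable S"
  shows "(\<integral>\<^sup>+x. (\<integral>\<^sup>+y. f x * g y * k x y \<partial>S) \<partial>S) \<le>
    C * epow (\<integral>\<^sup>+x. epow (f x) a \<partial>S) (1 / a) * epow (\<integral>\<^sup>+x. epow (g x) a \<partial>S) (1 / a)"
    (is "?L \<le> C * epow ?X _ * epow ?Y _")
proof -
  interpret sigma_finite_measure S by fact
  consider "?X = 0" | "?Y = 0" | "?X \<noteq> 0" "?Y \<noteq> 0" "?X = \<infinity> \<or> ?Y = \<infinity>" | "?X \<noteq> 0" "?Y \<noteq> 0" "?X \<noteq> \<infinity>" "?Y \<noteq> \<infinity>"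
    by blast
  then show ?thesis
  proof cases
    case 1
    then have "AE x in S. f x = 0" by (subst (asm) nn_integral_0_iff_AE) auto
    then have "?L = (\<integral>\<^sup>+x. 0 \<partial>S)"
      by (intro nn_integral_cong_AE, eventually_elim) auto
    then show ?thesis by simp
  next
    case 2
    then have "AE x in S. g x = 0" by (subst (asm) nn_integral_0_iff_AE) auto
    then have "(\<integral>\<^sup>+y. f x * g y * k x y \<partial>S) = (\<integral>\<^sup>+y. 0 \<partial>S)" for x
      by (intro nn_integral_cong_AE, eventually_elim) auto
    then show ?thesis by simp
  next
    case 3
    then show ?thesis using C by (auto simp: ennreal_mult_top ennreal_top_mult)
  next
    case 4
    obtain X where X: "?X = ennreal X" "X > 0"
      using 4 by (cases ?X) (auto simp: less_le)
    obtain Y where Y: "?Y = ennreal Y" "Y > 0"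
      using 4 by (cases ?Y) (auto simp: less_le)
    define u where "u = ennreal (X powr (- (1 / a)))"
    define v where "v = ennreal (Y powr (- (1 / a)))"
    have inv: "(Z powr (- (1 / a))) powr a * Z = 1" if "Z > 0" for Z :: real
      using that a unfolding powr_powr by (simp add: powr_neg_one)
    have u: "epow u a * ?X = 1" and v: "epow v a * ?Y = 1"
      using X Y inv[of X] inv[of Y] by (simp_all add: u_def v_def epow_ennreal flip: ennreal_mult)
    have "(\<integral>\<^sup>+x. (\<integral>\<^sup>+y. (u * f x) * (v * g y) * k x y \<partial>S) \<partial>S) \<le> C"
      by (intro le) (auto simp: epow_mult nn_integral_cmult u v)
    also have "(\<integral>\<^sup>+x. (\<integral>\<^sup>+y. (u * f x) * (v * g y) * k x y \<partial>S) \<partial>S) = (\<integral>\<^sup>+x. (\<integral>\<^sup>+y. (u * v) * (f x * g y * k x y) \<partial>S) \<partial>S)"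
      by (simp add: mult_ac)
    also have "\<dots> = (\<integral>\<^sup>+x. (u * v) * (\<integral>\<^sup>+y. f x * g y * k x y \<partial>S) \<partial>S)"
      by (intro nn_integral_cong nn_integral_cmult) measurable
    also have "\<dots> = u * v * ?L"
      by (intro nn_integral_cmult) measurable
    finally have *: "u * v * ?L \<le> C" .
    have "epow ?X (1 / a) * u = 1" "epow ?Y (1 / a) * v = 1"
      using X Y by (auto simp: u_def v_def epow_ennreal powr_minus field_simps simp flip: ennreal_mult)
    then have "?L = (epow ?X (1 / a) * u) * (epow ?Y (1 / a) * v) * ?L" by simp
    also have "\<dots> = epow ?X (1 / a) * epow ?Y (1 / a) * (u * v * ?L)"
      by (simp only: mult_ac)
    also have "\<dots> \<le> epow ?X (1 / a) * epow ?Y (1 / a) * C"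
      using * by (intro mult_left_mono) auto
    finally show ?thesis by (simp add: mult_ac)
  qed
qed

text \<open>Induction over the coordinates. With one pair of coordinates u, v frozen, the induction
  hypothesis bounds the form in the slices by their norms \<phi> u and \<psi> v; the one-variable
  inequality then handles u and v. Because the exponent a is the same in every coordinate, Tonelli
  identifies the norm of the slice norms with the norm on the product. The constants
  multiply.\<close>

lemma bilinear_PiM:
  fixes S :: "'b measure" and k :: "'b \<Rightarrow> 'b \<Rightarrow> ennreal"
  assumes S: "sigma_finite_measure S" and [measurable]: "case_prod k \<in> borel_measurable (S \<Otimes>\<^sub>M S)"
    and a: "a > 0"
    and le: "\<And>f g. f \<in> borel_measurable S \<Longrightarrow> g \<in> borel_measurable S \<Longrightarrow>
      (\<integral>\<^sup>+x. (\<integral>\<^sup>+y. f x * g y * k x y \<partial>S) \<partial>S) \<le> C * epow (\<integral>\<^sup>+x. epow (f x) a \<partial>S) (1 / a) * epow (\<integral>\<^sup>+x. epow (g x) a \<partial>S) (1 / a)"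
    and I: "finite I"
    and "f \<in> borel_measurable (Pi\<^sub>M I (\<lambda>_. S))" "g \<in> borel_measurable (Pi\<^sub>M I (\<lambda>_. S))"
  shows "(\<integral>\<^sup>+x. (\<integral>\<^sup>+y. f x * g y * (\<Prod>i\<in>I. k (x i) (y i)) \<partial>Pi\<^sub>M I (\<lambda>_. S)) \<partial>Pi\<^sub>M I (\<lambda>_. S)) \<le>
    C ^ card I * epow (\<integral>\<^sup>+x. epow (f x) a \<partial>Pi\<^sub>M I (\<lambda>_. S)) (1 / a) * epow (\<integral>\<^sup>+x. epow (g x) a \<partial>Pi\<^sub>M I (\<lambda>_. S)) (1 / a)"
  using I assms(6,7)
proof (induction I arbitrary: f g)
  case empty
  interpret product_sigma_finite "\<lambda>_. S" using S by (simp add: product_sigma_finite_def)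
  show ?case using a by (simp add: nn_integral_empty epow_epow)
next
  case (insert i I)
  interpret product_sigma_finite "\<lambda>_. S" using S by (simp add: product_sigma_finite_def)
  interpret fI: finite_product_sigma_finite "\<lambda>_. S" I by standard (fact insert)
  interpret sigma_finite_measure S by fact
  interpret P: pair_sigma_finite S "Pi\<^sub>M I (\<lambda>_. S)" ..
  note [measurable] = insert.prems
  let ?M = "Pi\<^sub>M I (\<lambda>_. S)"
  let ?K = "\<lambda>x y. \<Prod>j\<in>I. k (x j) (y j)"
  define F where "F = (\<lambda>u x. f (x(i := u)))"
  define G where "G = (\<lambda>v y. g (y(i := v)))"
  have Fm[measurable]: "case_prod F \<in> borel_measurable (S \<Otimes>\<^sub>M ?M)" unfolding F_def by measurable
  have Gm[measurable]: "case_prod G \<in> borel_measurable (S \<Otimes>\<^sub>M ?M)" unfolding G_def by measurable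
  define \<phi> where "\<phi> = (\<lambda>u. epow (\<integral>\<^sup>+x. epow (F u x) a \<partial>?M) (1 / a))"
  define \<psi> where "\<psi> = (\<lambda>v. epow (\<integral>\<^sup>+y. epow (G v y) a \<partial>?M) (1 / a))"
  have [measurable]: "\<phi> \<in> borel_measurable S" "\<psi> \<in> borel_measurable S"
    unfolding \<phi>_def \<psi>_def by measurable
  have prod: "(\<Prod>j\<in>insert i I. k ((x(i := u)) j) ((y(i := v)) j)) = k u v * ?K x y" for u v x y
  proof -
    have "(\<Prod>j\<in>I. k ((x(i := u)) j) ((y(i := v)) j)) = ?K x y"
      using insert(2) by (intro prod.cong) auto
    then show ?thesis using insert(1,2) by simp
  qed
  have ins: "(\<integral>\<^sup>+x. h x \<partial>Pi\<^sub>M (insert i I) (\<lambda>_. S)) = (\<integral>\<^sup>+u. \<integral>\<^sup>+x. h (x(i := u)) \<partial>?M \<partial>S)"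
    if "h \<in> borel_measurable (Pi\<^sub>M (insert i I) (\<lambda>_. S))" for h
    by (rule product_nn_integral_insert_rev[OF insert(1,2) that])
  have Kx[measurable]: "(\<lambda>(x, y). \<Prod>j\<in>insert i I. k (x j) (y j)) \<in>
      borel_measurable (Pi\<^sub>M (insert i I) (\<lambda>_. S) \<Otimes>\<^sub>M Pi\<^sub>M (insert i I) (\<lambda>_. S))"
    by measurable
  have [measurable]: "(\<lambda>(x, y). ?K x y) \<in> borel_measurable (?M \<Otimes>\<^sub>M ?M)"
    by measurable
  have "(\<integral>\<^sup>+x. (\<integral>\<^sup>+y. f x * g y * (\<Prod>j\<in>insert i I. k (x j) (y j)) \<partial>Pi\<^sub>M (insert i I) (\<lambda>_. S)) \<partial>Pi\<^sub>M (insert i I) (\<lambda>_. S)) =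
      (\<integral>\<^sup>+u. \<integral>\<^sup>+x. \<integral>\<^sup>+v. \<integral>\<^sup>+y. F u x * G v y * (k u v * ?K x y) \<partial>?M \<partial>S \<partial>?M \<partial>S)"
  proof -
    have "(\<integral>\<^sup>+y. f x * g y * (\<Prod>j\<in>insert i I. k (x j) (y j)) \<partial>Pi\<^sub>M (insert i I) (\<lambda>_. S)) =
      (\<integral>\<^sup>+v. \<integral>\<^sup>+y. f x * G v y * (\<Prod>j\<in>insert i I. k (x j) ((y(i := v)) j)) \<partial>?M \<partial>S)"
      if "x \<in> space (Pi\<^sub>M (insert i I) (\<lambda>_. S))" for x
      unfolding G_def using that by (intro ins) measurable
    then have "(\<integral>\<^sup>+x. (\<integral>\<^sup>+y. f x * g y * (\<Prod>j\<in>insert i I. k (x j) (y j)) \<partial>Pi\<^sub>M (insert i I) (\<lambda>_. S)) \<partial>Pi\<^sub>M (insert i I) (\<lambda>_. S)) =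
        (\<integral>\<^sup>+x. (\<integral>\<^sup>+v. \<integral>\<^sup>+y. f x * G v y * (\<Prod>j\<in>insert i I. k (x j) ((y(i := v)) j)) \<partial>?M \<partial>S) \<partial>Pi\<^sub>M (insert i I) (\<lambda>_. S))"
      by (rule nn_integral_cong)
    also have "\<dots> = (\<integral>\<^sup>+u. \<integral>\<^sup>+x. \<integral>\<^sup>+v. \<integral>\<^sup>+y. F u x * G v y * (\<Prod>j\<in>insert i I. k ((x(i := u)) j) ((y(i := v)) j)) \<partial>?M \<partial>S \<partial>?M \<partial>S)"
      unfolding F_def by (rule ins) measurable
    finally show ?thesis unfolding prod .
  qed
  also have "\<dots> = (\<integral>\<^sup>+u. \<integral>\<^sup>+v. \<integral>\<^sup>+x. \<integral>\<^sup>+y. F u x * G v y * (k u v * ?K x y) \<partial>?M \<partial>?M \<partial>S \<partial>S)"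
  proof (rule nn_integral_cong)
    fix u assume [measurable]: "u \<in> space S"
    show "(\<integral>\<^sup>+x. \<integral>\<^sup>+v. \<integral>\<^sup>+y. F u x * G v y * (k u v * ?K x y) \<partial>?M \<partial>S \<partial>?M) =
        (\<integral>\<^sup>+v. \<integral>\<^sup>+x. \<integral>\<^sup>+y. F u x * G v y * (k u v * ?K x y) \<partial>?M \<partial>?M \<partial>S)"
      by (rule P.Fubini') measurable
  qed
  also have "\<dots> = (\<integral>\<^sup>+u. \<integral>\<^sup>+v. k u v * (\<integral>\<^sup>+x. \<integral>\<^sup>+y. F u x * G v y * ?K x y \<partial>?M \<partial>?M) \<partial>S \<partial>S)"
  proof (intro nn_integral_cong)
    fix u v assume [measurable]: "u \<in> space S" "v \<in> space S"
    have "(\<integral>\<^sup>+x. \<integral>\<^sup>+y. F u x * G v y * (k u v * ?K x y) \<partial>?M \<partial>?M) = (\<integral>\<^sup>+x. \<integral>\<^sup>+y. k u v * (F u x * G v y * ?K x y) \<partial>?M \<partial>?M)"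
      by (simp add: mult_ac)
    also have "\<dots> = (\<integral>\<^sup>+x. k u v * (\<integral>\<^sup>+y. F u x * G v y * ?K x y \<partial>?M) \<partial>?M)"
      by (intro nn_integral_cong nn_integral_cmult) measurable
    also have "\<dots> = k u v * (\<integral>\<^sup>+x. \<integral>\<^sup>+y. F u x * G v y * ?K x y \<partial>?M \<partial>?M)"
      by (intro nn_integral_cmult) measurable
    finally show "(\<integral>\<^sup>+x. \<integral>\<^sup>+y. F u x * G v y * (k u v * ?K x y) \<partial>?M \<partial>?M) = k u v * (\<integral>\<^sup>+x. \<integral>\<^sup>+y. F u x * G v y * ?K x y \<partial>?M \<partial>?M)" .
  qed
  also have "\<dots> \<le> (\<integral>\<^sup>+u. \<integral>\<^sup>+v. k u v * (C ^ card I * \<phi> u * \<psi> v) \<partial>S \<partial>S)"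
    unfolding \<phi>_def \<psi>_def
    by (intro nn_integral_mono mult_left_mono insert.IH) auto
  also have "\<dots> = (\<integral>\<^sup>+u. C ^ card I * (\<integral>\<^sup>+v. \<phi> u * \<psi> v * k u v \<partial>S) \<partial>S)"
    by (intro nn_integral_cong, subst nn_integral_cmult[symmetric]) (auto simp: mult_ac)
  also have "\<dots> = C ^ card I * (\<integral>\<^sup>+u. (\<integral>\<^sup>+v. \<phi> u * \<psi> v * k u v \<partial>S) \<partial>S)"
    by (rule nn_integral_cmult) measurable
  also have "\<dots> \<le> C ^ card I * (C * epow (\<integral>\<^sup>+u. epow (\<phi> u) a \<partial>S) (1 / a) * epow (\<integral>\<^sup>+v. epow (\<psi> v) a \<partial>S) (1 / a))"
    by (intro mult_left_mono le) auto
  also have "(\<integral>\<^sup>+u. epow (\<phi> u) a \<partial>S) = (\<integral>\<^sup>+x. epow (f x) a \<partial>Pi\<^sub>M (insert i I) (\<lambda>_. S))"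
    using a by (subst ins) (auto simp: \<phi>_def F_def epow_epow)
  also have "(\<integral>\<^sup>+v. epow (\<psi> v) a \<partial>S) = (\<integral>\<^sup>+x. epow (g x) a \<partial>Pi\<^sub>M (insert i I) (\<lambda>_. S))"
    using a by (subst ins) (auto simp: \<psi>_def G_def epow_epow)
  finally show ?case using insert(1,2) by (simp add: mult_ac)
qed

section \<open>The circle\<close>

definition cpt :: "real \<Rightarrow> real \<times> real" where
  "cpt t = (cos (2 * pi * t), sin (2 * pi * t))"

text \<open>The area spanned by two vectors; on the circle it is the modulus of the sine of the
  angle between them. It vanishes at antipodal as well as at equal points, which is where addition
  of two points of the circle degenerates.\<close>

definition cdet :: "real \<times> real \<Rightarrow> real \<times> real \<Rightarrow> real" where
  "cdet p q = \<bar>fst p * snd q - snd p * fst q\<bar>"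

lemma cdet_nonneg [simp]: "cdet p q \<ge> 0"
  by (simp add: cdet_def)

lemma cdet_commute: "cdet p q = cdet q p"
  by (simp add: cdet_def abs_minus_commute mult.commute)

lemma borel_measurable_fst_snd_real [measurable]:
  "(fst :: real \<times> real \<Rightarrow> real) \<in> borel_measurable borel" "(snd :: real \<times> real \<Rightarrow> real) \<in> borel_measurable borel"
  by (intro borel_measurable_continuous_onI continuous_intros)+

lemma borel_measurable_cdet [measurable]:
  assumes [measurable]: "f \<in> borel_measurable M" "g \<in> borel_measurable M"
  shows "(\<lambda>x. cdet (f x) (g x)) \<in> borel_measurable M"
proof -
  note [measurable] = measurable_compose[OF assms(1) borel_measurable_fst_snd_real(1)] measurable_compose[OF assms(1) borel_measurable_fst_snd_real(2)]
    measurable_compose[OF assms(2) borel_measurable_fst_snd_real(1)] measurable_compose[OF assms(2) borel_measurable_fst_snd_real(2)]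
  show ?thesis unfolding cdet_def by simp
qed

lemma cdet_cpt: "cdet (cpt s) (cpt t) = \<bar>sin (2 * pi * (t - s))\<bar>"
  by (simp add: cdet_def cpt_def sin_diff algebra_simps)

lemma borel_measurable_cpt [measurable]: "cpt \<in> borel_measurable borel"
  unfolding cpt_def by (intro borel_measurable_continuous_onI continuous_intros)

lemma cpt_add_int [simp]: "cpt (t + of_int m) = cpt t"
proof -
  have e: "2 * pi * (t + of_int m) = 2 * pi * t + of_int m * (2 * pi)" by (simp add: algebra_simps)
  show ?thesis
    unfolding cpt_def e by (metis cos_add cos_int_2pin cos_minus mult.commute mult_1 mult_zero_left sin_add sin_int_2pin add.right_neutral diff_zero mult.right_neutral mult_zero_right)
qed

lemma norm_cpt [simp]: "norm (cpt t) = 1"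
  by (simp add: cpt_def norm_Pair)

lemma circle_iff_norm: "p \<in> circle \<longleftrightarrow> norm p = 1"
  by (auto simp: circle_def norm_prod_def)

lemma circle_cpt: "p \<in> circle \<Longrightarrow> \<exists>t. p = cpt t"
proof -
  assume "p \<in> circle"
  then have "(fst p)\<^sup>2 + (snd p)\<^sup>2 = 1" by (auto simp: circle_def)
  then obtain t where "fst p = cos t" "snd p = sin t" by (metis sincos_total_2pi)
  then have "p = cpt (t / (2 * pi))" by (simp add: cpt_def prod_eq_iff)
  then show ?thesis ..
qed

section \<open>Integration over the circle in the arc length parameter\<close>

lemma measurable_circle_measure_borel [measurable]:
  "(\<lambda>p. p) \<in> borel_measurable circle_measure"
  by (subst measurable_cong_sets[OF sets_circle_measure refl]) (simp add: measurable_restrict_space1)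

lemma borel_measurable_circle_measureI: "f \<in> borel_measurable borel \<Longrightarrow> f \<in> borel_measurable circle_measure"
  by (rule measurable_compose[OF measurable_circle_measure_borel])

lemma nn_integral_circle_measure:
  assumes [measurable]: "f \<in> borel_measurable borel"
  shows "(\<integral>\<^sup>+p. f p \<partial>circle_measure) = (\<integral>\<^sup>+t. f (cpt t) * indicator {0..<1} t \<partial>lborel)"
proof -
  have "f \<in> borel_measurable (restrict_space borel circle)"
    by (simp add: measurable_restrict_space1)
  then show ?thesis
    unfolding circle_measure_def
    by (subst nn_integral_distr) (auto simp: cpt_def nn_integral_restrict_space)
qed

lemma nn_integral_periodic_shift:
  fixes h :: "real \<Rightarrow> ennreal"
  assumes h[measurable]: "h \<in> borel_measurable borel" and per: "\<And>t m. h (t + of_int m) = h t"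
  shows "(\<integral>\<^sup>+t. h (t + a) * indicator {0..<1} t \<partial>lborel) = (\<integral>\<^sup>+t. h t * indicator {0..<1} t \<partial>lborel)"
proof -
  let ?I = "\<lambda>A. \<integral>\<^sup>+t. h t * indicator A t \<partial>lborel"
  define b where "b = frac a"
  have b: "0 \<le> b" "b < 1" by (auto simp: b_def frac_lt_1)
  have "h (t + a) = h (t + b)" for t
    using per[of "t + b" "\<lfloor>a\<rfloor>"] by (simp add: b_def frac_def)
  then have "(\<integral>\<^sup>+t. h (t + a) * indicator {0..<1} t \<partial>lborel) = (\<integral>\<^sup>+t. h (t + b) * indicator {0..<1} t \<partial>lborel)"
    by simp
  also have "\<dots> = (\<integral>\<^sup>+t. h (b + 1 * t) * indicator {b..<b + 1} (b + 1 * t) \<partial>lborel)"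
    by (intro nn_integral_cong) (auto simp: indicator_def add.commute)
  also have "\<dots> = ?I {b..<b + 1}"
    by (subst nn_integral_real_affine[where c=1 and t=b]) auto
  also have "\<dots> = (\<integral>\<^sup>+t. h t * indicator {b..<1} t + h t * indicator {1..<b + 1} t \<partial>lborel)"
    using b by (intro nn_integral_cong) (auto simp: indicator_def)
  also have "\<dots> = ?I {b..<1} + ?I {1..<b + 1}"
    by (intro nn_integral_add) auto
  also have "?I {1..<b + 1} = (\<integral>\<^sup>+t. h (1 + 1 * t) * indicator {1..<b + 1} (1 + 1 * t) \<partial>lborel)"
    by (subst nn_integral_real_affine[where c=1 and t=1]) auto
  also have "\<dots> = ?I {0..<b}"
    using per[of _ 1] by (intro nn_integral_cong) (auto simp: indicator_def add.commute)
  also have "?I {b..<1} + ?I {0..<b} = (\<integral>\<^sup>+t. h t * indicator {b..<1} t + h t * indicator {0..<b} t \<partial>lborel)"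
    by (intro nn_integral_add[symmetric]) auto
  also have "\<dots> = ?I {0..<1}"
    using b by (intro nn_integral_cong) (auto simp: indicator_def)
  finally show ?thesis .
qed

text \<open>The four quarter periods of |sin| are translates or reflections of the first, and the
  closed quarters cover the period. This reduces every circle integral of a function of
  \<open>cdet\<close> to [0, 1/4], where the sine is comparable to its argument.\<close>

lemma nn_integral_abs_sin_le:
  fixes h :: "real \<Rightarrow> ennreal"
  assumes [measurable]: "h \<in> borel_measurable borel"
  shows "(\<integral>\<^sup>+t. h \<bar>sin (2 * pi * (t + a))\<bar> * indicator {0..<1} t \<partial>lborel) \<le>
    4 * (\<integral>\<^sup>+t. h (sin (2 * pi * t)) * indicator {0..1/4} t \<partial>lborel)"
proof -
  have per: "sin (2 * pi * (t + of_int m)) = sin (2 * pi * t)" for t :: real and m :: int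
    using cpt_add_int[of t m] by (simp add: cpt_def)
  let ?g = "\<lambda>t. h \<bar>sin (2 * pi * t)\<bar>"
  let ?Q = "\<integral>\<^sup>+t. h (sin (2 * pi * t)) * indicator {0..1/4} t \<partial>lborel"
  \<comment> \<open>The pairs (s, b) inserted below, (1, 0), (-1, -1/2), (1, 1/2), (-1, -1),
    describe the quarters [0, 1/4], [1/4, 1/2], [1/2, 3/4], [3/4, 1] in this order.\<close>
  have piece: "(\<integral>\<^sup>+t. ?g t * indicator {0..1/4} (s * t - b) \<partial>lborel) = ?Q"
    if s: "s = 1 \<or> s = -1" and refl: "\<And>x. \<bar>sin (2 * pi * (s * (x + b)))\<bar> = \<bar>sin (2 * pi * x)\<bar>" for s b :: real
  proof -
    have "(\<integral>\<^sup>+t. ?g t * indicator {0..1/4} (s * t - b) \<partial>lborel) =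
        (\<integral>\<^sup>+x. ?g (s * b + s * x) * indicator {0..1/4} (s * (s * b + s * x) - b) \<partial>lborel)"
      using s by (subst nn_integral_real_affine[where c=s and t="s * b"]) auto
    also have "\<dots> = ?Q"
    proof (rule nn_integral_cong)
      fix x
      have "s * (s * b + s * x) - b = x" using s by auto
      moreover have "\<bar>sin (2 * pi * (s * b + s * x))\<bar> = \<bar>sin (2 * pi * x)\<bar>"
        using refl[of x] by (simp add: algebra_simps)
      moreover have "sin (2 * pi * x) \<ge> 0" if "x \<in> {0..1/4}"
        using that by (intro sin_ge_zero) (auto simp: field_simps)
      ultimately show "?g (s * b + s * x) * indicator {0..1/4} (s * (s * b + s * x) - b) =
          h (sin (2 * pi * x)) * indicator {0..1/4} x"
        by (auto simp: indicator_def)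
    qed
    finally show ?thesis .
  qed
  have half: "\<bar>sin (2 * pi * (x + 1 / 2))\<bar> = \<bar>sin (2 * pi * x)\<bar>" for x
    by (simp add: distrib_left)
  have "(\<integral>\<^sup>+t. ?g (t + a) * indicator {0..<1} t \<partial>lborel) = (\<integral>\<^sup>+t. ?g t * indicator {0..<1} t \<partial>lborel)"
    by (intro nn_integral_periodic_shift) (auto simp: per)
  also have "\<dots> \<le> (\<integral>\<^sup>+t. ?g t * indicator {0..1/4} (1 * t - 0) + ?g t * indicator {0..1/4} (- 1 * t - (- 1 / 2))
      + ?g t * indicator {0..1/4} (1 * t - 1 / 2) + ?g t * indicator {0..1/4} (- 1 * t - (- 1)) \<partial>lborel)"
    by (intro nn_integral_mono) (auto simp: indicator_def not_le field_simps)
  also have "\<dots> = (\<integral>\<^sup>+t. ?g t * indicator {0..1/4} (1 * t - 0) \<partial>lborel) + (\<integral>\<^sup>+t. ?g t * indicator {0..1/4} (- 1 * t - (- 1 / 2)) \<partial>lborel)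
      + (\<integral>\<^sup>+t. ?g t * indicator {0..1/4} (1 * t - 1 / 2) \<partial>lborel) + (\<integral>\<^sup>+t. ?g t * indicator {0..1/4} (- 1 * t - (- 1)) \<partial>lborel)"
    by (simp add: nn_integral_add)
  also have "\<dots> = ?Q + ?Q + ?Q + ?Q"
  proof (intro arg_cong2[where f="(+)"] piece)
    show "\<bar>sin (2 * pi * (- 1 * (x + - 1 / 2)))\<bar> = \<bar>sin (2 * pi * x)\<bar>" for x
      using half[of "- x"] by (simp add: algebra_simps)
    show "\<bar>sin (2 * pi * (- 1 * (x + - 1)))\<bar> = \<bar>sin (2 * pi * x)\<bar>" for x
      using per[of "- x" 1] by (simp add: algebra_simps)
  qed (auto simp: half)
  also have "\<dots> = (1 + 1 + 1 + 1) * ?Q" by (simp only: distrib_right mult_1)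
  finally show ?thesis by simp
qed

text \<open>Jordan's inequality: on [0, 1/4] the concave function sin (2 \<pi> t) lies above its
  chord.\<close>

lemma sin_lower_bound:
  fixes t :: real
  assumes "0 \<le> t" "t \<le> 1 / 4"
  shows "4 * t \<le> sin (2 * pi * t)"
proof -
  have c: "convex_on {0..pi / 2} (\<lambda>x. - sin x)"
    by (rule f''_ge0_imp_convex[where f'="\<lambda>x. - cos x" and f''=sin])
       (auto intro!: derivative_eq_intros sin_ge_zero)
  have "- sin ((1 - 4 * t) *\<^sub>R 0 + (4 * t) *\<^sub>R (pi / 2)) \<le> (1 - 4 * t) * (- sin 0) + (4 * t) * (- sin (pi / 2))"
    using assms by (intro convex_onD[OF c]) auto
  then show ?thesis by (simp add: mult_ac)
qed

lemma ennreal_4_mult: "x \<ge> 0 \<Longrightarrow> y \<ge> 0 \<Longrightarrow> 4 * (ennreal x * ennreal y) = ennreal (4 * (x * y))"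
  using ennreal_mult[of 4 "x * y"] ennreal_mult[of x y] by simp

text \<open>By Jordan's inequality the kernel is at most (4 t)^(-c), and the integration runs over a
  subset of t \<le> r / 4. Four quarters of this integral give exactly the stated constant, finite
  because c < 1.\<close>

lemma cdet_near:
  assumes c: "0 < c" "c < 1" and p: "p \<in> circle" and r: "r > 0"
  shows "(\<integral>\<^sup>+q. ennreal (cdet p q powr (- c)) * indicator {..r} (cdet p q) \<partial>circle_measure) \<le> ennreal (1 / (1 - c) * r powr (1 - c))"
proof -
  obtain s where s: "p = cpt s" using circle_cpt[OF p] by auto
  define h where "h = (\<lambda>x. ennreal (x powr (- c)) * indicator {..r} x)"
  have [measurable]: "h \<in> borel_measurable borel" unfolding h_def by measurable
  have "(\<integral>\<^sup>+q. ennreal (cdet p q powr (- c)) * indicator {..r} (cdet p q) \<partial>circle_measure) =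
      (\<integral>\<^sup>+t. h \<bar>sin (2 * pi * (t + - s))\<bar> * indicator {0..<1} t \<partial>lborel)"
    unfolding h_def by (subst nn_integral_circle_measure) (auto simp: cdet_cpt s)
  also have "\<dots> \<le> 4 * (\<integral>\<^sup>+t. h (sin (2 * pi * t)) * indicator {0..1/4} t \<partial>lborel)"
    by (rule nn_integral_abs_sin_le) measurable
  also have "\<dots> \<le> 4 * (\<integral>\<^sup>+t. ennreal (4 powr (- c)) * (ennreal (t powr (- c)) * indicator {0..r/4} t) \<partial>lborel)"
  proof (intro mult_left_mono nn_integral_mono)
    fix t :: real
    show "h (sin (2 * pi * t)) * indicator {0..1/4} t \<le> ennreal (4 powr (- c)) * (ennreal (t powr (- c)) * indicator {0..r/4} t)"
    proof (cases "0 < t \<and> t \<le> 1/4 \<and> sin (2 * pi * t) \<le> r")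
      case True
      then have "4 * t \<le> sin (2 * pi * t)" by (intro sin_lower_bound) auto
      then have "sin (2 * pi * t) powr (- c) \<le> (4 * t) powr (- c)" "t \<le> r / 4"
        using True c by (auto intro!: powr_mono2')
      then show ?thesis
        using True by (auto simp: h_def powr_mult simp flip: ennreal_mult intro!: ennreal_leI)
    qed (auto simp: h_def indicator_def)
  qed auto
  also have "\<dots> = 4 * (ennreal (4 powr (- c)) * ennreal ((r / 4) powr (1 - c) / (1 - c)))"
    using nn_integral_powr_Icc[of "- c" "r / 4"] c r by (simp add: nn_integral_cmult)
  also have "\<dots> = ennreal (1 / (1 - c) * r powr (1 - c))"
  proof -
    have "4 * (4 powr (- c) * ((r / 4) powr (1 - c) / (1 - c))) = 1 / (1 - c) * r powr (1 - c)"
      using r c by (simp add: powr_divide powr_diff powr_minus field_simps)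
    moreover have "4 * (ennreal (4 powr (- c)) * ennreal ((r / 4) powr (1 - c) / (1 - c))) =
        ennreal (4 * (4 powr (- c) * ((r / 4) powr (1 - c) / (1 - c))))"
      using c r by (intro ennreal_4_mult) auto
    ultimately show ?thesis by (simp only:)
  qed
  finally show ?thesis .
qed

lemma cdet_far:
  assumes p: "p \<in> circle" and r: "r > 0"
  shows "(\<integral>\<^sup>+q. ennreal (cdet p q powr (- 2)) * indicator {r<..} (cdet p q) \<partial>circle_measure) \<le> ennreal (2 / r)"
proof -
  obtain s where s: "p = cpt s" using circle_cpt[OF p] by auto
  define h where "h = (\<lambda>x. ennreal (x powr (- 2)) * indicator {r<..} x)"
  have [measurable]: "h \<in> borel_measurable borel" unfolding h_def by measurable
  \<comment> \<open>Since sin x \<le> x, the condition r < sin (2 \<pi> t) forces t \<ge> b. With (4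
    t)^(-2) in place of the kernel, four quarters then contribute \<pi> / (2 r), which is below 2 /
    r.\<close>
  define b where "b = r / (2 * pi)"
  have b: "b > 0" using r by (simp add: b_def)
  have I: "(\<integral>\<^sup>+t. ennreal (indicator {b..} t * t powr (- 2)) \<partial>lborel) = ennreal (1 / b)"
  proof -
    have "((\<lambda>x. x powr (- 2)) has_integral - (b powr (- 2 + 1)) / (- 2 + 1)) {b..}"
      using b by (intro has_integral_powr_to_inf) auto
    then have "((\<lambda>x. x powr (- 2)) has_integral 1 / b) {b..}"
      using b by (simp add: powr_neg_one)
    then show ?thesis by (intro nn_integral_has_integral_lebesgue) auto
  qed
  have "(\<integral>\<^sup>+q. ennreal (cdet p q powr (- 2)) * indicator {r<..} (cdet p q) \<partial>circle_measure) =
      (\<integral>\<^sup>+t. h \<bar>sin (2 * pi * (t + - s))\<bar> * indicator {0..<1} t \<partial>lborel)"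
    unfolding h_def by (subst nn_integral_circle_measure) (auto simp: cdet_cpt s)
  also have "\<dots> \<le> 4 * (\<integral>\<^sup>+t. h (sin (2 * pi * t)) * indicator {0..1/4} t \<partial>lborel)"
    by (rule nn_integral_abs_sin_le) measurable
  also have "\<dots> \<le> 4 * (\<integral>\<^sup>+t. ennreal (1 / 16) * ennreal (indicator {b..} t * t powr (- 2)) \<partial>lborel)"
  proof (intro mult_left_mono nn_integral_mono)
    fix t :: real
    show "h (sin (2 * pi * t)) * indicator {0..1/4} t \<le> ennreal (1 / 16) * ennreal (indicator {b..} t * t powr (- 2))"
    proof (cases "0 < t \<and> t \<le> 1/4 \<and> r < sin (2 * pi * t)")
      case True
      then have "4 * t \<le> sin (2 * pi * t)" by (intro sin_lower_bound) auto
      then have "sin (2 * pi * t) powr (- 2) \<le> (4 * t) powr (- 2)"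
        using True by (intro powr_mono2') auto
      also have "\<dots> = 1 / 16 * t powr (- 2)"
        using True by (simp add: powr_mult powr_minus powr_numeral)
      finally have "sin (2 * pi * t) powr (- 2) \<le> 1 / 16 * t powr (- 2)" .
      moreover have "r < 2 * pi * t" using True sin_x_le_x[of "2 * pi * t"] by auto
      then have "b \<le> t" by (simp add: b_def field_simps)
      ultimately show ?thesis
        using True by (simp add: h_def ennreal_leI flip: ennreal_mult)
    next
      case False
      then have "h (sin (2 * pi * t)) * indicator {0..1/4} t = 0"
        using r by (cases "t = 0") (auto simp: h_def indicator_def)
      then show ?thesis by (metis zero_le)
    qed
  qed auto
  also have "\<dots> = 4 * (ennreal (1 / 16) * ennreal (1 / b))"
    using I by (subst nn_integral_cmult) auto
  also have "\<dots> = ennreal (4 * (1 / 16 * (1 / b)))"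
    using b by (intro ennreal_4_mult) auto
  also have "\<dots> \<le> ennreal (2 / r)"
    using r pi_less_4 by (intro ennreal_leI) (simp add: b_def field_simps)
  finally show ?thesis .
qed

section \<open>Gaussian averages of the sum of two points of the circle\<close>

lemma nn_integral_gauss:
  fixes c :: "'a::euclidean_space"
  assumes e: "e > 0"
  shows "(\<integral>\<^sup>+x. ennreal (gauss e (x - c)) \<partial>lborel) = 1"
proof -
  have g: "exp (- (pi * (1 / e)\<^sup>2 * (norm x)\<^sup>2)) = e ^ DIM('a) * gauss e x" for x :: 'a
    using e by (simp add: gauss_def power_divide)
  have "integrable lborel (\<lambda>x::'a. e ^ DIM('a) * gauss e x)"
    "(LINT x|lborel. e ^ DIM('a) * gauss e (x::'a)) = e ^ DIM('a)"
    using gaussian_integral[of "1 / e", where 'a='a] e unfolding g by (auto simp: power_divide)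
  then have i: "integrable lborel (gauss e :: 'a \<Rightarrow> real)" and "(LINT x|lborel. gauss e (x::'a)) = 1"
    using e by simp_all
  then have "(\<integral>\<^sup>+x. ennreal (gauss e (x::'a)) \<partial>lborel) = 1"
    using e by (subst nn_integral_eq_integral) auto
  also have "(\<integral>\<^sup>+x. ennreal (gauss e (x::'a)) \<partial>lborel) = (\<integral>\<^sup>+x. ennreal (gauss e (x::'a)) \<partial>distr lborel borel ((+) (- c)))"
    by (simp add: lborel_distr_plus)
  also have "\<dots> = (\<integral>\<^sup>+x. ennreal (gauss e (x - c)) \<partial>lborel)"
    by (subst nn_integral_distr) auto
  finally show ?thesis by simp
qed

text \<open>Split |x| \<le> |c| + |x - c|. Half of the Gaussian exponent absorbs the factor |x - c|,
  leaving a Gaussian of width sqrt 2 e, again of mass 1; the constant 2 rounds up sqrt 2.\<close>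

lemma nn_integral_abs_gauss_le:
  fixes c e :: real
  assumes e: "e > 0"
  shows "(\<integral>\<^sup>+x. ennreal (\<bar>x\<bar> * gauss e (x - c)) \<partial>lborel) \<le> ennreal (\<bar>c\<bar> + 2 * e)"
proof -
  have *: "\<bar>z\<bar> * gauss e z \<le> sqrt 2 * e * gauss (sqrt 2 * e) z" for z :: real
  proof -
    define w where "w = exp (- (pi * z\<^sup>2 / (2 * e\<^sup>2)))"
    have "\<bar>z\<bar> / e * w \<le> 1"
    proof -
      have "\<bar>z\<bar> / e \<le> 1 + (z / e)\<^sup>2 / 2"
        using sum_squares_bound[of "\<bar>z\<bar> / e" 1] by (simp add: power_divide)
      also have "\<dots> \<le> 1 + pi * z\<^sup>2 / (2 * e\<^sup>2)"
        using pi_gt3 e mult_right_mono[of 1 pi "z\<^sup>2"] by (simp add: power_divide field_simps)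
      also have "\<dots> \<le> exp (pi * z\<^sup>2 / (2 * e\<^sup>2))"
        by (rule exp_ge_add_one_self)
      also have "\<dots> = 1 / w" by (simp add: w_def exp_minus field_simps)
      finally show ?thesis by (simp add: w_def pos_le_divide_eq)
    qed
    then have "\<bar>z\<bar> / e * w * w \<le> 1 * w"
      by (intro mult_right_mono) (auto simp: w_def)
    moreover have "w * w = exp (- (pi * z\<^sup>2 / e\<^sup>2))"
      by (simp add: w_def flip: exp_add)
    moreover have "sqrt 2 * e * gauss (sqrt 2 * e) z = w"
      using e by (simp add: gauss_def w_def power_mult_distrib)
    ultimately show ?thesis
      by (simp add: gauss_def mult.assoc)
  qed
  have "(\<integral>\<^sup>+x. ennreal (\<bar>x\<bar> * gauss e (x - c)) \<partial>lborel) \<le>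
      (\<integral>\<^sup>+x. ennreal \<bar>c\<bar> * ennreal (gauss e (x - c)) + ennreal (sqrt 2 * e) * ennreal (gauss (sqrt 2 * e) (x - c)) \<partial>lborel)"
  proof (rule nn_integral_mono)
    fix x
    have "\<bar>x\<bar> * gauss e (x - c) \<le> (\<bar>c\<bar> + \<bar>x - c\<bar>) * gauss e (x - c)"
      using e by (intro mult_right_mono) auto
    also have "\<dots> \<le> \<bar>c\<bar> * gauss e (x - c) + sqrt 2 * e * gauss (sqrt 2 * e) (x - c)"
      using *[of "x - c"] by (simp add: distrib_right)
    finally show "ennreal (\<bar>x\<bar> * gauss e (x - c)) \<le>
        ennreal \<bar>c\<bar> * ennreal (gauss e (x - c)) + ennreal (sqrt 2 * e) * ennreal (gauss (sqrt 2 * e) (x - c))"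
      using e by (simp add: ennreal_leI flip: ennreal_mult ennreal_plus)
  qed
  also have "\<dots> = ennreal \<bar>c\<bar> + ennreal (sqrt 2 * e)"
    using e by (simp add: nn_integral_add nn_integral_cmult nn_integral_gauss)
  also have "\<dots> \<le> ennreal (\<bar>c\<bar> + 2 * e)"
    using e sqrt2_less_2 by (simp add: ennreal_leI flip: ennreal_plus)
  finally show ?thesis .
qed

text \<open>Pythagoras in the frame of \<open>cpt u\<close>: the component along
  \<open>cpt u\<close> is r + y \<bullet> \<open>cpt u\<close>, and the orthogonal component
  involves y alone. So r occurs in one factor only.\<close>

lemma gauss_polar:
  fixes y :: "real \<times> real"
  shows "gauss e (y + r *\<^sub>R cpt u) =
    gauss e (r - (- (y \<bullet> cpt u))) * gauss e (fst y * sin (2 * pi * u) - snd y * cos (2 * pi * u))"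
proof -
  let ?c = "cos (2 * pi * u)" and ?s = "sin (2 * pi * u)"
  \<comment> \<open>The factors 1 mark the places where sin^2 + cos^2 is substituted.\<close>
  have "(fst y * 1)\<^sup>2 + (snd y * 1)\<^sup>2 + 2 * r * (fst y * ?c + snd y * ?s) + r\<^sup>2 * 1 =
      (fst y + r * ?c)\<^sup>2 + (snd y + r * ?s)\<^sup>2"
    unfolding sin_cos_squared_add[of "2 * pi * u", symmetric]
    using sin_cos_squared_add[of "2 * pi * u"] by algebra
  moreover have "(fst y * 1)\<^sup>2 + (snd y * 1)\<^sup>2 + 2 * r * (fst y * ?c + snd y * ?s) + r\<^sup>2 * 1 =
      (r + (fst y * ?c + snd y * ?s))\<^sup>2 + (fst y * ?s - snd y * ?c)\<^sup>2"
    using sin_cos_squared_add[of "2 * pi * u"] by algebra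
  ultimately have "(norm (y + r *\<^sub>R cpt u))\<^sup>2 = (r + y \<bullet> cpt u)\<^sup>2 + (fst y * ?s - snd y * ?c)\<^sup>2"
    by (simp add: cpt_def norm_prod_def inner_prod_def)
  then show ?thesis
    unfolding gauss_def
    by (simp add: power2_eq_square add_divide_distrib distrib_left flip: exp_add)
qed

text \<open>The orthogonal component has to pay for the factor |y| + 2 e that the first moment in
  the radius produces. The trivial bound 1 / e accounts for the term 2 e with the value 2. For the
  term R, Jordan's inequality replaces the sine by 4 u, so each quarter contributes at most 1 / (4
  R), and together they give 1.\<close>

lemma nn_integral_gauss_sin_le:
  fixes R e :: real
  assumes e: "e > 0" and R: "R \<ge> 0"
  shows "(\<integral>\<^sup>+u. ennreal (gauss e (R * sin (2 * pi * (u + a)))) * indicator {0..<1} u \<partial>lborel) * ennreal (R + 2 * e) \<le> 3"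
proof -
  let ?J = "\<integral>\<^sup>+u. ennreal (gauss e (R * sin (2 * pi * (u + a)))) * indicator {0..<1} u \<partial>lborel"
  have "?J \<le> (\<integral>\<^sup>+u. ennreal (1 / e) * indicator {0..<1} (u::real) \<partial>lborel)"
    by (intro nn_integral_mono mult_right_mono ennreal_leI) (simp_all add: gauss_le[OF e, where 'a=real, simplified])
  also have "\<dots> = ennreal (1 / e)" by (subst nn_integral_cmult_indicator) auto
  finally have J1: "?J \<le> ennreal (1 / e)" .
  have J2: "?J * ennreal R \<le> 1"
  proof (cases "R = 0")
    case False
    then have R: "R > 0" using R by simp
    have "?J = (\<integral>\<^sup>+u. ennreal (gauss e (R * \<bar>sin (2 * pi * (u + a))\<bar>)) * indicator {0..<1} u \<partial>lborel)"
      by (simp add: gauss_def power_mult_distrib)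
    also have "\<dots> \<le> 4 * (\<integral>\<^sup>+u. ennreal (gauss e (R * sin (2 * pi * u))) * indicator {0..1/4} u \<partial>lborel)"
      by (rule nn_integral_abs_sin_le) measurable
    also have "\<dots> \<le> 4 * (\<integral>\<^sup>+u. ennreal (1 / (4 * R)) * ennreal (gauss (e / (4 * R)) ((u::real) - 0)) \<partial>lborel)"
    proof (intro mult_left_mono nn_integral_mono)
      fix u :: real
      show "ennreal (gauss e (R * sin (2 * pi * u))) * indicator {0..1/4} u \<le> ennreal (1 / (4 * R)) * ennreal (gauss (e / (4 * R)) (u - 0))"
      proof (cases "u \<in> {0..1/4}")
        case True
        then have "(4 * u)\<^sup>2 \<le> (sin (2 * pi * u))\<^sup>2"
          using sin_lower_bound[of u] by (intro power_mono) auto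
        then have "pi * (R * (4 * u))\<^sup>2 / e\<^sup>2 \<le> pi * (R * sin (2 * pi * u))\<^sup>2 / e\<^sup>2"
          unfolding power_mult_distrib by (intro divide_right_mono mult_left_mono) auto
        then have "gauss e (R * sin (2 * pi * u)) \<le> exp (- (pi * (R * (4 * u))\<^sup>2 / e\<^sup>2)) / e"
          using e by (simp add: gauss_def divide_right_mono)
        also have "\<dots> = 1 / (4 * R) * gauss (e / (4 * R)) (u - 0)"
          using e R by (simp add: gauss_def field_simps power_mult_distrib power_divide)
        finally show ?thesis
          using True e R by (simp add: ennreal_leI flip: ennreal_mult)
      qed auto
    qed auto
    also have "\<dots> = 4 * (ennreal (1 / (4 * R)) * 1)"
      using e R nn_integral_gauss[of "e / (4 * R)" "0::real"] by (subst nn_integral_cmult) auto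
    finally have "?J * ennreal R \<le> 4 * (ennreal (1 / (4 * R)) * 1) * ennreal R"
      by (intro mult_right_mono) auto
    also have "\<dots> = 4 * (ennreal (1 / (4 * R)) * ennreal R)" by (simp add: mult_ac)
    also have "\<dots> = ennreal (4 * (1 / (4 * R) * R))"
      using R by (intro ennreal_4_mult) auto
    also have "\<dots> = 1" using R by simp
    finally show ?thesis .
  qed simp
  have "?J * ennreal (R + 2 * e) = ?J * ennreal R + ?J * ennreal (2 * e)"
    using e R by (simp add: distrib_left)
  also have "\<dots> \<le> 1 + ennreal (1 / e) * ennreal (2 * e)"
    by (intro add_mono J2 mult_right_mono J1) auto
  also have "ennreal (1 / e) * ennreal (2 * e) = ennreal 2"
    using e by (simp flip: ennreal_mult)
  finally show ?thesis by simp
qed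

text \<open>The arc length measures of two circles convolve to a measure of density \<open>1 / cdet\<close>, up to a constant;
  in the coordinates \<open>u = (s + t) / 2\<close>, \<open>v = t - s\<close> this is integration in polar coordinates.\<close>

lemma cdet_gauss_bound:
  fixes y :: "real \<times> real"
  assumes e: "e > 0"
  shows "(\<integral>\<^sup>+p. \<integral>\<^sup>+q. ennreal (cdet p q) * ennreal (gauss e (y - (p + q))) \<partial>circle_measure \<partial>circle_measure) \<le> 3"
proof -
  let ?i = "\<lambda>t::real. indicator {0..<1} t :: ennreal"
  define A where "A = (\<lambda>s v. ennreal \<bar>sin (2 * pi * v)\<bar> * ennreal (gauss e (y - (cpt s + cpt (v + s)))))"
  define B where "B = (\<lambda>u v. ennreal \<bar>sin (2 * pi * v)\<bar> * ennreal (gauss e (y + (- 2 * cos (pi * v)) *\<^sub>R cpt u)))"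
  have [measurable]: "case_prod A \<in> borel_measurable (borel \<Otimes>\<^sub>M borel)" "case_prod B \<in> borel_measurable (borel \<Otimes>\<^sub>M borel)"
    unfolding A_def B_def by measurable
  have sinp: "\<bar>sin (2 * pi * (t + of_int m))\<bar> = \<bar>sin (2 * pi * t)\<bar>" for t :: real and m :: int
    using cpt_add_int[of t m] by (simp add: cpt_def)
  have "(\<integral>\<^sup>+p. \<integral>\<^sup>+q. ennreal (cdet p q) * ennreal (gauss e (y - (p + q))) \<partial>circle_measure \<partial>circle_measure) =
      (\<integral>\<^sup>+p. \<integral>\<^sup>+t. ennreal (cdet p (cpt t)) * ennreal (gauss e (y - (p + cpt t))) * ?i t \<partial>lborel \<partial>circle_measure)"
    by (intro nn_integral_cong nn_integral_circle_measure) measurable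
  also have "\<dots> = (\<integral>\<^sup>+s. (\<integral>\<^sup>+t. ennreal (cdet (cpt s) (cpt t)) * ennreal (gauss e (y - (cpt s + cpt t))) * ?i t \<partial>lborel) * ?i s \<partial>lborel)"
    by (intro nn_integral_circle_measure) measurable
  also have "\<dots> = (\<integral>\<^sup>+s. (\<integral>\<^sup>+v. A s v * ?i v \<partial>lborel) * ?i s \<partial>lborel)"
  proof (rule nn_integral_cong)
    fix s
    define h where "h = (\<lambda>t. ennreal (cdet (cpt s) (cpt t)) * ennreal (gauss e (y - (cpt s + cpt t))))"
    have "(\<integral>\<^sup>+t. h (t + s) * ?i t \<partial>lborel) = (\<integral>\<^sup>+t. h t * ?i t \<partial>lborel)"
      by (rule nn_integral_periodic_shift) (auto simp: h_def)
    then show "(\<integral>\<^sup>+t. ennreal (cdet (cpt s) (cpt t)) * ennreal (gauss e (y - (cpt s + cpt t))) * ?i t \<partial>lborel) * ?i s =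
        (\<integral>\<^sup>+v. A s v * ?i v \<partial>lborel) * ?i s"
      by (simp add: h_def A_def cdet_cpt)
  qed
  also have "\<dots> = (\<integral>\<^sup>+s. (\<integral>\<^sup>+v. A s v * ?i v * ?i s \<partial>lborel) \<partial>lborel)"
    by (intro nn_integral_cong nn_integral_multc[symmetric]) measurable
  also have "\<dots> = (\<integral>\<^sup>+v. (\<integral>\<^sup>+s. A s v * ?i v * ?i s \<partial>lborel) \<partial>lborel)"
    by (rule lborel_pair.Fubini'[symmetric]) measurable
  also have "\<dots> = (\<integral>\<^sup>+v. (\<integral>\<^sup>+u. B u v * ?i v * ?i u \<partial>lborel) \<partial>lborel)"
  proof (rule nn_integral_cong)
    fix v
    define h where "h = (\<lambda>u. B u v * ?i v)"
    \<comment> \<open>Two unit vectors at parameters s and s + v add up to 2 cos (\<pi> v) times the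
      unit vector at the mean parameter. The shift by v / 2 is then absorbed by the periodicity of B
      in u.\<close>
    have AB: "A s v = B (s + v / 2) v" for s
    proof -
      have "cpt s + cpt (v + s) = (2 * cos (pi * v)) *\<^sub>R cpt (s + v / 2)"
      proof -
        have "(2 * pi * s + 2 * pi * (v + s)) / 2 = 2 * pi * (s + v / 2)" "(2 * pi * s - 2 * pi * (v + s)) / 2 = - (pi * v)"
          by (simp_all add: field_simps)
        then show ?thesis
          unfolding cpt_def by (simp only: add_Pair cos_plus_cos sin_plus_sin cos_minus) simp
      qed
      then show ?thesis by (simp add: A_def B_def)
    qed
    have "(\<integral>\<^sup>+s. h (s + v / 2) * ?i s \<partial>lborel) = (\<integral>\<^sup>+s. h s * ?i s \<partial>lborel)"
      by (rule nn_integral_periodic_shift) (auto simp: h_def B_def)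
    then show "(\<integral>\<^sup>+s. A s v * ?i v * ?i s \<partial>lborel) = (\<integral>\<^sup>+u. B u v * ?i v * ?i u \<partial>lborel)"
      by (simp add: h_def AB)
  qed
  also have "\<dots> = (\<integral>\<^sup>+u. (\<integral>\<^sup>+v. B u v * ?i v * ?i u \<partial>lborel) \<partial>lborel)"
    by (rule lborel_pair.Fubini') measurable
  also have "\<dots> = (\<integral>\<^sup>+u. (\<integral>\<^sup>+v. B u v * ?i v \<partial>lborel) * ?i u \<partial>lborel)"
    by (intro nn_integral_cong nn_integral_multc) measurable
  also have "\<dots> \<le> (\<integral>\<^sup>+u. (ennreal (gauss e (fst y * sin (2 * pi * u) - snd y * cos (2 * pi * u))) * ennreal (norm y + 2 * e)) * ?i u \<partial>lborel)"
  proof (intro nn_integral_mono mult_right_mono)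
    fix u
    define f where "f = (\<lambda>r. \<bar>r\<bar> * gauss e (y + r *\<^sub>R cpt u))"
    have [measurable]: "f \<in> borel_measurable borel" unfolding f_def by measurable
    \<comment> \<open>In the radius r = - 2 cos (\<pi> v) the weight |sin (2 \<pi> v)| equals |r|
      dr/dv divided by 2 \<pi>, the area element of polar coordinates; this quotient is bounded by
      |r| dr/dv. The minus sign comes from y - (p + q) and makes r increasing on [0, 1].\<close>
    let ?g = "\<lambda>v. - 2 * cos (pi * v)" and ?g' = "\<lambda>v. 2 * pi * sin (pi * v)"
    have sub: "(\<integral>\<^sup>+x. f x * indicator {?g 0..?g 1} x \<partial>lborel) = (\<integral>\<^sup>+x. f (?g x) * ?g' x * indicator {0..1} x \<partial>lborel)"
    proof (rule nn_integral_substitution)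
      show "(?g has_real_derivative ?g' x) (at x)" for x
        by (auto intro!: derivative_eq_intros)
      show "continuous_on {0..1} ?g'" by (intro continuous_intros)
      show "?g' x \<ge> 0" if "x \<in> {0..1}" for x
        using that by (intro mult_nonneg_nonneg sin_ge_zero) auto
    qed (auto simp: set_borel_measurable_def)
    have "(\<integral>\<^sup>+v. B u v * ?i v \<partial>lborel) \<le> (\<integral>\<^sup>+v. ennreal (f (?g v) * ?g' v * indicator {0..1} v) \<partial>lborel)"
    proof (rule nn_integral_mono)
      fix v
      show "B u v * ?i v \<le> ennreal (f (?g v) * ?g' v * indicator {0..1} v)"
      proof (cases "v \<in> {0..<1}")
        case True
        then have s: "sin (pi * v) \<ge> 0" by (intro sin_ge_zero) auto
        have "\<bar>sin (2 * pi * v)\<bar> = 2 * \<bar>cos (pi * v)\<bar> * sin (pi * v)"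
          using s sin_double[of "pi * v"] by (simp add: abs_mult mult_ac)
        also have "\<dots> \<le> pi * (2 * \<bar>cos (pi * v)\<bar> * sin (pi * v))"
          using pi_gt3 s mult_right_mono[of 1 pi "2 * \<bar>cos (pi * v)\<bar> * sin (pi * v)"] by simp
        finally have "\<bar>sin (2 * pi * v)\<bar> * gauss e (y + ?g v *\<^sub>R cpt u) \<le>
            pi * (2 * \<bar>cos (pi * v)\<bar> * sin (pi * v)) * gauss e (y + ?g v *\<^sub>R cpt u)"
          using e by (intro mult_right_mono) auto
        also have "\<dots> \<le> f (?g v) * ?g' v"
          using s e by (simp add: f_def abs_mult mult_ac)
        finally have "ennreal (\<bar>sin (2 * pi * v)\<bar> * gauss e (y + ?g v *\<^sub>R cpt u)) \<le> ennreal (f (?g v) * ?g' v)"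
          by (rule ennreal_leI)
        moreover have "B u v = ennreal (\<bar>sin (2 * pi * v)\<bar> * gauss e (y + ?g v *\<^sub>R cpt u))"
          unfolding B_def using e by (intro ennreal_mult[symmetric]) auto
        moreover have "?i v = 1" "indicator {0..1} v = (1::real)"
          using True by auto
        ultimately show ?thesis by (simp only: mult_1_right)
      next
        case False
        then have "?i v = 0" by simp
        then show ?thesis by (simp only: mult_zero_right zero_le)
      qed
    qed
    also have "\<dots> = (\<integral>\<^sup>+x. ennreal (f x * indicator {?g 0..?g 1} x) \<partial>lborel)"
      by (rule sub[symmetric])
    also have "\<dots> \<le> (\<integral>\<^sup>+x. ennreal (f x) \<partial>lborel)"
    proof (intro nn_integral_mono ennreal_leI)
      fix x
      have "f x \<ge> 0" using e by (simp add: f_def)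
      then show "f x * indicator {?g 0..?g 1} x \<le> f x"
        by (simp only: mult_left_le indicator_le_1)
    qed
    also have "\<dots> = (\<integral>\<^sup>+x. ennreal (gauss e (fst y * sin (2 * pi * u) - snd y * cos (2 * pi * u))) * ennreal (\<bar>x\<bar> * gauss e (x - (- (y \<bullet> cpt u)))) \<partial>lborel)"
    proof (rule nn_integral_cong)
      fix x
      have "f x = gauss e (fst y * sin (2 * pi * u) - snd y * cos (2 * pi * u)) * (\<bar>x\<bar> * gauss e (x - (- (y \<bullet> cpt u))))"
        unfolding f_def gauss_polar by (simp only: mult_ac)
      then show "ennreal (f x) = ennreal (gauss e (fst y * sin (2 * pi * u) - snd y * cos (2 * pi * u))) * ennreal (\<bar>x\<bar> * gauss e (x - (- (y \<bullet> cpt u))))"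
        using e by (simp only: ennreal_mult[symmetric] gauss_nonneg mult_nonneg_nonneg abs_ge_zero)
    qed
    also have "\<dots> = ennreal (gauss e (fst y * sin (2 * pi * u) - snd y * cos (2 * pi * u))) * (\<integral>\<^sup>+x. ennreal (\<bar>x\<bar> * gauss e (x - (- (y \<bullet> cpt u)))) \<partial>lborel)"
      by (rule nn_integral_cmult) measurable
    also have "\<dots> \<le> ennreal (gauss e (fst y * sin (2 * pi * u) - snd y * cos (2 * pi * u))) * ennreal (\<bar>- (y \<bullet> cpt u)\<bar> + 2 * e)"
      by (intro mult_left_mono nn_integral_abs_gauss_le e) auto
    also have "\<dots> \<le> ennreal (gauss e (fst y * sin (2 * pi * u) - snd y * cos (2 * pi * u))) * ennreal (norm y + 2 * e)"
      using Cauchy_Schwarz_ineq2[of y "cpt u"] by (intro mult_left_mono ennreal_leI) auto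
    finally show "(\<integral>\<^sup>+v. B u v * ?i v \<partial>lborel) \<le>
        ennreal (gauss e (fst y * sin (2 * pi * u) - snd y * cos (2 * pi * u))) * ennreal (norm y + 2 * e)" .
  qed auto
  also have "\<dots> = (\<integral>\<^sup>+u. ennreal (gauss e (fst y * sin (2 * pi * u) - snd y * cos (2 * pi * u))) * ?i u \<partial>lborel) * ennreal (norm y + 2 * e)"
    by (subst nn_integral_multc[symmetric]) (auto simp: mult_ac)
  also have "\<dots> \<le> 3"
  proof -
    \<comment> \<open>The polar form of y turns the orthogonal component into |y| times a shifted
      sine.\<close>
    obtain b where b: "y = norm y *\<^sub>R cpt b"
    proof (cases "y = 0")
      case False
      have "y /\<^sub>R norm y \<in> circle"
        using False by (simp add: circle_iff_norm)
      from circle_cpt[OF this] show ?thesis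
        using False that by (metis divideR_right norm_eq_zero)
    qed (use that in auto)
    have "fst y * sin (2 * pi * u) - snd y * cos (2 * pi * u) = norm y * sin (2 * pi * (u + - b))" for u
      by (subst (1 2) b) (simp add: cpt_def right_diff_distrib sin_diff algebra_simps)
    then show ?thesis using nn_integral_gauss_sin_le[OF e, of "norm y" "- b"] by simp
  qed
  finally show ?thesis .
qed

section \<open>The torus\<close>

abbreviation circle_PiM :: "('n::finite \<Rightarrow> real \<times> real) measure" where
  "circle_PiM \<equiv> Pi\<^sub>M UNIV (\<lambda>_. circle_measure)"

lemma product_sigma_finite_circle: "product_sigma_finite (\<lambda>_. circle_measure)"
  by (simp add: product_sigma_finite_def prob_space_imp_sigma_finite prob_space_circle_measure)

lemma cdet_le_1: "p \<in> circle \<Longrightarrow> q \<in> circle \<Longrightarrow> cdet p q \<le> 1"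
  using circle_cpt[of p] circle_cpt[of q] by (auto simp: cdet_cpt)

text \<open>Permits division by the weight J almost everywhere. After reduction to [0, 1/4] the sine
  vanishes at 0 only.\<close>

lemma AE_cdet_nonzero:
  assumes "p \<in> circle"
  shows "AE q in circle_measure. cdet p q \<noteq> 0"
proof -
  obtain s where s: "p = cpt s" using circle_cpt[OF assms] by auto
  have "(\<integral>\<^sup>+q. indicator {0} (cdet p q) \<partial>circle_measure) =
      (\<integral>\<^sup>+t. indicator {0} \<bar>sin (2 * pi * (t + - s))\<bar> * indicator {0..<1} t \<partial>lborel)"
    by (subst nn_integral_circle_measure) (auto simp: cdet_cpt s)
  also have "\<dots> \<le> 4 * (\<integral>\<^sup>+t. indicator {0} (sin (2 * pi * t)) * indicator {0..1/4} t \<partial>lborel)"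
    by (rule nn_integral_abs_sin_le) measurable
  also have "\<dots> \<le> 4 * (\<integral>\<^sup>+t. indicator {0} (t::real) \<partial>lborel)"
  proof (intro mult_left_mono nn_integral_mono)
    fix t :: real
    show "indicator {0} (sin (2 * pi * t)) * indicator {0..1/4} t \<le> (indicator {0} t :: ennreal)"
      using sin_lower_bound[of t] by (auto simp: indicator_def)
  qed simp
  finally have "(\<integral>\<^sup>+q. indicator {0} (cdet p q) \<partial>circle_measure) = 0"
    by simp
  moreover have "(\<lambda>q. indicator {0} (cdet p q) :: ennreal) \<in> borel_measurable circle_measure"
    by (rule borel_measurable_circle_measureI) measurable
  ultimately have "AE q in circle_measure. indicator {0} (cdet p q) = (0::ennreal)"
    by (subst (asm) nn_integral_0_iff_AE) auto
  then show ?thesis by eventually_elim (auto simp: indicator_def split: if_splits)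
qed

lemma measurable_circle_pair_borel:
  "(\<lambda>p. p) \<in> circle_measure \<Otimes>\<^sub>M circle_measure \<rightarrow>\<^sub>M borel \<Otimes>\<^sub>M borel"
  unfolding measurable_pair_iff comp_def
  using measurable_compose[OF measurable_fst measurable_circle_measure_borel]
    measurable_compose[OF measurable_snd measurable_circle_measure_borel] by auto

lemma gauss_vec:
  fixes z :: "(real \<times> real) ^ 'n::finite"
  shows "gauss e z = (\<Prod>l\<in>UNIV. gauss e (z $ l))"
proof -
  have "(norm z)\<^sup>2 = (\<Sum>l\<in>UNIV. (norm (z $ l))\<^sup>2)"
    by (simp add: norm_vec_def L2_set_def sum_nonneg)
  moreover have "e ^ DIM((real \<times> real) ^ 'n) = (\<Prod>l\<in>(UNIV::'n set). e ^ DIM(real \<times> real))"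
    by (simp add: power_add power2_eq_square power_mult_distrib)
  ultimately show ?thesis
    unfolding gauss_def by (simp only: prod_dividef) (simp add: sum_distrib_left sum_divide_distrib flip: exp_sum sum_negf)
qed

lemma circle_component_measurable [measurable]:
  "(\<lambda>u. u l) \<in> borel_measurable (circle_PiM :: ('n::finite \<Rightarrow> real \<times> real) measure)"
  by (rule measurable_compose[OF _ measurable_circle_measure_borel], rule measurable_component_singleton) simp

lemma vec_lambda_measurable_borel [measurable]:
  "(vec_lambda :: ('n::finite \<Rightarrow> real \<times> real) \<Rightarrow> _) \<in> borel_measurable circle_PiM"
  using measurable_vec_lambda_circle by (rule measurable_restrict_space2_iff[THEN iffD1, THEN conjunct1])

lemma space_circle_PiM: "u \<in> space circle_PiM \<Longrightarrow> u l \<in> circle"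
  by (auto simp: space_PiM)

text \<open>Moves the transform to the product space of functions, where Tonelli and the induction
  over coordinates apply.\<close>

lemma inv_fourier_torus_osc:
  assumes [measurable]: "F \<in> borel_measurable torus_measure"
  shows "inv_fourier torus_measure F x = osc circle_PiM vec_lambda (\<lambda>u. F (vec_lambda u)) x"
proof -
  have "inv_fourier torus_measure F x = (LINT \<xi>|torus_measure. cis (2 * pi * (x \<bullet> \<xi>)) * F \<xi>)"
    unfolding inv_fourier_def by (simp add: cis_conv_exp mult_ac)
  also have "\<dots> = (LINT u|circle_PiM. cis (2 * pi * (x \<bullet> vec_lambda u)) * F (vec_lambda u))"
    unfolding torus_measure_def
  proof (rule integral_distr[OF measurable_vec_lambda_circle])
    have "F \<in> borel_measurable (restrict_space borel torus)" using assms by simp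
    moreover have "(\<lambda>\<xi>. cis (2 * pi * (x \<bullet> \<xi>))) \<in> borel_measurable (restrict_space borel torus)"
      by (intro measurable_restrict_space1) measurable
    ultimately show "(\<lambda>\<xi>. cis (2 * pi * (x \<bullet> \<xi>)) * F \<xi>) \<in> borel_measurable (restrict_space borel torus)"
      by (rule borel_measurable_times[rotated])
  qed
  finally show ?thesis by (simp add: osc_def)
qed

lemma circle_PiM_vec_measurable:
  assumes "F \<in> borel_measurable torus_measure"
  shows "(\<lambda>u. F (vec_lambda u)) \<in> borel_measurable circle_PiM"
  using assms by (intro measurable_compose[OF measurable_vec_lambda_circle]) simp

lemma nn_integral_torus:
  assumes "F \<in> borel_measurable torus_measure"
  shows "(\<integral>\<^sup>+\<xi>. F \<xi> \<partial>torus_measure) = (\<integral>\<^sup>+u. F (vec_lambda u) \<partial>circle_PiM)"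
  using assms unfolding torus_measure_def by (intro nn_integral_distr measurable_vec_lambda_circle) (simp add: torus_measure_def)

lemma integrable_of_powr:
  assumes "finite_measure M" and f[measurable]: "f \<in> borel_measurable M" and s: "s \<ge> 1"
    and fin: "(\<integral>\<^sup>+x. ennreal (norm (f x) powr s) \<partial>M) < \<infinity>"
  shows "integrable M (f :: 'a \<Rightarrow> complex)"
proof (rule integrableI_bounded[OF f])
  interpret finite_measure M by fact
  have "(\<integral>\<^sup>+x. ennreal (norm (f x)) \<partial>M) \<le> (\<integral>\<^sup>+x. 1 + ennreal (norm (f x) powr s) \<partial>M)"
  proof (rule nn_integral_mono)
    fix x
    have "norm (f x) \<le> 1 + norm (f x) powr s"
    proof (cases "norm (f x) \<le> 1")
      case False
      then have "norm (f x) powr 1 \<le> norm (f x) powr s" using s by (intro powr_mono) auto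
      then show ?thesis using False by simp
    qed (simp add: add_increasing2)
    then show "ennreal (norm (f x)) \<le> 1 + ennreal (norm (f x) powr s)"
      by (simp flip: ennreal_1 ennreal_plus)
  qed
  also have "\<dots> = emeasure M (space M) + (\<integral>\<^sup>+x. ennreal (norm (f x) powr s) \<partial>M)"
    by (simp add: nn_integral_add)
  also have "\<dots> < \<infinity>"
    using fin emeasure_finite[of "space M"] unfolding infinity_ennreal_def ennreal_add_less_top by (simp only: less_top)
  finally show "(\<integral>\<^sup>+x. ennreal (norm (f x)) \<partial>M) < \<infinity>" .
qed

lemma prod_le_power_ennreal:
  fixes f :: "'i \<Rightarrow> ennreal"
  assumes "finite A" and "\<And>i. i \<in> A \<Longrightarrow> f i \<le> c"
  shows "prod f A \<le> c ^ card A"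
  using assms by (induction A) (auto intro!: mult_mono)

text \<open>Gaussian, weight and measure all factor over the coordinates, so the bound 3 for one
  circle is multiplied once per coordinate.\<close>

lemma torus_gauss_bound:
  fixes y :: "(real \<times> real) ^ 'n::finite"
  assumes e: "e > 0"
  shows "(\<integral>\<^sup>+u. \<integral>\<^sup>+v. ennreal (\<Prod>l\<in>UNIV. cdet (u l) (v l)) * ennreal (gauss e (y - (vec_lambda u + vec_lambda v)))
      \<partial>circle_PiM \<partial>circle_PiM) \<le> 3 ^ CARD('n)"
proof -
  interpret product_sigma_finite "\<lambda>_::'n. circle_measure" by (rule product_sigma_finite_circle)
  define h where "h = (\<lambda>l p q. ennreal (cdet p q) * ennreal (gauss e (y $ l - (p + q))))"
  have hm: "case_prod (h l) \<in> borel_measurable (circle_measure \<Otimes>\<^sub>M circle_measure)" for l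
  proof -
    have "case_prod (h l) \<in> borel_measurable (borel \<Otimes>\<^sub>M borel)" unfolding h_def by measurable
    then show ?thesis by (rule measurable_compose[OF measurable_circle_pair_borel])
  qed
  note [measurable] = hm
  have hm2: "h l p \<in> borel_measurable circle_measure" if "p \<in> circle" for l p
    using measurable_compose_Pair1[of p circle_measure "case_prod (h l)"] hm[of l] that by simp
  interpret circ: sigma_finite_measure circle_measure
    by (rule prob_space_imp_sigma_finite[OF prob_space_circle_measure])
  have "(\<integral>\<^sup>+u. \<integral>\<^sup>+v. ennreal (\<Prod>l\<in>UNIV. cdet (u l) (v l)) * ennreal (gauss e (y - (vec_lambda u + vec_lambda v)))
      \<partial>circle_PiM \<partial>circle_PiM) = (\<integral>\<^sup>+u. \<integral>\<^sup>+v. (\<Prod>l\<in>UNIV. h l (u l) (v l)) \<partial>circle_PiM \<partial>circle_PiM)"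
    using e by (simp add: gauss_vec h_def prod.distrib prod_ennreal)
  also have "\<dots> = (\<integral>\<^sup>+u. (\<Prod>l\<in>UNIV. \<integral>\<^sup>+q. h l (u l) q \<partial>circle_measure) \<partial>circle_PiM)"
    by (intro nn_integral_cong product_nn_integral_prod) (auto intro!: hm2 space_circle_PiM)
  also have "\<dots> = (\<Prod>l\<in>UNIV. \<integral>\<^sup>+p. \<integral>\<^sup>+q. h l p q \<partial>circle_measure \<partial>circle_measure)"
    by (intro product_nn_integral_prod) auto
  also have "\<dots> \<le> 3 ^ CARD('n)"
    unfolding h_def by (intro prod_le_power_ennreal cdet_gauss_bound e) simp
  finally show ?thesis .
qed

text \<open>The endpoint estimate for normalised F. The bound 2 instead of 1 is what a function of
  norm at most 1 for a larger exponent satisfies, by the pointwise inequality z^\<sigma> \<le> 1 +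
  z^s; homogeneity is restored afterwards by \<open>extension_homogenise\<close>.\<close>

lemma torus_extension_normalised:
  fixes r :: real
  assumes r: "r > 4"
  obtains C :: real where "C > 0"
    "\<And>F. F \<in> borel_measurable (torus_measure :: ((real \<times> real) ^ 'n::finite) measure) \<Longrightarrow>
      (\<integral>\<^sup>+\<xi>. ennreal (norm (F \<xi>) powr (r / (r - 3))) \<partial>torus_measure) \<le> 2 \<Longrightarrow>
      (\<integral>\<^sup>+x. ennreal (norm (inv_fourier torus_measure F x) powr r) \<partial>lborel) \<le> ennreal C"
proof -
  let ?S = circle_measure
  let ?M = "circle_PiM :: ('n \<Rightarrow> real \<times> real) measure"
  let ?P = "?M \<Otimes>\<^sub>M ?M"
  interpret product_sigma_finite "\<lambda>_::'n. circle_measure" by (rule product_sigma_finite_circle)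
  interpret circ: prob_space circle_measure by (rule prob_space_circle_measure)
  note circ_sf = prob_space_imp_sigma_finite[OF prob_space_circle_measure]
  interpret M: prob_space ?M by (intro prob_space_PiM prob_space_circle_measure)
  interpret P: pair_sigma_finite ?M ?M ..
  interpret PP: pair_prob_space ?M ?M ..
  define t where "t = r / 2"
  define c where "c = 2 / (r - 2)"
  define a where "a = 2 / (2 - c)"
  have t: "t > 2" "t / (t - 1) = 1 + c" and c: "0 < c" "c < 1"
    using r by (auto simp: t_def c_def field_simps)
  have c2: "2 - c = 2 * (r - 3) / (r - 2)" and c1: "1 + c = r / (r - 2)"
    using r by (auto simp: c_def field_simps)
  have a': "a = (r - 2) / (r - 3)"
    unfolding a_def c2 using r by (simp add: divide_simps) (simp add: algebra_simps)
  have a: "a > 1" "(1 + c) * a = r / (r - 3)"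
    using r by (simp_all add: a' c1)
  define k where "k = (\<lambda>p q. ennreal (cdet p q powr (- c)))"
  have cm[measurable]: "case_prod cdet \<in> borel_measurable (?S \<Otimes>\<^sub>M ?S)"
    by (rule measurable_compose[OF measurable_circle_pair_borel]) measurable
  have km[measurable]: "case_prod k \<in> borel_measurable (?S \<Otimes>\<^sub>M ?S)"
    unfolding k_def by measurable
  \<comment> \<open>One constant for both kernel hypotheses: 1 / (1 - c) from
    \<open>cdet_near\<close> and 2 from \<open>cdet_far\<close>.\<close>
  define A where "A = max (1 / (1 - c)) 2"
  have A: "A \<ge> 0" "A \<ge> 1 / (1 - c)" "A \<ge> 2" by (auto simp: A_def)
  define C1 where "C1 = 2 * (2 * A + 1)"
  have C1: "C1 > 0" using A by (simp add: C1_def)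
  have hls1: "(\<integral>\<^sup>+x. (\<integral>\<^sup>+y. f x * g y * k x y \<partial>?S) \<partial>?S) \<le> ennreal C1"
    if "f \<in> borel_measurable ?S" "g \<in> borel_measurable ?S" "(\<integral>\<^sup>+x. epow (f x) a \<partial>?S) \<le> 1" "(\<integral>\<^sup>+x. epow (g x) a \<partial>?S) \<le> 1" for f g
    unfolding k_def C1_def
  proof (rule hls_normalised[OF circ_sf cm _ cdet_commute c A(1) _ _ that(1,2) a_def that(3,4)])
    fix p and \<rho> :: real assume p: "p \<in> space ?S" and \<rho>: "\<rho> > 0"
    have "(\<integral>\<^sup>+q. ennreal (cdet p q powr (- c)) * indicator {..\<rho>} (cdet p q) \<partial>?S) \<le> ennreal (1 / (1 - c) * \<rho> powr (1 - c))"
      using p by (intro cdet_near c \<rho>) simp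
    also have "\<dots> \<le> ennreal (A * \<rho> powr (1 - c))"
      using A by (intro ennreal_leI mult_right_mono) auto
    finally show "(\<integral>\<^sup>+q. ennreal (cdet p q powr (- c)) * indicator {..\<rho>} (cdet p q) \<partial>?S) \<le> ennreal (A * \<rho> powr (1 - c))" .
    have "(\<integral>\<^sup>+q. ennreal (cdet p q powr (- 2)) * indicator {\<rho><..} (cdet p q) \<partial>?S) \<le> ennreal (2 / \<rho>)"
      using p by (intro cdet_far \<rho>) simp
    also have "\<dots> \<le> ennreal (A / \<rho>)"
      using A \<rho> by (intro ennreal_leI divide_right_mono) auto
    finally show "(\<integral>\<^sup>+q. ennreal (cdet p q powr (- 2)) * indicator {\<rho><..} (cdet p q) \<partial>?S) \<le> ennreal (A / \<rho>)" .
  qed auto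
  have hls: "(\<integral>\<^sup>+x. (\<integral>\<^sup>+y. f x * g y * (\<Prod>l\<in>UNIV. k (x l) (y l)) \<partial>?M) \<partial>?M) \<le>
      ennreal C1 ^ CARD('n) * epow (\<integral>\<^sup>+x. epow (f x) a \<partial>?M) (1 / a) * epow (\<integral>\<^sup>+x. epow (g x) a \<partial>?M) (1 / a)"
    if "f \<in> borel_measurable ?M" "g \<in> borel_measurable ?M" for f g
    by (rule bilinear_PiM[OF circ_sf km _ _ _ that])
       (use a C1 in \<open>auto intro!: bilinear_homogenise[OF circ_sf km] hls1\<close>)
  \<comment> \<open>The value of the bound \<open>hls\<close> when both integrals are at most
    2.\<close>
  define N where "N = C1 ^ CARD('n) * 2 powr (1 / a) * 2 powr (1 / a)"
  have N: "N > 0" using C1 by (simp add: N_def)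
  define C where "C = 3 ^ CARD('n) * (4 * t / (t - 2) * (2 * N) powr (t - 2) * N)"
  have C: "C > 0" using t N by (simp add: C_def)
  define J where "J = (\<lambda>p :: ('n \<Rightarrow> real \<times> real) \<times> ('n \<Rightarrow> real \<times> real). \<Prod>l\<in>UNIV. cdet (fst p l) (snd p l))"
  have fm: "(\<lambda>p. fst p l) \<in> borel_measurable ?P" "(\<lambda>p. snd p l) \<in> borel_measurable ?P" for l
    by (rule measurable_compose[OF measurable_fst circle_component_measurable])
       (rule measurable_compose[OF measurable_snd circle_component_measurable])
  have Jm[measurable]: "J \<in> borel_measurable ?P"
    unfolding J_def by (intro borel_measurable_prod borel_measurable_cdet fm)
  have J0: "J p \<ge> 0" for p by (simp add: J_def prod_nonneg)
  have J1: "J p \<le> 1" if "p \<in> space ?P" for p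
    using that unfolding J_def
    by (intro prod_le_1) (auto simp: space_pair_measure intro!: cdet_le_1 space_circle_PiM)
  have Jpos: "AE p in ?P. J p > 0"
  proof (rule P.AE_pair_measure)
    show "{p \<in> space ?P. J p > 0} \<in> sets ?P" by measurable
    show "AE u in ?M. AE v in ?M. J (u, v) > 0"
    proof (rule AE_I2)
      fix u assume u: "u \<in> space ?M"
      have "AE v in ?M. \<forall>l\<in>UNIV. cdet (u l) (v l) \<noteq> 0"
        using u by (intro AE_finite_allI AE_PiM_component AE_cdet_nonzero prob_space_circle_measure space_circle_PiM) auto
      then show "AE v in ?M. J (u, v) > 0"
      proof eventually_elim
        case (elim v)
        show ?case unfolding J_def
          by (rule prod_pos) (use elim in \<open>auto simp: less_le\<close>)
      qed
    qed
  qed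
  \<comment> \<open>The weight J offsets the degeneracy of addition: with it, the Gaussian averages
    of the image under \<Phi> are bounded (\<open>bound\<close>).\<close>
  define \<nu> where "\<nu> = density ?P (\<lambda>p. ennreal (J p))"
  define \<Phi> where "\<Phi> = (\<lambda>p :: ('n \<Rightarrow> real \<times> real) \<times> ('n \<Rightarrow> real \<times> real). vec_lambda (fst p) + vec_lambda (snd p) :: (real \<times> real) ^ 'n)"
  have \<Phi>P[measurable]: "\<Phi> \<in> borel_measurable ?P"
    unfolding \<Phi>_def
    by (intro borel_measurable_add measurable_compose[OF measurable_fst vec_lambda_measurable_borel]
        measurable_compose[OF measurable_snd vec_lambda_measurable_borel])
  have \<Phi>: "\<Phi> \<in> borel_measurable \<nu>"
    unfolding \<nu>_def by simp
  have fin: "finite_measure \<nu>"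
  proof (rule finite_measureI)
    have "emeasure \<nu> (space \<nu>) = (\<integral>\<^sup>+p. ennreal (J p) \<partial>?P)"
      unfolding \<nu>_def by (subst emeasure_density) (auto intro!: nn_integral_cong)
    also have "\<dots> \<le> (\<integral>\<^sup>+p. 1 \<partial>?P)"
      by (intro nn_integral_mono) (simp add: J1)
    also have "\<dots> = 1" by (simp add: PP.emeasure_space_1)
    finally show "emeasure \<nu> (space \<nu>) \<noteq> \<infinity>" by (auto simp: top_unique)
  qed
  have bound: "(\<integral>\<^sup>+p. ennreal (gauss e (y - \<Phi> p)) \<partial>\<nu>) \<le> ennreal (3 ^ CARD('n))" if e: "e > 0" for e y
  proof -
    have "(\<integral>\<^sup>+p. ennreal (gauss e (y - \<Phi> p)) \<partial>\<nu>) = (\<integral>\<^sup>+p. ennreal (J p) * ennreal (gauss e (y - \<Phi> p)) \<partial>?P)"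
      unfolding \<nu>_def by (subst nn_integral_density) auto
    also have "\<dots> = (\<integral>\<^sup>+u. \<integral>\<^sup>+v. ennreal (J (u, v)) * ennreal (gauss e (y - \<Phi> (u, v))) \<partial>?M \<partial>?M)"
      by (subst M.nn_integral_fst[symmetric]) auto
    also have "\<dots> \<le> 3 ^ CARD('n)"
      unfolding J_def \<Phi>_def fst_conv snd_conv by (rule torus_gauss_bound[OF e])
    finally show ?thesis by (simp flip: ennreal_power ennreal_numeral)
  qed
  show thesis
  proof (rule that[OF C])
    fix F :: "(real \<times> real) ^ 'n \<Rightarrow> complex"
    assume F: "F \<in> borel_measurable torus_measure"
      and F2: "(\<integral>\<^sup>+\<xi>. ennreal (norm (F \<xi>) powr (r / (r - 3))) \<partial>torus_measure) \<le> 2"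
    define f where "f = (\<lambda>u. F (vec_lambda u))"
    have [measurable]: "f \<in> borel_measurable ?M"
      unfolding f_def by (rule circle_PiM_vec_measurable[OF F])
    have f2: "(\<integral>\<^sup>+u. ennreal (norm (f u) powr (r / (r - 3))) \<partial>?M) \<le> 2"
      using F2 F by (subst (asm) nn_integral_torus) (auto simp: f_def)
    have fi: "integrable ?M f"
    proof (rule integrable_of_powr)
      show "(\<integral>\<^sup>+u. ennreal (norm (f u) powr (r / (r - 3))) \<partial>?M) < \<infinity>"
        using f2 by (rule le_less_trans) simp
    qed (use r in \<open>auto simp: M.finite_measure_axioms\<close>)
    \<comment> \<open>Chosen so that G d\<nu> is the product measure with density f(u) f(v). Where J
      = 0 the quotient is 0 by convention, and \<open>Jpos\<close> makes this a null set.\<close>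
    define G where "G = (\<lambda>p. f (fst p) * f (snd p) / complex_of_real (J p))"
    have Gm[measurable]: "G \<in> borel_measurable ?P" unfolding G_def by measurable
    have JG: "J p *\<^sub>R G p = f (fst p) * f (snd p)" if "J p > 0" for p
      using that by (simp add: G_def scaleR_conv_of_real)
    have "integrable ?P (\<lambda>p. f (fst p) * f (snd p))"
      using P.integral_product_mult(1)[OF fi fi] by (simp add: case_prod_unfold)
    then have "integrable ?P (\<lambda>p. J p *\<^sub>R G p)"
      by (rule integrable_cong_AE_imp) (use Jpos in \<open>auto simp: JG\<close>)
    then have G: "integrable \<nu> G"
      unfolding \<nu>_def by (subst integrable_density) (auto simp: J0)
    have sq: "osc \<nu> \<Phi> G x = (inv_fourier torus_measure F x)\<^sup>2" for x
    proof -
      let ?e = "\<lambda>u. cis (2 * pi * (x \<bullet> vec_lambda u)) * f u"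
      have ei: "integrable ?M ?e" by (intro integrable_osc fi) simp
      have "osc \<nu> \<Phi> G x = (LINT p|?P. J p *\<^sub>R (cis (2 * pi * (x \<bullet> \<Phi> p)) * G p))"
        unfolding osc_def \<nu>_def by (rule integral_density) (auto simp: J0)
      also have "\<dots> = (LINT p|?P. ?e (fst p) * ?e (snd p))"
      proof (rule integral_cong_AE)
        show "AE p in ?P. J p *\<^sub>R (cis (2 * pi * (x \<bullet> \<Phi> p)) * G p) = ?e (fst p) * ?e (snd p)"
          using Jpos
        proof eventually_elim
          case (elim p)
          have "J p *\<^sub>R (cis (2 * pi * (x \<bullet> \<Phi> p)) * G p) = cis (2 * pi * (x \<bullet> \<Phi> p)) * (J p *\<^sub>R G p)"
            by simp
          also have "\<dots> = ?e (fst p) * ?e (snd p)"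
            unfolding JG[OF elim] \<Phi>_def inner_add_right distrib_left cis_mult[symmetric] by (simp only: mult_ac)
          finally show ?case .
        qed
        have "(\<lambda>p. ?e (fst p)) \<in> borel_measurable ?P" "(\<lambda>p. ?e (snd p)) \<in> borel_measurable ?P"
          using borel_measurable_integrable[OF ei] by (auto intro: measurable_compose[OF measurable_fst] measurable_compose[OF measurable_snd])
        then show "(\<lambda>p. ?e (fst p) * ?e (snd p)) \<in> borel_measurable ?P"
          by (rule borel_measurable_times)
      qed measurable
      also have "\<dots> = (LINT u|?M. ?e u) * (LINT v|?M. ?e v)"
        using P.integral_product_mult(2)[OF ei ei] by (simp add: case_prod_unfold)
      also have "\<dots> = (inv_fourier torus_measure F x)\<^sup>2"
        unfolding inv_fourier_torus_osc[OF F] by (simp add: osc_def f_def power2_eq_square)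
      finally show ?thesis .
    qed
    have GN: "(\<integral>\<^sup>+p. ennreal (norm (G p) powr (t / (t - 1))) \<partial>\<nu>) \<le> ennreal N"
    proof -
      let ?f = "\<lambda>u. ennreal (norm (f u) powr (1 + c))"
      have "(\<integral>\<^sup>+p. ennreal (norm (G p) powr (t / (t - 1))) \<partial>\<nu>) = (\<integral>\<^sup>+p. ennreal (J p) * ennreal (norm (G p) powr (1 + c)) \<partial>?P)"
        unfolding \<nu>_def t(2) by (subst nn_integral_density) auto
      \<comment> \<open>Of the 1 + c powers of 1 / J the density cancels one. What remains, J^(-c),
        is a product over the coordinates.\<close>
      also have "\<dots> = (\<integral>\<^sup>+p. ?f (fst p) * ?f (snd p) * ennreal (J p powr (- c)) \<partial>?P)"
        using Jpos
      proof (intro nn_integral_cong_AE, eventually_elim)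
        case (elim p)
        have "J p * norm (G p) powr (1 + c) = J p * ((norm (f (fst p)) powr (1 + c) * norm (f (snd p)) powr (1 + c)) / J p powr (1 + c))"
          using elim by (simp add: G_def norm_mult norm_divide powr_mult powr_divide)
        also have "\<dots> = norm (f (fst p)) powr (1 + c) * norm (f (snd p)) powr (1 + c) * J p powr (- c)"
          using elim by (simp add: powr_add powr_minus field_simps)
        finally show ?case
          using J0 by (simp flip: ennreal_mult)
      qed
      also have "\<dots> = (\<integral>\<^sup>+u. \<integral>\<^sup>+v. ?f u * ?f v * ennreal (J (u, v) powr (- c)) \<partial>?M \<partial>?M)"
        by (subst M.nn_integral_fst[symmetric]) auto
      also have "\<dots> = (\<integral>\<^sup>+u. \<integral>\<^sup>+v. ?f u * ?f v * (\<Prod>l\<in>UNIV. k (u l) (v l)) \<partial>?M \<partial>?M)"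
        by (simp add: k_def J_def prod_powr_distrib prod_ennreal)
      also have "\<dots> \<le> ennreal C1 ^ CARD('n) * epow (\<integral>\<^sup>+x. epow (?f x) a \<partial>?M) (1 / a) * epow (\<integral>\<^sup>+x. epow (?f x) a \<partial>?M) (1 / a)"
        by (rule hls) measurable
      also have "(\<integral>\<^sup>+x. epow (?f x) a \<partial>?M) = (\<integral>\<^sup>+u. ennreal (norm (f u) powr (r / (r - 3))) \<partial>?M)"
        by (simp add: epow_ennreal powr_powr a(2))
      also have "ennreal C1 ^ CARD('n) * epow \<dots> (1 / a) * epow \<dots> (1 / a) \<le> ennreal C1 ^ CARD('n) * epow 2 (1 / a) * epow 2 (1 / a)"
        using a(1) f2 by (intro mult_mono epow_mono) auto
      also have "epow 2 (1 / a) = ennreal (2 powr (1 / a))"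
        using epow_ennreal[of 2] by simp
      also have "ennreal C1 ^ CARD('n) * ennreal (2 powr (1 / a)) * ennreal (2 powr (1 / a)) = ennreal N"
        using C1 by (simp add: N_def ennreal_mult ennreal_power)
      finally show ?thesis .
    qed
    have "(\<integral>\<^sup>+x. ennreal (norm (inv_fourier torus_measure F x) powr r) \<partial>lborel) =
        (\<integral>\<^sup>+x. ennreal (norm (osc \<nu> \<Phi> G x) powr t) \<partial>lborel)"
      by (simp add: sq t_def norm_power powr_powr flip: powr_numeral)
    also have "\<dots> \<le> ennreal (3 ^ CARD('n)) * ennreal (4 * t / (t - 2) * (2 * N) powr (t - 2) * N)"
      by (rule osc_Hausdorff_Young[OF fin \<Phi> G bound t(1) N GN])
    also have "\<dots> = ennreal C"
      using t N unfolding C_def by (intro ennreal_mult[symmetric]) auto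
    finally show "(\<integral>\<^sup>+x. ennreal (norm (inv_fourier torus_measure F x) powr r) \<partial>lborel) \<le> ennreal C" .
  qed
qed

section \<open>Failure for small exponents\<close>

text \<open>On one side of every p there is an arc of length e, of mass e / (2 \<pi>), whose points
  have chord distance at most e from p; on it the planar Gaussian is at least exp (- \<pi>) / e^2.
  The average grows like 1 / e because the circle has dimension one in a plane.\<close>

lemma circle_gauss_lower_bound:
  assumes e: "0 < e" "e \<le> 1"
  shows "ennreal (exp (- pi) / (2 * pi) / e) \<le> (\<integral>\<^sup>+p. \<integral>\<^sup>+q. ennreal (gauss e (p - q)) \<partial>circle_measure \<partial>circle_measure)"
proof -
  interpret prob_space circle_measure by (rule prob_space_circle_measure)
  have *: "ennreal (exp (- pi) / (2 * pi) / e) \<le> (\<integral>\<^sup>+q. ennreal (gauss e (p - q)) \<partial>circle_measure)" if p: "p \<in> circle" for p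
  proof -
    obtain s where s: "p = cpt s" using circle_cpt[OF p] by auto
    define h where "h = (\<lambda>t. ennreal (gauss e (cpt s - cpt t)))"
    have "ennreal (exp (- pi) / (2 * pi) / e) = ennreal (exp (- pi) / e\<^sup>2) * ennreal (e / (2 * pi))"
      using e by (simp add: power2_eq_square flip: ennreal_mult)
    also have "\<dots> = (\<integral>\<^sup>+t. ennreal (exp (- pi) / e\<^sup>2) * indicator {0..e / (2 * pi)} (t::real) \<partial>lborel)"
      using e by (subst nn_integral_cmult_indicator) auto
    also have "\<dots> \<le> (\<integral>\<^sup>+t. h (t + s) * indicator {0..<1} t \<partial>lborel)"
    proof (rule nn_integral_mono)
      fix t :: real
      show "ennreal (exp (- pi) / e\<^sup>2) * indicator {0..e / (2 * pi)} t \<le> h (t + s) * indicator {0..<1} t"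
      proof (cases "t \<in> {0..e / (2 * pi)}")
        case True
        then have t: "0 \<le> t" "2 * pi * t \<le> e" by (auto simp: field_simps)
        have "1 * t < 2 * pi * t \<or> t = 0" using pi_gt3 t by (intro disjCI mult_strict_right_mono) auto
        then have t1: "t < 1" using t e by auto
        have "(norm (cpt s - cpt (t + s)))\<^sup>2 = 2 - 2 * cos (2 * pi * t)"
        proof -
          have "(norm (cpt s - cpt (t + s)))\<^sup>2 = (cos (2 * pi * s))\<^sup>2 + (sin (2 * pi * s))\<^sup>2 + ((cos (2 * pi * (t + s)))\<^sup>2 + (sin (2 * pi * (t + s)))\<^sup>2)
            - 2 * cos (2 * pi * (t + s) - 2 * pi * s)"
          proof -
            have n2: "(norm (z :: real \<times> real))\<^sup>2 = (fst z)\<^sup>2 + (snd z)\<^sup>2" for z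
              by (simp add: norm_prod_def)
            have ring: "(a - c)\<^sup>2 + (b - d)\<^sup>2 = a\<^sup>2 + b\<^sup>2 + (c\<^sup>2 + d\<^sup>2) - 2 * (c * a + d * b)" for a b c d :: real
              by algebra
            show ?thesis
              unfolding n2 cos_diff cpt_def diff_Pair fst_conv snd_conv by (rule ring)
          qed
          then show ?thesis by (simp add: algebra_simps)
        qed
        also have "\<dots> = 4 * (sin (pi * t))\<^sup>2"
          using cos_double_sin[of "pi * t"] by (simp add: mult_ac)
        also have "\<dots> \<le> 4 * (pi * t)\<^sup>2"
          using abs_sin_x_le_abs_x[of "pi * t"] sin_x_le_x[of "pi * t"] t
          by (intro mult_left_mono) (auto simp: abs_le_square_iff[symmetric])
        also have "\<dots> = (2 * pi * t)\<^sup>2" by (simp add: power_mult_distrib)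
        also have "\<dots> \<le> e\<^sup>2" using t by (intro power_mono) auto
        finally have "pi * (norm (cpt s - cpt (t + s)))\<^sup>2 / e\<^sup>2 \<le> pi"
          using e by (simp add: divide_le_eq)
        then have "exp (- pi) / e\<^sup>2 \<le> gauss e (cpt s - cpt (t + s))"
          by (simp add: gauss_def divide_right_mono power2_eq_square)
        then show ?thesis using True t t1 by (simp add: h_def ennreal_leI)
      qed auto
    qed
    also have "\<dots> = (\<integral>\<^sup>+t. h t * indicator {0..<1} t \<partial>lborel)"
      by (rule nn_integral_periodic_shift) (auto simp: h_def)
    also have "\<dots> = (\<integral>\<^sup>+q. ennreal (gauss e (p - q)) \<partial>circle_measure)"
      unfolding h_def s by (rule nn_integral_circle_measure[symmetric]) measurable
    finally show ?thesis .
  qed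
  have "ennreal (exp (- pi) / (2 * pi) / e) = (\<integral>\<^sup>+p. ennreal (exp (- pi) / (2 * pi) / e) \<partial>circle_measure)"
    by (simp add: emeasure_space_1[simplified])
  also have "\<dots> \<le> (\<integral>\<^sup>+p. \<integral>\<^sup>+q. ennreal (gauss e (p - q)) \<partial>circle_measure \<partial>circle_measure)"
    by (intro nn_integral_mono *) simp
  finally show ?thesis .
qed

lemma prod_ge_power_ennreal:
  fixes f :: "'i \<Rightarrow> ennreal"
  assumes "finite A" and "\<And>i. i \<in> A \<Longrightarrow> c \<le> f i"
  shows "c ^ card A \<le> prod f A"
  using assms by (induction A) (auto intro!: mult_mono)

lemma torus_gauss_lower_bound:
  assumes e: "0 < e" "e \<le> 1"
  shows "ennreal (exp (- pi) / (2 * pi) / e) ^ CARD('n) \<le>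
    (\<integral>\<^sup>+u. \<integral>\<^sup>+v. ennreal (gauss e (vec_lambda u - vec_lambda v :: (real \<times> real) ^ 'n::finite)) \<partial>circle_PiM \<partial>circle_PiM)"
proof -
  interpret product_sigma_finite "\<lambda>_::'n. circle_measure" by (rule product_sigma_finite_circle)
  interpret circ: sigma_finite_measure circle_measure
    by (rule prob_space_imp_sigma_finite[OF prob_space_circle_measure])
  define h where "h = (\<lambda>p q. ennreal (gauss e (p - q :: real \<times> real)))"
  have hm[measurable]: "case_prod h \<in> borel_measurable (circle_measure \<Otimes>\<^sub>M circle_measure)"
    by (rule measurable_compose[OF measurable_circle_pair_borel]) (simp add: h_def)
  have hm2: "h p \<in> borel_measurable circle_measure" for p
    unfolding h_def by (intro borel_measurable_circle_measureI) measurable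
  have "ennreal (exp (- pi) / (2 * pi) / e) ^ CARD('n) \<le> (\<Prod>l\<in>(UNIV::'n set). \<integral>\<^sup>+p. \<integral>\<^sup>+q. h p q \<partial>circle_measure \<partial>circle_measure)"
    unfolding h_def by (intro prod_ge_power_ennreal circle_gauss_lower_bound e) simp
  also have "\<dots> = (\<integral>\<^sup>+u. (\<Prod>l\<in>(UNIV::'n set). \<integral>\<^sup>+q. h (u l) q \<partial>circle_measure) \<partial>circle_PiM)"
    by (intro product_nn_integral_prod[symmetric]) auto
  also have "\<dots> = (\<integral>\<^sup>+u. \<integral>\<^sup>+v. (\<Prod>l\<in>(UNIV::'n set). h (u l) (v l)) \<partial>circle_PiM \<partial>circle_PiM)"
    by (intro nn_integral_cong product_nn_integral_prod[symmetric]) (auto intro!: hm2)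
  finally show ?thesis
    using e by (simp add: gauss_vec h_def prod_ennreal)
qed

text \<open>If the fourth power were integrable, dominated convergence would make the damped \<open>L\<^sup>2\<close> norm
  of smaller order than its true size \<open>e\<^sup>-\<^sup>n\<close>.\<close>

lemma inv_fourier_torus_one_not_L4:
  "(\<integral>\<^sup>+x. ennreal (norm (inv_fourier (torus_measure :: ((real \<times> real) ^ 'n::finite) measure) (\<lambda>_. 1) x) ^ 4) \<partial>lborel) = \<infinity>"
proof (rule ccontr)
  let ?n = "CARD('n)"
  let ?M = "circle_PiM :: ('n \<Rightarrow> real \<times> real) measure"
  interpret M: prob_space ?M by (intro prob_space_PiM prob_space_circle_measure)
  interpret P: pair_sigma_finite ?M ?M ..
  define H where "H = osc ?M vec_lambda (\<lambda>_. 1)"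
  have HF: "inv_fourier torus_measure (\<lambda>_. 1) = H"
    by (simp add: H_def inv_fourier_torus_osc fun_eq_iff)
  have [measurable]: "H \<in> borel_measurable borel"
    unfolding H_def by (intro borel_measurable_osc M.sigma_finite_measure_axioms) auto
  assume "(\<integral>\<^sup>+x. ennreal (norm (inv_fourier (torus_measure :: ((real \<times> real) ^ 'n) measure) (\<lambda>_. 1) x) ^ 4) \<partial>lborel) \<noteq> \<infinity>"
  then have I4: "integrable lborel (\<lambda>x. norm (H x) ^ 4)"
    unfolding HF by (intro integrableI_nonneg) (auto simp: less_top)
  define w where "w = (\<lambda>e x::(real \<times> real) ^ 'n. exp (- (pi * e\<^sup>2 * (norm x)\<^sup>2)))"
  have [measurable]: "w e \<in> borel_measurable borel" for e unfolding w_def by measurable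
  define \<kappa> where "\<kappa> = (exp (- pi) / (2 * pi)) ^ ?n"
  have \<kappa>: "\<kappa> > 0" by (simp add: \<kappa>_def)
  have Hw: "integrable lborel (\<lambda>x. (norm (H x))\<^sup>2 * w e x)" "\<kappa> \<le> e ^ ?n * (LINT x|lborel. (norm (H x))\<^sup>2 * w e x)"
    if e: "0 < e" "e \<le> 1" for e
  proof -
    note dp = damped_plancherel[OF M.finite_measure_axioms vec_lambda_measurable_borel, of "\<lambda>_. 1", OF _ e(1), folded H_def, simplified]
    show i: "integrable lborel (\<lambda>x. (norm (H x))\<^sup>2 * w e x)"
      using dp(1) by (simp add: w_def)
    define g where "g = (\<lambda>p. gauss e (vec_lambda (fst p) - vec_lambda (snd p) :: (real \<times> real) ^ 'n))"
    have gi: "integrable (?M \<Otimes>\<^sub>M ?M) (\<lambda>p. complex_of_real (g p))"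
      using dp(2) by (simp add: g_def case_prod_unfold)
    then have gi': "integrable (?M \<Otimes>\<^sub>M ?M) g"
      using integrable_Re[OF gi] by simp
    have "complex_of_real (LINT x|lborel. (norm (H x))\<^sup>2 * w e x) = complex_of_real (LINT p|(?M \<Otimes>\<^sub>M ?M). g p)"
      using dp(3) unfolding w_def g_def integral_complex_of_real[symmetric] by (simp add: case_prod_unfold)
    then have L: "(LINT x|lborel. (norm (H x))\<^sup>2 * w e x) = (LINT p|(?M \<Otimes>\<^sub>M ?M). g p)"
      by (simp only: of_real_eq_iff)
    have "ennreal (\<kappa> / e ^ ?n) = ennreal (exp (- pi) / (2 * pi) / e) ^ ?n"
      using e by (simp add: \<kappa>_def ennreal_power power_divide power_mult_distrib)
    also have "\<dots> \<le> (\<integral>\<^sup>+u. \<integral>\<^sup>+v. ennreal (g (u, v)) \<partial>?M \<partial>?M)"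
      unfolding g_def fst_conv snd_conv by (rule torus_gauss_lower_bound[OF e])
    also have "\<dots> = (\<integral>\<^sup>+p. ennreal (g p) \<partial>(?M \<Otimes>\<^sub>M ?M))"
      using borel_measurable_integrable[OF gi'] by (subst M.nn_integral_fst[symmetric]) auto
    also have "\<dots> = ennreal (LINT p|(?M \<Otimes>\<^sub>M ?M). g p)"
      using gi' e by (intro nn_integral_eq_integral) (auto simp: g_def)
    finally have "\<kappa> / e ^ ?n \<le> (LINT p|(?M \<Otimes>\<^sub>M ?M). g p)"
      using e by (subst (asm) ennreal_le_iff) (auto simp: g_def)
    then show "\<kappa> \<le> e ^ ?n * (LINT x|lborel. (norm (H x))\<^sup>2 * w e x)"
      using e unfolding L by (simp add: field_simps)
  qed
  define \<mu> where "\<mu> = \<kappa> / 2"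
  have \<mu>: "\<mu> > 0" using \<kappa> by (simp add: \<mu>_def)
  \<comment> \<open>Cauchy--Schwarz in the form X Y \<le> X^2 / (4 \<mu>) + \<mu> Y^2, with X =
    |H|^2 and Y = e^n w. The integral of Y^2 is 2^(-n) for every e, so after subtracting \<mu> Y^2
    at least \<kappa> - \<mu> = \<kappa> / 2 of the integral survives, although the remainder is
    dominated by |H|^4 / (4 \<mu>) and tends to 0 pointwise. The maximum with 0 makes the domination
    hold in absolute value.\<close>
  define p where "p = (\<lambda>e x. max 0 (e ^ ?n * ((norm (H x))\<^sup>2 * w e x) - \<mu> * (e ^ ?n * w e x)\<^sup>2))"
  have pm: "p e \<in> borel_measurable borel" for e unfolding p_def by measurable
  have ple: "norm (p e x) \<le> 1 / (4 * \<mu>) * norm (H x) ^ 4" for e x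
  proof -
    have "0 \<le> ((norm (H x))\<^sup>2 - 2 * \<mu> * (e ^ ?n * w e x))\<^sup>2" by simp
    also have "\<dots> = norm (H x) ^ 4 - 4 * \<mu> * (e ^ ?n * ((norm (H x))\<^sup>2 * w e x) - \<mu> * (e ^ ?n * w e x)\<^sup>2)"
      by (simp add: power2_eq_square power4_eq_xxxx algebra_simps)
    finally have "4 * \<mu> * (e ^ ?n * ((norm (H x))\<^sup>2 * w e x) - \<mu> * (e ^ ?n * w e x)\<^sup>2) \<le> norm (H x) ^ 4"
      by linarith
    then show ?thesis
      using \<mu> by (simp add: p_def field_simps)
  qed
  have pint: "\<kappa> / 2 \<le> (LINT x|lborel. p e x)" if e: "0 < e" "e \<le> 1" for e
  proof -
    have w2: "(w e x)\<^sup>2 = exp (- (pi * (sqrt 2 * e)\<^sup>2 * (norm x)\<^sup>2))" for x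
      by (simp add: w_def power2_eq_square algebra_simps flip: exp_add)
    have wi: "integrable lborel (\<lambda>x. (w e x)\<^sup>2)" and wv: "(LINT x|lborel. (w e x)\<^sup>2) = 1 / (sqrt 2 * e) ^ (2 * ?n)"
      using gaussian_integral[of "sqrt 2 * e", where 'a="(real \<times> real) ^ 'n"] e unfolding w2
      by (auto simp: mult_2 mult_2_right)
    have pi: "integrable lborel (p e)"
      by (rule Bochner_Integration.integrable_bound[OF integrable_mult_right[OF I4, of "1 / (4 * \<mu>)"]])
         (use pm ple \<mu> in \<open>auto simp: abs_mult\<close>)
    have "\<kappa> \<le> (LINT x|lborel. e ^ ?n * ((norm (H x))\<^sup>2 * w e x))"
      using Hw[OF e] by simp
    also have "\<dots> \<le> (LINT x|lborel. p e x + \<mu> * e ^ (2 * ?n) * (w e x)\<^sup>2)"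
    proof (rule integral_mono)
      fix x
      have "\<mu> * (e ^ ?n * w e x)\<^sup>2 = \<mu> * e ^ (2 * ?n) * (w e x)\<^sup>2"
        by (simp only: power_mult_distrib power_mult[symmetric] mult.commute[of 2] mult.assoc)
      moreover have "e ^ ?n * ((norm (H x))\<^sup>2 * w e x) - \<mu> * (e ^ ?n * w e x)\<^sup>2 \<le> p e x"
        unfolding p_def by (rule max.cobounded2)
      ultimately show "e ^ ?n * ((norm (H x))\<^sup>2 * w e x) \<le> p e x + \<mu> * e ^ (2 * ?n) * (w e x)\<^sup>2"
        by linarith
    qed (use Hw(1)[OF e] pi wi in auto)
    also have "\<dots> = (LINT x|lborel. p e x) + \<mu> * e ^ (2 * ?n) * (1 / (sqrt 2 * e) ^ (2 * ?n))"
      using pi wi by (simp add: wv)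
    also have "\<mu> * e ^ (2 * ?n) * (1 / (sqrt 2 * e) ^ (2 * ?n)) = \<mu> / 2 ^ ?n"
      using e by (simp add: power_mult_distrib power_mult)
    also have "\<dots> \<le> \<mu>"
      using \<mu> by (simp add: divide_le_eq)
    finally show ?thesis by (simp add: \<mu>_def)
  qed
  define u where "u = (\<lambda>k::nat. inverse (real (Suc k)))"
  have u: "u k > 0" "u k \<le> 1" for k by (auto simp: u_def inverse_le_1_iff)
  have u0: "u \<longlonglongrightarrow> 0" unfolding u_def by (rule LIMSEQ_inverse_real_of_nat)
  have "(\<lambda>k. LINT x|lborel. p (u k) x) \<longlonglongrightarrow> (LINT x|(lborel :: ((real \<times> real) ^ 'n) measure). 0)"
  proof (rule integral_dominated_convergence[where w="\<lambda>x. 1 / (4 * \<mu>) * norm (H x) ^ 4"])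
    show "AE x in lborel. (\<lambda>k. p (u k) x) \<longlonglongrightarrow> 0"
    proof (rule AE_I2)
      fix x
      have "(\<lambda>k. p (u k) x) \<longlonglongrightarrow> max 0 (0 ^ ?n * ((norm (H x))\<^sup>2 * w 0 x) - \<mu> * (0 ^ ?n * w 0 x)\<^sup>2)"
        unfolding p_def w_def by (intro tendsto_intros u0)
      moreover have "(0::real) ^ ?n = 0" by simp
      ultimately show "(\<lambda>k. p (u k) x) \<longlonglongrightarrow> 0" by (simp only:) simp
    qed
  qed (use pm ple I4 in auto)
  then have "(\<lambda>k. LINT x|lborel. p (u k) x) \<longlonglongrightarrow> 0" by simp
  then have "\<kappa> / 2 \<le> 0"
    by (rule LIMSEQ_le_const) (use pint u in auto)
  then show False using \<kappa> by simp
qed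

section \<open>Knapp's example\<close>

text \<open>A product of arcs around (1, 0). Depth \<delta>^2 in the first component means width of
  order \<delta> in the second, by the curvature of the circle.\<close>

definition torus_cap :: "real \<Rightarrow> ((real \<times> real) ^ 'n::finite) set" where
  "torus_cap \<delta> = {\<xi> \<in> torus. \<forall>l. 1 - \<delta>\<^sup>2 \<le> fst (\<xi> $ l)}"

lemma torus_cap_sets: "torus_cap \<delta> \<in> sets (torus_measure :: ((real \<times> real) ^ 'n::finite) measure)"
proof -
  have m: "(\<lambda>\<xi>::(real \<times> real) ^ 'n. fst (\<xi> $ l)) \<in> borel_measurable borel" for l
    by (intro borel_measurable_continuous_onI continuous_intros)
  have "{\<xi>::(real \<times> real) ^ 'n. \<forall>l. 1 - \<delta>\<^sup>2 \<le> fst (\<xi> $ l)} = (\<Inter>l\<in>UNIV. {\<xi>. 1 - \<delta>\<^sup>2 \<le> fst (\<xi> $ l)})"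
    by auto
  also have "\<dots> \<in> sets borel"
    using m by (intro sets.countable_INT'') auto
  finally have "torus \<inter> {\<xi>::(real \<times> real) ^ 'n. \<forall>l. 1 - \<delta>\<^sup>2 \<le> fst (\<xi> $ l)} \<in> sets (restrict_space borel torus)"
    by (auto simp: sets_restrict_space)
  moreover have "torus_cap \<delta> = torus \<inter> {\<xi>::(real \<times> real) ^ 'n. \<forall>l. 1 - \<delta>\<^sup>2 \<le> fst (\<xi> $ l)}"
    by (auto simp: torus_cap_def)
  ultimately show ?thesis by simp
qed

lemma circle_cap_lower_bound:
  assumes d: "0 < \<delta>" "\<delta> \<le> 1"
  shows "ennreal (\<delta> / 5) \<le> (\<integral>\<^sup>+p. indicator {1 - \<delta>\<^sup>2..} (fst p) \<partial>circle_measure)"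
proof -
  have "ennreal (\<delta> / 5) = (\<integral>\<^sup>+t. indicator {0..\<delta> / 5} (t::real) \<partial>lborel)"
    using d by simp
  also have "\<dots> \<le> (\<integral>\<^sup>+t. indicator {1 - \<delta>\<^sup>2..} (fst (cpt t)) * indicator {0..<1} t \<partial>lborel)"
  proof (rule nn_integral_mono)
    fix t :: real
    show "(indicator {0..\<delta> / 5} t :: ennreal) \<le> indicator {1 - \<delta>\<^sup>2..} (fst (cpt t)) * indicator {0..<1} t"
    proof (cases "t \<in> {0..\<delta> / 5}")
      case True
      have "(sin (pi * t))\<^sup>2 \<le> (pi * t)\<^sup>2"
        using abs_sin_x_le_abs_x[of "pi * t"] by (simp add: abs_le_square_iff)
      \<comment> \<open>With \<pi> \<le> 7 / 2, twice this square is 0.98 \<delta>^2. This is why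
        parameters up to \<delta> / 5 stay in the cap.\<close>
      also have "\<dots> \<le> (7 / 2 * (\<delta> / 5))\<^sup>2"
        using True pi_less_4 pi_approx by (intro power_mono mult_mono) auto
      finally have "2 * (sin (pi * t))\<^sup>2 \<le> \<delta>\<^sup>2"
        by (simp add: power_mult_distrib power_divide) (use zero_le_power2[of \<delta>] in linarith)
      then have "1 - \<delta>\<^sup>2 \<le> cos (2 * pi * t)"
        using cos_double_sin[of "pi * t"] by (simp add: mult.assoc)
      then show ?thesis using True d by (simp add: cpt_def)
    qed simp
  qed
  also have "\<dots> = (\<integral>\<^sup>+p. indicator {1 - \<delta>\<^sup>2..} (fst p) \<partial>circle_measure)"
    by (rule nn_integral_circle_measure[symmetric]) measurable
  finally show ?thesis .
qed

text \<open>The measure \<alpha> of one arc stays implicit: in Knapp's comparison the measure of the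
  cap enters with the exponent 1 - 1 / s \<ge> 0, for which a lower bound on \<alpha> is what
  counts.\<close>

lemma measure_torus_cap:
  assumes d: "0 < \<delta>" "\<delta> \<le> 1"
  obtains \<alpha> where "\<alpha> \<ge> \<delta> / 5"
    "emeasure (torus_measure :: ((real \<times> real) ^ 'n::finite) measure) (torus_cap \<delta>) = ennreal (\<alpha> ^ CARD('n))"
proof -
  interpret product_sigma_finite "\<lambda>_::'n. circle_measure" by (rule product_sigma_finite_circle)
  interpret circ: prob_space circle_measure by (rule prob_space_circle_measure)
  let ?h = "\<lambda>p::real \<times> real. indicator {1 - \<delta>\<^sup>2..} (fst p) :: ennreal"
  have hm: "?h \<in> borel_measurable circle_measure"
    by (intro borel_measurable_circle_measureI) measurable
  have "(\<integral>\<^sup>+p. ?h p \<partial>circle_measure) \<le> (\<integral>\<^sup>+p. 1 \<partial>circle_measure)"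
    by (intro nn_integral_mono) (simp add: indicator_def)
  also have "\<dots> = 1" by (simp add: circ.emeasure_space_1[simplified])
  finally obtain \<alpha> where \<alpha>: "\<alpha> \<ge> 0" "(\<integral>\<^sup>+p. ?h p \<partial>circle_measure) = ennreal \<alpha>"
    by (cases "\<integral>\<^sup>+p. ?h p \<partial>circle_measure") (auto simp: top_unique)
  have "\<delta> / 5 \<le> \<alpha>"
    using circle_cap_lower_bound[OF d] \<alpha> by (simp add: ennreal_le_iff)
  moreover have "emeasure (torus_measure :: ((real \<times> real) ^ 'n) measure) (torus_cap \<delta>) = ennreal (\<alpha> ^ CARD('n))"
  proof -
    have "emeasure (torus_measure :: ((real \<times> real) ^ 'n) measure) (torus_cap \<delta>) = (\<integral>\<^sup>+\<xi>. indicator (torus_cap \<delta>) \<xi> \<partial>(torus_measure :: ((real \<times> real) ^ 'n) measure))"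
      by (rule nn_integral_indicator[symmetric]) (rule torus_cap_sets)
    also have "\<dots> = (\<integral>\<^sup>+u. indicator (torus_cap \<delta>) (vec_lambda u :: (real \<times> real) ^ 'n) \<partial>circle_PiM)"
      by (intro nn_integral_torus borel_measurable_indicator torus_cap_sets)
    also have "\<dots> = (\<integral>\<^sup>+u. (\<Prod>l\<in>(UNIV::'n set). ?h (u l)) \<partial>circle_PiM)"
    proof (rule nn_integral_cong)
      fix u :: "'n \<Rightarrow> real \<times> real" assume "u \<in> space circle_PiM"
      then have "(vec_lambda u :: (real \<times> real) ^ 'n) \<in> torus"
        using space_circle_PiM[of u] by (force simp: torus_def circle_def split: prod.splits)
      then show "(indicator (torus_cap \<delta>) (vec_lambda u :: (real \<times> real) ^ 'n) :: ennreal) = (\<Prod>l\<in>UNIV. ?h (u l))"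
        by (auto simp: torus_cap_def indicator_def)
    qed
    also have "\<dots> = ennreal \<alpha> ^ CARD('n)"
      using hm \<alpha> by (subst product_nn_integral_prod) auto
    finally show ?thesis using \<alpha> by (simp add: ennreal_power)
  qed
  ultimately show ?thesis using that by blast
qed

text \<open>Used with side parameters proportional to 1 / \<delta>^2 and 1 / \<delta>, the
  reciprocals of the depth and the width of the cap, so that x \<bullet> \<xi> varies little over
  the cap.\<close>

definition dual_box :: "real \<Rightarrow> real \<Rightarrow> ((real \<times> real) ^ 'n::finite) set" where
  "dual_box a b = {x. \<forall>l. \<bar>fst (x $ l)\<bar> \<le> a \<and> \<bar>snd (x $ l)\<bar> \<le> b}"

lemma dual_box_eq_cbox: "dual_box a b = cbox (\<chi> l. (- a, - b)) (\<chi> l. (a, b))"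
proof -
  have "\<bar>y\<bar> \<le> c \<longleftrightarrow> - c \<le> y \<and> y \<le> c" for y c :: real
    by linarith
  then show ?thesis
    by (auto simp: set_eq_iff dual_box_def mem_box Basis_vec_def Basis_prod_def inner_axis inner_prod_def)
qed

lemma emeasure_dual_box:
  assumes "a \<ge> 0" "b \<ge> 0"
  shows "emeasure lborel (dual_box a b :: ((real \<times> real) ^ 'n::finite) set) = ennreal ((4 * a * b) ^ CARD('n))"
proof -
  let ?l = "(\<chi> l. (- a, - b)) :: (real \<times> real) ^ 'n" and ?u = "(\<chi> l. (a, b)) :: (real \<times> real) ^ 'n"
  have le: "?l \<bullet> c \<le> ?u \<bullet> c" if "c \<in> Basis" for c
    using that assms by (auto simp: Basis_vec_def Basis_prod_def inner_axis)
  have "(\<Prod>c\<in>Basis. (?u - ?l) \<bullet> c) = (\<Prod>i\<in>UNIV. \<Prod>c\<in>(\<Union>v\<in>Basis. {axis i v}). (?u - ?l) \<bullet> c)"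
    unfolding Basis_vec_def by (rule prod.UNION_disjoint) (auto simp: axis_eq_axis)
  also have "\<dots> = (\<Prod>i\<in>(UNIV::'n set). \<Prod>v\<in>(Basis :: (real \<times> real) set). (2 * a, 2 * b) \<bullet> v)"
  proof (rule prod.cong[OF refl])
    fix i :: 'n
    have "(\<Prod>c\<in>(\<Union>v\<in>Basis. {axis i v}). (?u - ?l) \<bullet> c) = (\<Prod>v\<in>Basis. (?u - ?l) \<bullet> axis i v)"
      by (subst prod.UNION_disjoint) (auto simp: axis_eq_axis)
    then show "(\<Prod>c\<in>(\<Union>v\<in>Basis. {axis i v}). (?u - ?l) \<bullet> c) = (\<Prod>v\<in>Basis. (2 * a, 2 * b) \<bullet> v)"
      by (simp add: inner_axis)
  qed
  also have "(\<Prod>v\<in>(Basis :: (real \<times> real) set). (2 * a, 2 * b) \<bullet> v) = 4 * a * b"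
    by (simp add: Basis_prod_def prod.insert_if)
  finally show ?thesis
    unfolding dual_box_eq_cbox by (subst emeasure_lborel_cbox) (auto simp: le)
qed

text \<open>Relative to the centre z of the cap, each coordinate adds at most 3 b to the phase: b
  from the first component and 2 b from the second. With b = 1 / (24 n) the total is at most 1 / 8,
  an angle of at most \<pi> / 4, so the cosine stays above 1 / 2 and there is no cancellation.
  Recentring at z only multiplies the transform by a number of modulus 1.\<close>

lemma inv_fourier_cap_lower_bound:
  fixes x :: "(real \<times> real) ^ 'n::finite"
  assumes d: "0 < \<delta>" "\<delta> \<le> 1" and b: "b = 1 / (24 * real CARD('n))" and x: "x \<in> dual_box (b / \<delta>\<^sup>2) (b / \<delta>)"
  shows "measure torus_measure (torus_cap \<delta> :: ((real \<times> real) ^ 'n) set) / 2 \<le>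
    norm (inv_fourier torus_measure (indicator (torus_cap \<delta>)) x)"
proof -
  interpret T: prob_space "torus_measure :: ((real \<times> real) ^ 'n) measure" by (rule prob_space_torus_measure)
  let ?T = "torus_measure :: ((real \<times> real) ^ 'n) measure"
  let ?Q = "torus_cap \<delta> :: ((real \<times> real) ^ 'n) set"
  define z :: "(real \<times> real) ^ 'n" where "z = (\<chi> l. (1, 0))"
  have b0: "b > 0" by (simp add: b)
  note [measurable] = torus_cap_sets[of \<delta>, where 'n='n]
  have idm[measurable]: "(\<lambda>\<xi>. \<xi>) \<in> borel_measurable ?T"
    by (subst measurable_cong_sets[OF sets_torus_measure refl]) (simp add: measurable_restrict_space1)
  have cm: "(\<lambda>\<xi>. cis (2 * pi * (x \<bullet> (\<xi> - z)))) \<in> borel_measurable ?T"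
    by measurable
  have near: "\<bar>x \<bullet> (\<xi> - z)\<bar> \<le> 1 / 8" if \<xi>: "\<xi> \<in> ?Q" for \<xi>
  proof -
    have "\<bar>x \<bullet> (\<xi> - z)\<bar> \<le> (\<Sum>l\<in>UNIV. \<bar>(x $ l) \<bullet> ((\<xi> - z) $ l)\<bar>)"
      unfolding inner_vec_def by (rule sum_abs)
    also have "\<dots> \<le> (\<Sum>l\<in>(UNIV::'n set). 3 * b)"
    proof (rule sum_mono)
      fix l
      let ?p = "\<xi> $ l"
      have p: "(fst ?p)\<^sup>2 + (snd ?p)\<^sup>2 = 1" "1 - \<delta>\<^sup>2 \<le> fst ?p"
        using \<xi> by (auto simp: torus_cap_def torus_def)
      have "(fst ?p)\<^sup>2 \<le> 1" using p(1) zero_le_power2[of "snd ?p"] by linarith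
      then have f1: "fst ?p \<le> 1" by (simp add: abs_square_le_1)
      then have f: "\<bar>fst ?p - 1\<bar> \<le> \<delta>\<^sup>2" using p(2) by linarith
      have "(snd ?p)\<^sup>2 = (1 - fst ?p) * (1 + fst ?p)"
        using p(1) by (simp add: algebra_simps power2_eq_square)
      also have "\<dots> \<le> \<delta>\<^sup>2 * 2"
        using f1 p(2) d power_le_one[of \<delta> 2] by (intro mult_mono) auto
      also have "\<dots> \<le> (2 * \<delta>)\<^sup>2" by (simp add: power_mult_distrib)
      finally have s: "\<bar>snd ?p\<bar> \<le> 2 * \<delta>"
        using d abs_le_square_iff[of "snd ?p" "2 * \<delta>"] by simp
      have "\<bar>(x $ l) \<bullet> ((\<xi> - z) $ l)\<bar> \<le> \<bar>fst (x $ l)\<bar> * \<bar>fst ?p - 1\<bar> + \<bar>snd (x $ l)\<bar> * \<bar>snd ?p\<bar>"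
        unfolding z_def by (simp add: inner_prod_def flip: abs_mult)
      also have "\<dots> \<le> (b / \<delta>\<^sup>2) * \<delta>\<^sup>2 + (b / \<delta>) * (2 * \<delta>)"
        using x f s d b0 by (intro add_mono mult_mono) (auto simp: dual_box_def)
      also have "\<dots> = 3 * b" using d by simp
      finally show "\<bar>(x $ l) \<bullet> ((\<xi> - z) $ l)\<bar> \<le> 3 * b" .
    qed
    also have "\<dots> = 1 / 8" by (simp add: b)
    finally show ?thesis .
  qed
  have cos: "1 / 2 \<le> cos (2 * pi * (x \<bullet> (\<xi> - z)))" if "\<xi> \<in> ?Q" for \<xi>
  proof -
    have "\<bar>2 * pi * (x \<bullet> (\<xi> - z))\<bar> \<le> pi / 3"
      using near[OF that] by (simp add: abs_mult field_simps)
    then have "cos (pi / 3) \<le> cos \<bar>2 * pi * (x \<bullet> (\<xi> - z))\<bar>"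
      using pi_gt_zero by (intro cos_monotone_0_pi_le) auto
    then show ?thesis by (simp add: cos_60)
  qed
  have qi: "integrable ?T (indicator ?Q :: _ \<Rightarrow> complex)" and qr: "integrable ?T (indicator ?Q :: _ \<Rightarrow> real)"
    by (rule T.integrable_const_bound[where B=1]; simp add: indicator_def borel_measurable_indicator torus_cap_sets)+
  have ci: "integrable ?T (\<lambda>\<xi>. cis (2 * pi * (x \<bullet> (\<xi> - z))) * indicator ?Q \<xi>)"
    by (rule Bochner_Integration.integrable_bound[OF qi]) (use cm in \<open>auto simp: norm_mult\<close>)
  have "measure ?T ?Q / 2 = (LINT \<xi>|?T. 1 / 2 * indicator ?Q \<xi>)"
  proof -
    have "?Q \<inter> torus = ?Q" by (auto simp: torus_cap_def)
    then show ?thesis by simp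
  qed
  also have "\<dots> \<le> (LINT \<xi>|?T. Re (cis (2 * pi * (x \<bullet> (\<xi> - z))) * indicator ?Q \<xi>))"
  proof (rule integral_mono)
    show "integrable ?T (\<lambda>\<xi>. 1 / 2 * indicator ?Q \<xi> :: real)" using qr by (rule integrable_mult_right)
    show "integrable ?T (\<lambda>\<xi>. Re (cis (2 * pi * (x \<bullet> (\<xi> - z))) * indicator ?Q \<xi>))" using ci by (rule integrable_Re)
    show "1 / 2 * indicator ?Q \<xi> \<le> Re (cis (2 * pi * (x \<bullet> (\<xi> - z))) * indicator ?Q \<xi>)" for \<xi>
      using cos[of \<xi>] by (cases "\<xi> \<in> ?Q") auto
  qed
  also have "\<dots> = Re (LINT \<xi>|?T. cis (2 * pi * (x \<bullet> (\<xi> - z))) * indicator ?Q \<xi>)"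
    using ci by (rule integral_Re)
  also have "\<dots> \<le> norm (LINT \<xi>|?T. cis (2 * pi * (x \<bullet> (\<xi> - z))) * indicator ?Q \<xi>)"
    by (rule complex_Re_le_cmod)
  also have "(LINT \<xi>|?T. cis (2 * pi * (x \<bullet> (\<xi> - z))) * indicator ?Q \<xi>) =
      (LINT \<xi>|?T. cis (- (2 * pi * (x \<bullet> z))) * (exp (2 * complex_of_real pi * \<i> * complex_of_real (x \<bullet> \<xi>)) * indicator ?Q \<xi>))"
  proof (rule Bochner_Integration.integral_cong[OF refl])
    fix \<xi>
    have "cis (2 * pi * (x \<bullet> (\<xi> - z))) = cis (- (2 * pi * (x \<bullet> z))) * cis (2 * pi * (x \<bullet> \<xi>))"
      by (simp add: cis_mult inner_diff_right algebra_simps)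
    moreover have "cis (2 * pi * (x \<bullet> \<xi>)) = exp (2 * complex_of_real pi * \<i> * complex_of_real (x \<bullet> \<xi>))"
      by (simp add: cis_conv_exp mult_ac)
    ultimately show "cis (2 * pi * (x \<bullet> (\<xi> - z))) * indicator ?Q \<xi> =
        cis (- (2 * pi * (x \<bullet> z))) * (exp (2 * complex_of_real pi * \<i> * complex_of_real (x \<bullet> \<xi>)) * indicator ?Q \<xi>)"
      by simp
  qed
  also have "\<dots> = cis (- (2 * pi * (x \<bullet> z))) * inv_fourier ?T (indicator ?Q) x"
    unfolding inv_fourier_def by (rule integral_mult_right_zero)
  also have "norm \<dots> = norm (inv_fourier ?T (indicator ?Q) x)"
    by (simp add: norm_mult)
  finally show ?thesis .
qed

section \<open>The equivalence\<close>

lemma Lp_norm_ereal: "Lp_norm (ereal r) M f = epow (\<integral>\<^sup>+x. ennreal (norm (f x) powr r) \<partial>M) (1 / r)"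
  by (simp add: Lp_norm_def epow_def Let_def)

lemma Lp_norm_infinity: "Lp_norm \<infinity> M f = esssup M (\<lambda>x. ennreal (norm (f x)))"
  by (simp add: Lp_norm_def)

lemma Lp_norm_scale_le:
  fixes f :: "'a \<Rightarrow> complex"
  assumes [measurable]: "f \<in> borel_measurable M" and c: "c > 0" and r: "r = \<infinity> \<or> (\<exists>s>0. r = ereal s)"
  shows "Lp_norm r M (\<lambda>x. complex_of_real c * f x) \<le> ennreal c * Lp_norm r M f"
  using r
proof (elim disjE exE conjE)
  assume r: "r = \<infinity>"
  have "AE x in M. ennreal (norm (f x)) \<le> esssup M (\<lambda>x. ennreal (norm (f x)))"
    by (rule esssup_AE)
  then have "AE x in M. ennreal (norm (complex_of_real c * f x)) \<le> ennreal c * esssup M (\<lambda>x. ennreal (norm (f x)))"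
    by eventually_elim (use c in \<open>simp add: norm_mult ennreal_mult mult_left_mono\<close>)
  then show ?thesis
    unfolding r Lp_norm_infinity by (intro esssup_I) auto
next
  fix s assume s: "s > 0" "r = ereal s"
  have "(\<integral>\<^sup>+x. ennreal (norm (complex_of_real c * f x) powr s) \<partial>M) =
      (\<integral>\<^sup>+x. ennreal (c powr s) * ennreal (norm (f x) powr s) \<partial>M)"
    using c by (simp add: norm_mult powr_mult ennreal_mult)
  also have "\<dots> = ennreal (c powr s) * (\<integral>\<^sup>+x. ennreal (norm (f x) powr s) \<partial>M)"
    by (rule nn_integral_cmult) measurable
  finally show ?thesis
    using s c by (simp add: Lp_norm_ereal epow_mult epow_ennreal powr_powr)
qed

text \<open>On a probability space higher norms control lower ones. Integrating z^\<sigma> \<le> 1 +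
  z^s for s \<ge> \<sigma> gives 1 + 1, the bound that \<open>torus_extension_normalised\<close>
  takes as input.\<close>

lemma nn_integral_powr_le_2:
  fixes f :: "'a \<Rightarrow> complex"
  assumes "prob_space M" and [measurable]: "f \<in> borel_measurable M" and \<sigma>: "\<sigma> \<ge> 1"
    and r: "r = \<infinity> \<or> (\<exists>s\<ge>\<sigma>. r = ereal s)" and le: "Lp_norm r M f \<le> 1"
  shows "(\<integral>\<^sup>+x. ennreal (norm (f x) powr \<sigma>) \<partial>M) \<le> 2"
  using r
proof (elim disjE exE conjE)
  interpret prob_space M by fact
  assume r: "r = \<infinity>"
  have "AE x in M. ennreal (norm (f x)) \<le> esssup M (\<lambda>x. ennreal (norm (f x)))"
    by (rule esssup_AE)
  then have "AE x in M. ennreal (norm (f x) powr \<sigma>) \<le> 1"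
  proof eventually_elim
    case (elim x)
    then have "ennreal (norm (f x)) \<le> 1"
      using le unfolding r Lp_norm_infinity by (rule order_trans)
    then have "norm (f x) powr \<sigma> \<le> 1 powr \<sigma>" using \<sigma> by (intro powr_mono2) auto
    then show ?case by simp
  qed
  then have "(\<integral>\<^sup>+x. ennreal (norm (f x) powr \<sigma>) \<partial>M) \<le> (\<integral>\<^sup>+x. 1 \<partial>M)"
    by (rule nn_integral_mono_AE)
  also have "\<dots> \<le> 2" by (simp add: emeasure_space_1)
  finally show ?thesis .
next
  interpret prob_space M by fact
  fix s assume s: "s \<ge> \<sigma>" "r = ereal s"
  have "epow (epow (\<integral>\<^sup>+x. ennreal (norm (f x) powr s) \<partial>M) (1 / s)) s \<le> epow 1 s"
    using le s \<sigma> by (intro epow_mono) (auto simp: Lp_norm_ereal)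
  then have 1: "(\<integral>\<^sup>+x. ennreal (norm (f x) powr s) \<partial>M) \<le> 1"
    using s \<sigma> by (simp add: epow_epow)
  have "(\<integral>\<^sup>+x. ennreal (norm (f x) powr \<sigma>) \<partial>M) \<le> (\<integral>\<^sup>+x. 1 + ennreal (norm (f x) powr s) \<partial>M)"
  proof (rule nn_integral_mono)
    fix x
    have "norm (f x) powr \<sigma> \<le> 1 + norm (f x) powr s"
    proof (cases "norm (f x) \<le> 1")
      case True
      then have "norm (f x) powr \<sigma> \<le> 1 powr \<sigma>" using \<sigma> by (intro powr_mono2) auto
      then show ?thesis by (simp add: add_increasing2)
    next
      case False
      then have "norm (f x) powr \<sigma> \<le> norm (f x) powr s" using s by (intro powr_mono) auto
      then show ?thesis by simp
    qed
    then show "ennreal (norm (f x) powr \<sigma>) \<le> 1 + ennreal (norm (f x) powr s)"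
      by (simp flip: ennreal_1 ennreal_plus)
  qed
  also have "\<dots> = 1 + (\<integral>\<^sup>+x. ennreal (norm (f x) powr s) \<partial>M)"
    by (simp add: nn_integral_add emeasure_space_1)
  also have "\<dots> \<le> 1 + 1" using 1 by (intro add_mono) auto
  finally show ?thesis by (simp add: one_add_one)
qed

lemma borel_measurable_inv_fourier_torus:
  fixes F :: "(real \<times> real) ^ 'n::finite \<Rightarrow> complex"
  assumes F: "F \<in> borel_measurable torus_measure"
  shows "inv_fourier torus_measure F \<in> borel_measurable borel"
proof -
  have "inv_fourier torus_measure F = osc circle_PiM vec_lambda (\<lambda>u. F (vec_lambda u))"
    by (simp add: fun_eq_iff inv_fourier_torus_osc[OF F])
  moreover have "sigma_finite_measure (circle_PiM :: ('n \<Rightarrow> real \<times> real) measure)"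
    by (intro prob_space_imp_sigma_finite prob_space_PiM prob_space_circle_measure)
  ultimately show ?thesis
    using borel_measurable_osc[OF vec_lambda_measurable_borel circle_PiM_vec_measurable[OF F]] by simp
qed

lemma norm_inv_fourier_torus_le:
  fixes F :: "(real \<times> real) ^ 'n::finite \<Rightarrow> complex"
  assumes F: "F \<in> borel_measurable torus_measure"
  shows "ennreal (norm (inv_fourier torus_measure F x)) \<le> (\<integral>\<^sup>+\<xi>. ennreal (norm (F \<xi>)) \<partial>torus_measure)"
proof (cases "integrable torus_measure F")
  case True
  have "norm (inv_fourier torus_measure F x) \<le>
      (LINT \<xi>|torus_measure. norm (exp (2 * complex_of_real pi * \<i> * complex_of_real (x \<bullet> \<xi>)) * F \<xi>))"
    unfolding inv_fourier_def by (rule integral_norm_bound)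
  also have "\<dots> = (LINT \<xi>|torus_measure. norm (F \<xi>))"
    by (simp add: norm_mult)
  also have "ennreal \<dots> = (\<integral>\<^sup>+\<xi>. ennreal (norm (F \<xi>)) \<partial>torus_measure)"
    using True by (intro nn_integral_eq_integral[symmetric]) auto
  finally show ?thesis by (simp add: ennreal_leI)
next
  case False
  then have "(\<integral>\<^sup>+\<xi>. ennreal (norm (F \<xi>)) \<partial>torus_measure) = \<infinity>"
    using F by (simp add: integrable_iff_bounded less_top[symmetric])
  then show ?thesis by simp
qed

text \<open>Dividing F by L + e / C instead of its norm L covers L = 0 along with the other cases.
  The price is exactly the additive term e, which \<open>ennreal_le_epsilon\<close> removes.\<close>

lemma extension_homogenise:
  fixes C :: real
  assumes C: "C > 0" and p: "p = \<infinity> \<or> (\<exists>s>0. p = ereal s)" and q: "q = \<infinity> \<or> (\<exists>s>0. q = ereal s)"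
    and norm: "\<And>F. F \<in> borel_measurable (torus_measure :: ((real \<times> real) ^ 'n::finite) measure) \<Longrightarrow>
      Lp_norm q torus_measure F \<le> 1 \<Longrightarrow> Lp_norm p lborel (inv_fourier torus_measure F) \<le> ennreal C"
    and F: "F \<in> Lp_space q (torus_measure :: ((real \<times> real) ^ 'n) measure)"
  shows "Lp_norm p lborel (inv_fourier torus_measure F) \<le> ennreal C * Lp_norm q torus_measure F"
proof (rule ennreal_le_epsilon)
  fix e :: real assume e: "e > 0"
  have Fm: "F \<in> borel_measurable torus_measure" and fin: "Lp_norm q torus_measure F < \<infinity>"
    using F by (auto simp: Lp_space_def)
  obtain L where L: "L \<ge> 0" "Lp_norm q torus_measure F = ennreal L"
    using fin by (cases "Lp_norm q torus_measure F") auto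
  define c where "c = L + e / C"
  have c: "c > 0" "L \<le> c" using L e C by (auto simp: c_def add_nonneg_pos)
  define F' where "F' = (\<lambda>\<xi>. complex_of_real (1 / c) * F \<xi>)"
  have F'm: "F' \<in> borel_measurable torus_measure"
    unfolding F'_def using Fm by (rule borel_measurable_times[OF borel_measurable_const])
  have "Lp_norm q torus_measure F' \<le> ennreal (1 / c) * ennreal L"
    unfolding F'_def L(2)[symmetric] using c by (intro Lp_norm_scale_le Fm q) auto
  also have "\<dots> = ennreal (L / c)" using c L by (simp flip: ennreal_mult)
  also have "\<dots> \<le> 1" using c by simp
  finally have 1: "Lp_norm p lborel (inv_fourier torus_measure F') \<le> ennreal C"
    by (intro norm F'm)
  have "inv_fourier torus_measure F = (\<lambda>x. complex_of_real c * inv_fourier torus_measure F' x)"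
  proof
    fix x
    have "complex_of_real c * inv_fourier torus_measure F' x =
        (LINT \<xi>|torus_measure. complex_of_real c * (exp (2 * complex_of_real pi * \<i> * complex_of_real (x \<bullet> \<xi>)) * F' \<xi>))"
      unfolding inv_fourier_def by (rule integral_mult_right_zero[symmetric])
    also have "\<dots> = inv_fourier torus_measure F x"
      using c unfolding inv_fourier_def F'_def by (intro Bochner_Integration.integral_cong) auto
    finally show "inv_fourier torus_measure F x = complex_of_real c * inv_fourier torus_measure F' x" ..
  qed
  then have "Lp_norm p lborel (inv_fourier torus_measure F) \<le> ennreal c * Lp_norm p lborel (inv_fourier torus_measure F')"
    using Lp_norm_scale_le[of "inv_fourier torus_measure F'" lborel c p] borel_measurable_inv_fourier_torus[OF F'm] c p
    by simp
  also have "\<dots> \<le> ennreal c * ennreal C"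
    by (intro mult_left_mono 1) simp
  also have "\<dots> = ennreal C * Lp_norm q torus_measure F + ennreal e"
    using L e C c unfolding L(2) by (simp add: c_def distrib_left mult.commute flip: ennreal_mult ennreal_plus)
  finally show "Lp_norm p lborel (inv_fourier torus_measure F) \<le> ennreal C * Lp_norm q torus_measure F + ennreal e" .
qed

lemma Lp_norm_const_one:
  assumes "prob_space M" and q: "q = \<infinity> \<or> (\<exists>s>0. q = ereal s)"
  shows "Lp_norm q M (\<lambda>_. 1 :: complex) \<le> 1"
proof -
  interpret prob_space M by fact
  show ?thesis
    using q by (auto simp: Lp_norm_infinity Lp_norm_ereal emeasure_space_1 intro!: esssup_I)
qed

text \<open>The transform of a probability measure is at most 1 in modulus, so lower powers are
  larger, and divergence at the exponent 4 spreads to all smaller ones.\<close>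

lemma extension_fails_small_exponent:
  fixes r :: real
  assumes r: "0 < r" "r \<le> 4"
  shows "Lp_norm (ereal r) lborel (inv_fourier (torus_measure :: ((real \<times> real) ^ 'n::finite) measure) (\<lambda>_. 1)) = \<infinity>"
proof -
  let ?H = "inv_fourier (torus_measure :: ((real \<times> real) ^ 'n) measure) (\<lambda>_. 1)"
  interpret T: prob_space "torus_measure :: ((real \<times> real) ^ 'n) measure" by (rule prob_space_torus_measure)
  have "(\<integral>\<^sup>+x. ennreal (norm (?H x) ^ 4) \<partial>lborel) \<le> (\<integral>\<^sup>+x. ennreal (norm (?H x) powr r) \<partial>lborel)"
  proof (intro nn_integral_mono ennreal_leI)
    fix x
    have "ennreal (norm (?H x)) \<le> 1"
      using norm_inv_fourier_torus_le[of "\<lambda>_. 1" x] by (simp add: T.emeasure_space_1[simplified])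
    then have "norm (?H x) \<le> 1" by simp
    then have "norm (?H x) powr 4 \<le> norm (?H x) powr r"
      using r by (intro powr_mono') auto
    then show "norm (?H x) ^ 4 \<le> norm (?H x) powr r"
      by (cases "?H x = 0") auto
  qed
  then have "(\<integral>\<^sup>+x. ennreal (norm (?H x) powr r) \<partial>lborel) = \<infinity>"
    unfolding inv_fourier_torus_one_not_L4 by (simp add: top_unique)
  then show ?thesis unfolding Lp_norm_ereal by (simp only: epow_top)
qed

text \<open>Knapp's example: the transform of the indicator of a cap of side \<open>\<delta>\<close> is comparable to its value at the origin
  on a box of volume \<open>\<delta>\<^sup>-\<^sup>3\<^sup>n\<close>.\<close>

lemma Knapp:
  fixes r s C :: real
  assumes r: "r > 3" and s: "s \<ge> 1" "s < r / (r - 3)" and C: "C > 0"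
  obtains F where "F \<in> Lp_space (ereal s) (torus_measure :: ((real \<times> real) ^ 'n::finite) measure)"
    "\<not> Lp_norm (ereal r) lborel (inv_fourier torus_measure F) \<le> ennreal C * Lp_norm (ereal s) torus_measure F"
proof -
  let ?n = "real CARD('n)"
  let ?T = "torus_measure :: ((real \<times> real) ^ 'n) measure"
  interpret T: prob_space ?T by (rule prob_space_torus_measure)
  define b where "b = 1 / (24 * ?n)"
  have b: "b > 0" by (simp add: b_def)
  \<comment> \<open>The condition s < r / (r - 3) reads 1 - 1 / s < 3 / r: the gain \<delta>^(-3 n /
    r) from the volume of the dual box outweighs the loss \<delta>^(n \<theta>) from the measure of
    the cap.\<close>
  define \<theta> where "\<theta> = 1 - 1 / s"
  have \<theta>: "\<theta> \<ge> 0" "\<theta> < 3 / r"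
    using r s by (auto simp: \<theta>_def field_simps)
  define K where "K = (1 / 5) powr (?n * \<theta>) * (4 * b\<^sup>2) powr (?n / r)"
  have K: "K > 0" using b by (simp add: K_def)
  define \<eta> where "\<eta> = ?n * (3 / r - \<theta>)"
  have \<eta>: "\<eta> > 0" using \<theta> by (simp add: \<eta>_def)
  \<comment> \<open>At \<delta> = y the quantity K \<delta>^(-\<eta>) equals 4 C, twice the 2 C that
    has to be exceeded, and it only grows for smaller \<delta>. The minimum with 1 keeps the cap
    estimates applicable.\<close>
  define y where "y = (4 * C / K) powr (- 1 / \<eta>)"
  have y: "y > 0" "y powr (- \<eta>) = 4 * C / K"
    using C K \<eta> by (auto simp: y_def powr_powr)
  define \<delta> where "\<delta> = min 1 y"
  have \<delta>: "0 < \<delta>" "\<delta> \<le> 1" using y by (auto simp: \<delta>_def)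
  have "4 * C / K \<le> \<delta> powr (- \<eta>)"
    unfolding y(2)[symmetric] using \<delta> \<eta> by (intro powr_mono2') (auto simp: \<delta>_def)
  then have big: "2 * C < K * \<delta> powr (- \<eta>)"
    using K C by (simp add: divide_le_eq mult.commute)
  let ?Q = "torus_cap \<delta> :: ((real \<times> real) ^ 'n) set"
  obtain \<alpha> where \<alpha>: "\<alpha> \<ge> \<delta> / 5" "emeasure ?T ?Q = ennreal (\<alpha> ^ CARD('n))"
    using measure_torus_cap[OF \<delta>] by blast
  have \<alpha>0: "\<alpha> > 0" using \<alpha> \<delta> by linarith
  define m where "m = \<alpha> powr ?n"
  have m: "m > 0" "emeasure ?T ?Q = ennreal m" "measure ?T ?Q = m"
    using \<alpha> \<alpha>0 by (auto simp: m_def powr_realpow measure_def)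
  define V where "V = (4 * b\<^sup>2 / \<delta> powr 3) powr ?n"
  have V: "V > 0" using b \<delta> by (simp add: V_def)
  define F where "F = (indicator ?Q :: _ \<Rightarrow> complex)"
  have Fm: "F \<in> borel_measurable ?T"
    unfolding F_def by (intro borel_measurable_indicator torus_cap_sets)
  have "(\<integral>\<^sup>+\<xi>. ennreal (norm (F \<xi>) powr s) \<partial>?T) = (\<integral>\<^sup>+\<xi>. indicator ?Q \<xi> \<partial>?T)"
    using s by (intro nn_integral_cong) (auto simp: F_def indicator_def)
  also have "\<dots> = ennreal m"
    using m(2) by (subst nn_integral_indicator[OF torus_cap_sets])
  finally have FL: "Lp_norm (ereal s) ?T F = ennreal (m powr (1 / s))"
    using m by (simp add: Lp_norm_ereal epow_ennreal)
  have "ennreal (((m / 2) powr r) * V) = (\<integral>\<^sup>+x. ennreal ((m / 2) powr r) * indicator (dual_box (b / \<delta>\<^sup>2) (b / \<delta>) :: ((real \<times> real) ^ 'n) set) x \<partial>lborel)"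
  proof -
    have "emeasure lborel (dual_box (b / \<delta>\<^sup>2) (b / \<delta>) :: ((real \<times> real) ^ 'n) set) = ennreal V"
    proof -
      have "4 * (b / \<delta>\<^sup>2) * (b / \<delta>) = 4 * b\<^sup>2 / \<delta> powr 3"
        using \<delta> by (simp add: powr_numeral power2_eq_square power3_eq_cube)
      moreover have "4 * b\<^sup>2 / \<delta> powr 3 > 0" using b \<delta> by simp
      ultimately show ?thesis
        using emeasure_dual_box[of "b / \<delta>\<^sup>2" "b / \<delta>", where 'n='n] b \<delta>
        by (simp add: V_def powr_realpow)
    qed
    then show ?thesis
      using V by (subst nn_integral_cmult_indicator) (auto simp: ennreal_mult dual_box_eq_cbox)
  qed
  also have "\<dots> \<le> (\<integral>\<^sup>+x. ennreal (norm (inv_fourier ?T F x) powr r) \<partial>lborel)"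
  proof (rule nn_integral_mono)
    fix x
    show "ennreal ((m / 2) powr r) * indicator (dual_box (b / \<delta>\<^sup>2) (b / \<delta>)) x \<le> ennreal (norm (inv_fourier ?T F x) powr r)"
    proof (cases "x \<in> dual_box (b / \<delta>\<^sup>2) (b / \<delta>)")
      case True
      then have "m / 2 \<le> norm (inv_fourier ?T F x)"
        using inv_fourier_cap_lower_bound[OF \<delta> b_def] m by (simp add: F_def)
      then show ?thesis
        using True m r by (simp add: ennreal_leI powr_mono2)
    qed simp
  qed
  finally have "epow (ennreal (((m / 2) powr r) * V)) (1 / r) \<le> Lp_norm (ereal r) lborel (inv_fourier ?T F)"
    unfolding Lp_norm_ereal using r by (intro epow_mono) auto
  moreover have "epow (ennreal (((m / 2) powr r) * V)) (1 / r) = ennreal (m / 2 * V powr (1 / r))"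
    using m V r by (simp add: epow_ennreal powr_mult powr_powr)
  ultimately have lower: "ennreal (m / 2 * V powr (1 / r)) \<le> Lp_norm (ereal r) lborel (inv_fourier ?T F)"
    by simp
  \<comment> \<open>After division by m^(1/s) / 2 this is 2 C < m^\<theta> V^(1/r), and the right
    side is at least K \<delta>^(-\<eta>) by the lower bound on \<alpha>.\<close>
  have "C * m powr (1 / s) < m / 2 * V powr (1 / r)"
  proof -
    have "K * \<delta> powr (- \<eta>) = (\<delta> / 5) powr (?n * \<theta>) * V powr (1 / r)"
    proof -
      have "V powr (1 / r) = (4 * b\<^sup>2) powr (?n / r) * \<delta> powr (- (3 * ?n / r))"
        using \<delta> b by (simp add: V_def powr_powr powr_divide powr_minus_divide del: powr_numeral)
      moreover have "(\<delta> / 5) powr (?n * \<theta>) = \<delta> powr (?n * \<theta>) * (1 / 5) powr (?n * \<theta>)"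
        using \<delta> by (simp add: powr_divide)
      moreover have "\<delta> powr (- \<eta>) = \<delta> powr (?n * \<theta>) * \<delta> powr (- (3 * ?n / r))"
        by (simp add: \<eta>_def algebra_simps flip: powr_add)
      ultimately show ?thesis by (simp add: K_def)
    qed
    also have "\<dots> \<le> \<alpha> powr (?n * \<theta>) * V powr (1 / r)"
      using \<alpha> \<delta> \<theta> by (intro mult_right_mono powr_mono2) auto
    also have "\<alpha> powr (?n * \<theta>) = m powr \<theta>"
      by (simp add: m_def powr_powr)
    finally have "2 * C < m powr \<theta> * V powr (1 / r)" using big by simp
    then have "m powr (1 / s) * (2 * C) < m powr (1 / s) * (m powr \<theta> * V powr (1 / r))"
      using m by (intro mult_strict_left_mono) auto
    also have "\<dots> = m * V powr (1 / r)"
      using m by (simp add: \<theta>_def powr_diff)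
    finally show ?thesis by (simp add: algebra_simps)
  qed
  then have "ennreal C * Lp_norm (ereal s) ?T F < ennreal (m / 2 * V powr (1 / r))"
    unfolding FL using C m V by (subst ennreal_mult[symmetric]) (auto intro!: ennreal_lessI)
  with lower have "\<not> Lp_norm (ereal r) lborel (inv_fourier ?T F) \<le> ennreal C * Lp_norm (ereal s) ?T F"
    by (simp add: not_le)
  moreover have "F \<in> Lp_space (ereal s) ?T"
    using Fm FL by (simp add: Lp_space_def)
  ultimately show ?thesis using that by blast
qed

theorem corollary3p1:
  fixes p q :: real and p' q' :: ereal
  assumes "CARD('n::finite) \<ge> 2"
    and "1 \<le> p" and "1 \<le> q"
    and "p' = conj_exp (ereal p)" and "q' = conj_exp (ereal q)"
  shows "(\<exists>C::real. C > 0 \<and>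
            (\<forall>F \<in> Lp_space q' (torus_measure :: ((real \<times> real) ^ 'n) measure).
               Lp_norm p' lborel (inv_fourier torus_measure F)
                 \<le> ennreal C * Lp_norm q' torus_measure F))
         \<longleftrightarrow> p' > 4 \<and> q' \<ge> conj_exp (p' / 3)" (is "?L \<longleftrightarrow> ?R")
proof -
  let ?T = "torus_measure :: ((real \<times> real) ^ 'n) measure"
  have q': "q' = \<infinity> \<or> (\<exists>s\<ge>1. q' = ereal s)"
  proof (cases "q = 1")
    case False
    then have "q' = ereal (q / (q - 1))" "q / (q - 1) \<ge> 1"
      using assms by (auto simp: conj_exp_ereal)
    then show ?thesis by blast
  qed (use assms in \<open>simp flip: one_ereal_def\<close>)
  then have q'0: "q' = \<infinity> \<or> (\<exists>s>0. q' = ereal s)" and q'1: "q' \<ge> 1"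
    by (force, auto simp: one_ereal_def)
  show ?thesis
  proof (cases "p = 1")
    \<comment> \<open>Here p' = \<infinity> and both sides hold: the condition on q' reduces to q'
      \<ge> 1, and a function of norm at most 1 has an integral of modulus at most 2, which bounds
      its transform everywhere.\<close>
    case True
    then have p': "p' = \<infinity>" using assms by (simp flip: one_ereal_def)
    have R: ?R using q'1 by (simp add: p')
    have "Lp_norm p' lborel (inv_fourier ?T F) \<le> ennreal 2"
      if F: "F \<in> borel_measurable ?T" "Lp_norm q' ?T F \<le> 1" for F
    proof -
      have "(\<integral>\<^sup>+\<xi>. ennreal (norm (F \<xi>) powr 1) \<partial>?T) \<le> 2"
        using q' by (intro nn_integral_powr_le_2[OF prob_space_torus_measure F(1) _ _ F(2)]) auto
      then have "ennreal (norm (inv_fourier ?T F x)) \<le> ennreal 2" for x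
        using norm_inv_fourier_torus_le[OF F(1), of x] by (simp add: order_trans)
      then show ?thesis
        unfolding p' Lp_norm_infinity
        using borel_measurable_inv_fourier_torus[OF F(1)] by (intro esssup_I) auto
    qed
    then have "\<forall>F \<in> Lp_space q' ?T. Lp_norm p' lborel (inv_fourier ?T F) \<le> ennreal 2 * Lp_norm q' ?T F"
      using p' by (intro ballI extension_homogenise q'0) auto
    then have ?L by (intro exI[of _ 2]) auto
    with R show ?thesis by blast
  next
    case False
    define r where "r = p / (p - 1)"
    have p': "p' = ereal r" and r1: "r > 1"
      using assms False by (auto simp: r_def conj_exp_ereal)
    have conj: "conj_exp (p' / 3) = ereal (r / (r - 3))" if "r > 4"
    proof -
      have "p' / 3 = ereal (r / 3)" by (simp add: p')
      then have "conj_exp (p' / 3) = ereal (r / 3 / (r / 3 - 1))"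
        using that by (simp add: conj_exp_ereal)
      also have "r / 3 / (r / 3 - 1) = r / (r - 3)" using that by (simp add: field_simps)
      finally show ?thesis .
    qed
    show ?thesis
    proof
      assume ?L
      then obtain C where C: "C > 0" and le: "\<And>F. F \<in> Lp_space q' ?T \<Longrightarrow>
          Lp_norm p' lborel (inv_fourier ?T F) \<le> ennreal C * Lp_norm q' ?T F"
        by blast
      have r4: "r > 4"
      proof (rule ccontr)
        assume "\<not> r > 4"
        then have "Lp_norm p' lborel (inv_fourier ?T (\<lambda>_. 1)) = \<infinity>"
          unfolding p' using r1 by (intro extension_fails_small_exponent) auto
        moreover have one: "Lp_norm q' ?T (\<lambda>_. 1 :: complex) \<le> 1"
          by (rule Lp_norm_const_one[OF prob_space_torus_measure q'0])
        then have "Lp_norm q' ?T (\<lambda>_. 1 :: complex) < \<infinity>"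
          by (rule le_less_trans) simp
        then have "(\<lambda>_. 1 :: complex) \<in> Lp_space q' ?T"
          by (simp add: Lp_space_def)
        ultimately have "\<infinity> \<le> ennreal C * Lp_norm q' ?T (\<lambda>_. 1 :: complex)"
          using le[of "\<lambda>_. 1"] by simp
        also have "\<dots> \<le> ennreal C * 1" by (intro mult_left_mono one) simp
        finally show False by (simp add: top_unique)
      qed
      moreover have "q' \<ge> ereal (r / (r - 3))"
      proof (rule ccontr)
        assume *: "\<not> q' \<ge> ereal (r / (r - 3))"
        \<comment> \<open>An infinite q' cannot violate the inequality, so q' is real and Knapp's
          example applies with the given constant C.\<close>
        then obtain s where s: "s \<ge> 1" "q' = ereal s" using q' by auto
        then have "s < r / (r - 3)" using * by simp
        then obtain F where "F \<in> Lp_space (ereal s) ?T"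
          "\<not> Lp_norm (ereal r) lborel (inv_fourier ?T F) \<le> ennreal C * Lp_norm (ereal s) ?T F"
          using Knapp[of r s C] r4 s(1) C by auto
        then show False using le[of F] s p' by simp
      qed
      ultimately show ?R using conj p' by simp
    next
      assume R: ?R
      then have r4: "r > 4" by (simp add: p')
      have qc: "q' \<ge> ereal (r / (r - 3))" using R conj[OF r4] by simp
      obtain C0 where C0: "C0 > 0" and ext: "\<And>F. F \<in> borel_measurable ?T \<Longrightarrow>
          (\<integral>\<^sup>+\<xi>. ennreal (norm (F \<xi>) powr (r / (r - 3))) \<partial>?T) \<le> 2 \<Longrightarrow>
          (\<integral>\<^sup>+x. ennreal (norm (inv_fourier ?T F x) powr r) \<partial>lborel) \<le> ennreal C0"
        using torus_extension_normalised[OF r4, where 'n='n] by blast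
      define C where "C = C0 powr (1 / r)"
      have C: "C > 0" using C0 by (simp add: C_def)
      have "Lp_norm p' lborel (inv_fourier ?T F) \<le> ennreal C"
        if F: "F \<in> borel_measurable ?T" "Lp_norm q' ?T F \<le> 1" for F
      proof -
        have "(\<integral>\<^sup>+\<xi>. ennreal (norm (F \<xi>) powr (r / (r - 3))) \<partial>?T) \<le> 2"
          using q' qc r4 by (intro nn_integral_powr_le_2[OF prob_space_torus_measure F(1) _ _ F(2)]) auto
        then have "epow (\<integral>\<^sup>+x. ennreal (norm (inv_fourier ?T F x) powr r) \<partial>lborel) (1 / r) \<le> epow (ennreal C0) (1 / r)"
          using r4 by (intro epow_mono ext F) auto
        then show ?thesis
          using C0 by (simp add: p' Lp_norm_ereal epow_ennreal C_def)
      qed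
      then have "\<forall>F \<in> Lp_space q' ?T. Lp_norm p' lborel (inv_fourier ?T F) \<le> ennreal C * Lp_norm q' ?T F"
        using p' r4 C by (intro ballI extension_homogenise q'0) auto
      with C show ?L by blast
    qed
  qed
qed

end
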